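(* Let $\Omega\subset\mathbb R^d$ be non-empty and open, and let $0\le a,q\in L^1_{\rm loc}(\Omega)$. Suppose there exist $\nu>0$ and $C>0$ such that for all $F=(f,g)\in\mathcal H$ and all $t\ge 0$ the (mild) solution $u(t)$ of the damped wave equation $\partial_{tt}u+a\,\partial_t u=(\Delta-q)u$ in $\Omega$ with Dirichlet boundary condition and initial data $(u(0),\partial_tu(0))=(f,g)$ satisfies $$\|\nabla u(t)\|_{L^2}+\|q^{1/2}u(t)\|_{L^2}+\|\partial_tu(t)\|_{L^2}\le C e^{-\nu t}\|F\|_{\mathcal H}. \qquad ( * )$$ Then there exists $M>0$ such that $$\|a^{1/2}\varphi\|_{L^2}^2+\|\varphi\|_{L^2}^2\le M\left(\|\nabla\varphi\|_{L^2}^2+\|q^{1/2}\varphi\|_{L^2}^2\right),\qquad \varphi\in C_c^\infty(\Omega). \qquad ( ** )$$ Moreover, if there is a constant $a_0>0$ with $a(x)\ge a_0$ for a.e. $x\in\Omega$, then the reverse implication holds, so that in this case the existence of $\nu,C>0$ as in $( * )$ (for all $F\in\mathcal H$, $t\ge0$) is equivalent to the existence of $M>0$ as in $( ** )$.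
   Context: All function spaces are complex. For measurable $m\ge0$ on $\Omega$, $\mathrm{Dom}(m^{1/2})=\{u\in L^2(\Omega): m^{1/2}u\in L^2(\Omega)\}$. $\mathcal W$ is the Hilbert completion of $C_c^\infty(\Omega)$ with respect to the norm $\|u\|_{\mathcal W}^2=\|\nabla u\|_{L^2}^2+\|q^{1/2}u\|_{L^2}^2$; for $u\in\mathcal W$, $\nabla u$ and $q^{1/2}u$ denote the $L^2$-limits along a Cauchy sequence representing $u$. $\mathcal W^*$ is the space of bounded antilinear functionals on $\mathcal W$. The energy space is $\mathcal H=\mathcal W\oplus L^2(\Omega)$ with $\|(f,g)\|_{\mathcal H}^2=\|f\|_{\mathcal W}^2+\|g\|_{L^2}^2$. $\mathcal D_{\mathfrak t}=H_0^1(\Omega)\cap\mathrm{Dom}(q^{1/2})\cap\mathrm{Dom}(a^{1/2})$ with norm $\|u\|_{\mathcal D_{\mathfrak t}}^2=\|\nabla u\|_{L^2}^2+\|q^{1/2}u\|_{L^2}^2+\|a^{1/2}u\|_{L^2}^2+\|u\|_{L^2}^2$. $C_c^\infty(\Omega)$ is dense in $\mathcal D_{\mathfrak t}$, and $\mathcal D_{\mathfrak t}$ is boundedly embedded in $\mathcal W$ and in $L^2(\Omega)$; by duality $\mathcal W^*\subset\mathcal D_{\mathfrak t}^*$ and $L^2(\Omega)\subset\mathcal D_{\mathfrak t}^*$. The operators $\Delta-q\in\mathcal B(\mathcal W,\mathcal W^* )$ and $a\in\mathcal B(\mathcal D_{\mathfrak t},\mathcal D_{\mathfrak t}^* )$ are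 defined by $((\Delta-q)u,v)=-\langle\nabla u,\nabla v\rangle_{L^2}-\langle q^{1/2}u,q^{1/2}v\rangle_{L^2}$ and $(au,v)=\int_\Omega a u\overline v\,dx$. The generator $\mathcal A$ in $\mathcal H$ is $\mathcal A(f,g)=(g,(\Delta-q)f-ag)$ with $\mathrm{Dom}(\mathcal A)=\{(f,g)\in\mathcal W\times\mathcal D_{\mathfrak t}:(\Delta-q)f-ag\in L^2(\Omega)\}$. It is known that $\mathcal A$ is densely defined and m-dissipative, so it generates a $C_0$-contraction semigroup $e^{t\mathcal A}$ on $\mathcal H$. The (mild) solution with initial data $F=(f,g)\in\mathcal H$ is the first component $u(t)$ of $U(t)=e^{t\mathcal A}F$, and $U(t)=(u(t),\partial_tu(t))$. *)

theory Defs
  imports "HOL-Analysis.Analysis" "HOL-Library.Function_Algebras"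
begin

text \<open>
  Elements of the \<open>L\<^sup>2\<close>-type spaces below are represented by functions, and two functions that
  agree almost everywhere on \<open>\<Omega>\<close> represent the same element; accordingly equality of elements is
  always expressed by an almost-everywhere equality or by a vanishing seminorm. Sums and differences
  of functions and of tuples of functions are pointwise (\<open>HOL-Library.Function_Algebras\<close>).
\<close>

definition L2 :: "'a::euclidean_space set \<Rightarrow> ('a \<Rightarrow> 'b::euclidean_space) set" where
  "L2 \<Omega> = {u \<in> borel_measurable (lebesgue_on \<Omega>).
              integrable (lebesgue_on \<Omega>) (\<lambda>x. (norm (u x))\<^sup>2)}"

definition L2_norm :: "'a::euclidean_space set \<Rightarrow> ('a \<Rightarrow> 'b::euclidean_space) \<Rightarrow> real" where
  "L2_norm \<Omega> u = sqrt (\<integral>x. (norm (u x))\<^sup>2 \<partial>lebesgue_on \<Omega>)"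

definition L2_inner :: "'a::euclidean_space set \<Rightarrow> ('a \<Rightarrow> complex) \<Rightarrow> ('a \<Rightarrow> complex) \<Rightarrow> complex" where
  "L2_inner \<Omega> u v = (\<integral>x. u x * cnj (v x) \<partial>lebesgue_on \<Omega>)"

definition L2_inner_vec ::
    "'a::euclidean_space set \<Rightarrow> ('a \<Rightarrow> complex^'d) \<Rightarrow> ('a \<Rightarrow> complex^'d) \<Rightarrow> complex" where
  "L2_inner_vec \<Omega> G H = (\<integral>x. (\<Sum>i\<in>UNIV. G x $ i * cnj (H x $ i)) \<partial>lebesgue_on \<Omega>)"

definition L1_loc :: "(real^'d) set \<Rightarrow> (real^'d \<Rightarrow> real) set" where
  "L1_loc \<Omega> = {m. \<forall>K. compact K \<and> K \<subseteq> \<Omega> \<longrightarrow> m absolutely_integrable_on K}"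

definition sqrt_mult :: "('a \<Rightarrow> real) \<Rightarrow> ('a \<Rightarrow> complex) \<Rightarrow> 'a \<Rightarrow> complex" where
  "sqrt_mult m u = (\<lambda>x. sqrt (m x) *\<^sub>R u x)"

definition Dom_sqrt :: "'a::euclidean_space set \<Rightarrow> ('a \<Rightarrow> real) \<Rightarrow> ('a \<Rightarrow> complex) set" where
  "Dom_sqrt \<Omega> m = {u \<in> L2 \<Omega>. sqrt_mult m u \<in> L2 \<Omega>}"


definition partial_deriv :: "'d::finite \<Rightarrow> (real^'d \<Rightarrow> complex) \<Rightarrow> real^'d \<Rightarrow> complex" where
  "partial_deriv i \<phi> x = frechet_derivative \<phi> (at x) (axis i 1)"

definition grad :: "(real^'d \<Rightarrow> complex) \<Rightarrow> real^'d \<Rightarrow> complex^'d" where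
  "grad \<phi> x = (\<chi> i. partial_deriv i \<phi> x)"

fun C_k :: "nat \<Rightarrow> (real^'d \<Rightarrow> complex) \<Rightarrow> bool" where
  "C_k 0 \<phi> \<longleftrightarrow> continuous_on UNIV \<phi>"
| "C_k (Suc k) \<phi> \<longleftrightarrow> (\<forall>x. \<phi> differentiable (at x)) \<and> (\<forall>i. C_k k (partial_deriv i \<phi>))"

text \<open>The space \<open>C\<^sub>c\<^sup>\<infinity>(\<Omega>)\<close>; its members are extended by zero to the whole space.\<close>

definition test_functions :: "(real^'d) set \<Rightarrow> (real^'d \<Rightarrow> complex) set" where
  "test_functions \<Omega> = {\<phi>. (\<forall>k. C_k k \<phi>) \<and> compact (closure {x. \<phi> x \<noteq> 0})
                              \<and> closure {x. \<phi> x \<noteq> 0} \<subseteq> \<Omega>}"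

definition has_weak_gradient ::
    "(real^'d) set \<Rightarrow> (real^'d \<Rightarrow> complex) \<Rightarrow> (real^'d \<Rightarrow> complex^'d) \<Rightarrow> bool" where
  "has_weak_gradient \<Omega> u G \<longleftrightarrow> (\<forall>\<phi>\<in>test_functions \<Omega>. \<forall>i.
     (\<integral>x. u x * partial_deriv i \<phi> x \<partial>lebesgue_on \<Omega>) = - (\<integral>x. G x $ i * \<phi> x \<partial>lebesgue_on \<Omega>))"

text \<open>
  \<open>H01_grad \<Omega> u G\<close>: the function \<open>u\<close> lies in \<open>H\<^sub>0\<^sup>1(\<Omega>)\<close>, the closure of \<open>C\<^sub>c\<^sup>\<infinity>(\<Omega>)\<close> in \<open>H\<^sup>1(\<Omega>)\<close>,
  and \<open>G = \<nabla>u\<close>.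
\<close>

definition H01_grad ::
    "(real^'d) set \<Rightarrow> (real^'d \<Rightarrow> complex) \<Rightarrow> (real^'d \<Rightarrow> complex^'d) \<Rightarrow> bool" where
  "H01_grad \<Omega> u G \<longleftrightarrow> u \<in> L2 \<Omega> \<and> G \<in> L2 \<Omega> \<and> has_weak_gradient \<Omega> u G \<and>
     (\<exists>\<phi>. (\<forall>n. \<phi> n \<in> test_functions \<Omega>) \<and>
          (\<lambda>n. L2_norm \<Omega> (\<phi> n - u)) \<longlonglongrightarrow> 0 \<and>
          (\<lambda>n. L2_norm \<Omega> (grad (\<phi> n) - G)) \<longlonglongrightarrow> 0)"

text \<open>The form domain \<open>\<D>\<^sub>\<tt>\<close>.\<close>

definition form_domain ::
    "(real^'d) set \<Rightarrow> (real^'d \<Rightarrow> real) \<Rightarrow> (real^'d \<Rightarrow> real) \<Rightarrow> (real^'d \<Rightarrow> complex) set" where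
  "form_domain \<Omega> a q = {u. \<exists>G. H01_grad \<Omega> u G} \<inter> Dom_sqrt \<Omega> q \<inter> Dom_sqrt \<Omega> a"

text \<open>
  The completion \<open>\<W>\<close> of \<open>C\<^sub>c\<^sup>\<infinity>(\<Omega>)\<close>. The map \<open>\<phi> \<mapsto> (\<nabla>\<phi>, q\<^sup>1\<^sup>/\<^sup>2\<phi>)\<close> is an isometry of \<open>C\<^sub>c\<^sup>\<infinity>(\<Omega>)\<close> with the
  \<open>\<W>\<close>-norm into the complete space \<open>L\<^sup>2(\<Omega>)\<^sup>d \<times> L\<^sup>2(\<Omega>)\<close>, so the completion is the closure of its range:
  an element \<open>u\<close> of \<open>\<W>\<close> is the pair \<open>(\<nabla>u, q\<^sup>1\<^sup>/\<^sup>2u)\<close> of the \<open>L\<^sup>2\<close>-limits along a Cauchy sequence of test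
  functions representing \<open>u\<close>. In general \<open>u\<close> itself is not a function on \<open>\<Omega>\<close>.
\<close>

type_synonym 'd w_elem = "(real^'d \<Rightarrow> complex^'d) \<times> (real^'d \<Rightarrow> complex)"

definition W_space :: "(real^'d) set \<Rightarrow> (real^'d \<Rightarrow> real) \<Rightarrow> 'd w_elem set" where
  "W_space \<Omega> q = {(G, p). G \<in> L2 \<Omega> \<and> p \<in> L2 \<Omega> \<and>
     (\<exists>\<phi>. (\<forall>n. \<phi> n \<in> test_functions \<Omega>) \<and>
          (\<lambda>n. L2_norm \<Omega> (grad (\<phi> n) - G)) \<longlonglongrightarrow> 0 \<and>
          (\<lambda>n. L2_norm \<Omega> (sqrt_mult q (\<phi> n) - p)) \<longlonglongrightarrow> 0)}"

abbreviation W_grad :: "'d w_elem \<Rightarrow> real^'d \<Rightarrow> complex^'d" where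
  "W_grad u \<equiv> fst u"

abbreviation W_sqrt_q :: "'d w_elem \<Rightarrow> real^'d \<Rightarrow> complex" where
  "W_sqrt_q u \<equiv> snd u"

definition W_norm :: "(real^'d) set \<Rightarrow> 'd w_elem \<Rightarrow> real" where
  "W_norm \<Omega> u = sqrt ((L2_norm \<Omega> (W_grad u))\<^sup>2 + (L2_norm \<Omega> (W_sqrt_q u))\<^sup>2)"

text \<open>The energy space \<open>\<H> = \<W> \<oplus> L\<^sup>2(\<Omega>)\<close>.\<close>

type_synonym 'd state = "'d w_elem \<times> (real^'d \<Rightarrow> complex)"

definition energy_space :: "(real^'d) set \<Rightarrow> (real^'d \<Rightarrow> real) \<Rightarrow> 'd state set" where
  "energy_space \<Omega> q = W_space \<Omega> q \<times> L2 \<Omega>"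

definition energy_norm :: "(real^'d) set \<Rightarrow> 'd state \<Rightarrow> real" where
  "energy_norm \<Omega> F = sqrt ((W_norm \<Omega> (fst F))\<^sup>2 + (L2_norm \<Omega> (snd F))\<^sup>2)"

fun state_scale :: "complex \<Rightarrow> 'd::finite state \<Rightarrow> 'd state" where
  "state_scale c ((G, p), g) = ((\<lambda>x. c *s G x, \<lambda>x. c * p x), \<lambda>x. c * g x)"


text \<open>
  \<open>damped_wave_op \<Omega> a q F K\<close> is the graph relation \<open>F \<in> Dom(\<A>)\<close>, \<open>\<A> F = K\<close>. For \<open>F = (f, g)\<close> and
  \<open>K = (w, h)\<close> it says that \<open>w\<close> is the image of \<open>g\<close> under the embedding \<open>\<D>\<^sub>\<tt> \<rightarrow> \<W>\<close> and that
  \<open>(\<Delta> - q) f - a g\<close>, a functional on \<open>\<D>\<^sub>\<tt>\<close>, is the element \<open>h\<close> of \<open>L\<^sup>2(\<Omega>)\<close>.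
\<close>

definition damped_wave_op ::
    "(real^'d) set \<Rightarrow> (real^'d \<Rightarrow> real) \<Rightarrow> (real^'d \<Rightarrow> real) \<Rightarrow> 'd state \<Rightarrow> 'd state \<Rightarrow> bool" where
  "damped_wave_op \<Omega> a q F K \<longleftrightarrow>
     (case (F, K) of ((f, g), (w, h)) \<Rightarrow>
        f \<in> W_space \<Omega> q \<and> g \<in> form_domain \<Omega> a q \<and> w \<in> W_space \<Omega> q \<and> h \<in> L2 \<Omega> \<and>
        (\<exists>Dg. H01_grad \<Omega> g Dg \<and>
           (AE x in lebesgue_on \<Omega>. W_grad w x = Dg x \<and> W_sqrt_q w x = sqrt_mult q g x)) \<and>
        (\<forall>v\<in>form_domain \<Omega> a q. \<forall>Dv. H01_grad \<Omega> v Dv \<longrightarrow>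
           L2_inner \<Omega> h v =
             - L2_inner_vec \<Omega> (W_grad f) Dv - L2_inner \<Omega> (W_sqrt_q f) (sqrt_mult q v)
             - (\<integral>x. a x *\<^sub>R (g x * cnj (v x)) \<partial>lebesgue_on \<Omega>)))"

definition C0_contraction_semigroup ::
    "(real^'d) set \<Rightarrow> (real^'d \<Rightarrow> real) \<Rightarrow> (real \<Rightarrow> 'd state \<Rightarrow> 'd state) \<Rightarrow> bool" where
  "C0_contraction_semigroup \<Omega> q T \<longleftrightarrow>
     (\<forall>t\<ge>0. \<forall>F\<in>energy_space \<Omega> q.
        T t F \<in> energy_space \<Omega> q \<and> energy_norm \<Omega> (T t F) \<le> energy_norm \<Omega> F) \<and>
     (\<forall>t\<ge>0. \<forall>F\<in>energy_space \<Omega> q. \<forall>K\<in>energy_space \<Omega> q. \<forall>b c.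
        energy_norm \<Omega> (T t (state_scale b F + state_scale c K)
                        - (state_scale b (T t F) + state_scale c (T t K))) = 0) \<and>
     (\<forall>F\<in>energy_space \<Omega> q. energy_norm \<Omega> (T 0 F - F) = 0) \<and>
     (\<forall>s\<ge>0. \<forall>t\<ge>0. \<forall>F\<in>energy_space \<Omega> q. energy_norm \<Omega> (T (s + t) F - T s (T t F)) = 0) \<and>
     (\<forall>F\<in>energy_space \<Omega> q. ((\<lambda>t. energy_norm \<Omega> (T t F - F)) \<longlongrightarrow> 0) (at_right 0))"

text \<open>The graph of the infinitesimal generator of \<open>T\<close>.\<close>

definition semigroup_generator ::
    "(real^'d) set \<Rightarrow> (real^'d \<Rightarrow> real) \<Rightarrow> (real \<Rightarrow> 'd state \<Rightarrow> 'd state)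
       \<Rightarrow> 'd state \<Rightarrow> 'd state \<Rightarrow> bool" where
  "semigroup_generator \<Omega> q T F K \<longleftrightarrow> F \<in> energy_space \<Omega> q \<and> K \<in> energy_space \<Omega> q \<and>
     ((\<lambda>t. energy_norm \<Omega> (state_scale (of_real (1 / t)) (T t F - F) - K)) \<longlongrightarrow> 0) (at_right 0)"

text \<open>
  \<open>T t = e\<^sup>t\<^sup>\<A>\<close>, so that \<open>T t F = (u(t), \<partial>\<^sub>t u(t))\<close> for the mild solution \<open>u\<close> with initial data \<open>F\<close>.
  Such a \<open>T\<close> exists because \<open>\<A>\<close> is m-dissipative, and a semigroup is determined by its generator,
  so \<open>T\<close> is unique up to almost-everywhere equality.
\<close>

definition damped_wave_semigroup ::
    "(real^'d) set \<Rightarrow> (real^'d \<Rightarrow> real) \<Rightarrow> (real^'d \<Rightarrow> real)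
       \<Rightarrow> (real \<Rightarrow> 'd state \<Rightarrow> 'd state) \<Rightarrow> bool" where
  "damped_wave_semigroup \<Omega> a q T \<longleftrightarrow> C0_contraction_semigroup \<Omega> q T \<and>
     (\<forall>F K. semigroup_generator \<Omega> q T F K \<longleftrightarrow> damped_wave_op \<Omega> a q F K)"

definition decay_estimate ::
    "(real^'d) set \<Rightarrow> (real^'d \<Rightarrow> real) \<Rightarrow> (real \<Rightarrow> 'd state \<Rightarrow> 'd state)
       \<Rightarrow> real \<Rightarrow> real \<Rightarrow> bool" where
  "decay_estimate \<Omega> q T \<nu> C \<longleftrightarrow>
     (\<forall>F\<in>energy_space \<Omega> q. \<forall>t\<ge>0. case T t F of (u, u\<^sub>t) \<Rightarrow>
        L2_norm \<Omega> (W_grad u) + L2_norm \<Omega> (W_sqrt_q u) + L2_norm \<Omega> u\<^sub>t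
          \<le> C * exp (- \<nu> * t) * energy_norm \<Omega> F)"

definition damping_bound ::
    "(real^'d) set \<Rightarrow> (real^'d \<Rightarrow> real) \<Rightarrow> (real^'d \<Rightarrow> real) \<Rightarrow> real \<Rightarrow> bool" where
  "damping_bound \<Omega> a q M \<longleftrightarrow>
     (\<forall>\<phi>\<in>test_functions \<Omega>.
        (L2_norm \<Omega> (sqrt_mult a \<phi>))\<^sup>2 + (L2_norm \<Omega> \<phi>)\<^sup>2
          \<le> M * ((L2_norm \<Omega> (grad \<phi>))\<^sup>2 + (L2_norm \<Omega> (sqrt_mult q \<phi>))\<^sup>2))"

end

theory Submission
  imports Defs
begin

text \<open>
  An exponentially stable semigroup has a boundedly invertible generator. Solving
  \<open>\<A>(f, g) = (\<phi>, 0)\<close> for a test function \<open>\<phi>\<close> gives \<open>g = \<phi>\<close> and \<open>(\<Delta> - q) f = a \<phi>\<close>, with \<open>\<parallel>f\<parallel>\<^sub>\<W>\<close> and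
  \<open>\<parallel>g\<parallel>\<close> bounded by a multiple of \<open>\<parallel>\<phi>\<parallel>\<^sub>\<W>\<close>; pairing the second equation with \<open>\<phi>\<close> yields \<open>(**)\<close>.
  Conversely, \<open>(**)\<close> embeds \<open>\<W>\<close> into \<open>L\<^sup>2(\<Omega>)\<close> and into \<open>Dom(a\<^sup>1\<^sup>/\<^sup>2)\<close>, so that
  \<open>\<parallel>U\<parallel>\<^sup>2 / 2 + \<delta> Re \<langle>u, \<partial>\<^sub>t u\<rangle>\<close> is defined along solutions; for \<open>a \<ge> a\<^sub>0\<close> and small \<open>\<delta>\<close> it is equivalent
  to the energy and decays exponentially. In both directions all spaces are realised inside one
  Hilbert space of equivalence classes of square-integrable functions.
\<close>

section \<open>Square-integrable functions\<close>

text \<open>Before the damping bound is known, the norm of W controls neither \<phi> nor a^(1/2)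
  \<phi>, and an element of W need not even be a function. In the first implication the equation g =
  \<phi> is therefore known only as equality of gradients and of q-parts, so a uniqueness result in
  H01 that does not rest on a Poincare inequality has to identify the functions. The bounded inverse
  is the integral of the orbit over the half-line, of norm at most C/\<nu>.

  In the converse the functional needs u(t) as an element of L2, which the semigroup does not carry.
  The damping bound makes u(t) the unique function with the given gradient and makes it depend
  boundedly on that element of W; this is why the time derivative of u is the velocity v in L2.
  Differentiating the functional gives - |a^(1/2) v|^2 + \<delta> (|v|^2 - |u|_W^2 - Re <a^(1/2) v,
  a^(1/2) u>). The lower bound on a absorbs |v|^2, and the a-part of the damping bound absorbs the
  mixed term. Only real parts occur, so a real Hilbert space is enough.\<close>

lemma L2_iff: "u \<in> L2 \<Omega> \<longleftrightarrow> u \<in> borel_measurable (lebesgue_on \<Omega>) \<and>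
    integrable (lebesgue_on \<Omega>) (\<lambda>x. (norm (u x))\<^sup>2)"
  by (simp add: L2_def)

lemma L2_measurable: "u \<in> L2 \<Omega> \<Longrightarrow> u \<in> borel_measurable (lebesgue_on \<Omega>)"
  by (simp add: L2_iff)

lemma L2_bound:
  fixes u :: "'a::euclidean_space \<Rightarrow> 'b::euclidean_space" and v :: "'a \<Rightarrow> 'c::euclidean_space"
  assumes "v \<in> L2 \<Omega>" "u \<in> borel_measurable (lebesgue_on \<Omega>)"
    and "AE x in lebesgue_on \<Omega>. norm (u x) \<le> c * norm (v x)"
  shows "u \<in> L2 \<Omega>"
proof -
  have "integrable (lebesgue_on \<Omega>) (\<lambda>x. c\<^sup>2 * (norm (v x))\<^sup>2)"
    using assms(1) by (simp add: L2_iff)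
  then have "integrable (lebesgue_on \<Omega>) (\<lambda>x. (norm (u x))\<^sup>2)"
  proof (rule Bochner_Integration.integrable_bound)
    show "(\<lambda>x. (norm (u x))\<^sup>2) \<in> borel_measurable (lebesgue_on \<Omega>)"
      using assms(2) by measurable
    show "AE x in lebesgue_on \<Omega>. norm ((norm (u x))\<^sup>2) \<le> norm (c\<^sup>2 * (norm (v x))\<^sup>2)"
      using assms(3)
      by eventually_elim (metis abs_norm_cancel norm_ge_zero power_mono power_mult_distrib real_norm_def abs_power2)
  qed
  then show ?thesis using assms(2) by (simp add: L2_iff)
qed

lemma L2_cong_AE:
  assumes "u \<in> L2 \<Omega>" "v \<in> borel_measurable (lebesgue_on \<Omega>)" "AE x in lebesgue_on \<Omega>. u x = v x"
  shows "v \<in> L2 \<Omega>"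
  by (rule L2_bound[OF assms(1,2), of 1]) (use assms(3) in auto)

lemma L2_zero [simp]: "(\<lambda>x. 0) \<in> L2 \<Omega>"
  by (simp add: L2_iff)

lemma L2_scaleR: "u \<in> L2 \<Omega> \<Longrightarrow> (\<lambda>x. c *\<^sub>R u x) \<in> L2 \<Omega>"
  by (rule L2_bound[of u _ _ "\<bar>c\<bar>"]) (auto simp: L2_iff)

lemma L2_add:
  assumes "u \<in> L2 \<Omega>" "v \<in> L2 \<Omega>"
  shows "(\<lambda>x. u x + v x) \<in> L2 \<Omega>"
proof -
  have [measurable]: "u \<in> borel_measurable (lebesgue_on \<Omega>)" "v \<in> borel_measurable (lebesgue_on \<Omega>)"
    using assms by (simp_all add: L2_iff)
  have "integrable (lebesgue_on \<Omega>) (\<lambda>x. 2 * (norm (u x))\<^sup>2 + 2 * (norm (v x))\<^sup>2)"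
    using assms by (simp add: L2_iff)
  then have "integrable (lebesgue_on \<Omega>) (\<lambda>x. (norm (u x + v x))\<^sup>2)"
  proof (rule Bochner_Integration.integrable_bound)
    have "(norm (y + z))\<^sup>2 \<le> 2 * (norm y)\<^sup>2 + 2 * (norm z)\<^sup>2" for y z :: 'b
    proof -
      have "(norm (y + z))\<^sup>2 \<le> (norm y + norm z)\<^sup>2"
        by (simp add: norm_triangle_ineq power_mono)
      also have "\<dots> \<le> 2 * (norm y)\<^sup>2 + 2 * (norm z)\<^sup>2"
        using sum_squares_bound[of "norm y" "norm z"] by (simp add: power2_sum)
      finally show ?thesis .
    qed
    then show "AE x in lebesgue_on \<Omega>. norm ((norm (u x + v x))\<^sup>2)
        \<le> norm (2 * (norm (u x))\<^sup>2 + 2 * (norm (v x))\<^sup>2)"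
      by auto
  qed measurable
  then show ?thesis by (simp add: L2_iff)
qed

lemma L2_diff:
  assumes "u \<in> L2 \<Omega>" "v \<in> L2 \<Omega>"
  shows "(\<lambda>x. u x - v x) \<in> L2 \<Omega>"
  using L2_add[OF assms(1) L2_scaleR[OF assms(2), of "-1"]] by simp

text \<open>Stating it for a dominated \<open>f\<close> instead of a fixed product lets one proof
  cover inner products, complex products and products of components. Only 2st \<le> s^2 + t^2 is
  used, since Cauchy-Schwarz becomes available only after the inner product has been built on this
  integrability.\<close>

lemma L2_product_integrable:
  fixes u :: "'a::euclidean_space \<Rightarrow> 'b::euclidean_space" and v :: "'a \<Rightarrow> 'c::euclidean_space"
    and f :: "'a \<Rightarrow> 'e::euclidean_space"
  assumes "u \<in> L2 \<Omega>" "v \<in> L2 \<Omega>" "f \<in> borel_measurable (lebesgue_on \<Omega>)"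
    and "AE x in lebesgue_on \<Omega>. norm (f x) \<le> norm (u x) * norm (v x)"
  shows "integrable (lebesgue_on \<Omega>) f"
proof (rule Bochner_Integration.integrable_bound)
  show "integrable (lebesgue_on \<Omega>) (\<lambda>x. (norm (u x))\<^sup>2 + (norm (v x))\<^sup>2)"
    using assms by (simp add: L2_iff)
  show "AE x in lebesgue_on \<Omega>. norm (f x) \<le> norm ((norm (u x))\<^sup>2 + (norm (v x))\<^sup>2)"
    using assms(4)
  proof eventually_elim
    case (elim x)
    have "0 \<le> norm (u x) * norm (v x)" by simp
    then have "norm (u x) * norm (v x) \<le> (norm (u x))\<^sup>2 + (norm (v x))\<^sup>2"
      using sum_squares_bound[of "norm (u x)" "norm (v x)"] by linarith
    then show ?case using elim by simp
  qed
qed (fact assms)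

lemma L2_inner_integrable:
  assumes "u \<in> L2 \<Omega>" "v \<in> L2 \<Omega>"
  shows "integrable (lebesgue_on \<Omega>) (\<lambda>x. u x \<bullet> v x)"
  by (rule L2_product_integrable[OF assms])
    (use assms in \<open>auto simp: L2_iff Cauchy_Schwarz_ineq2 intro!: borel_measurable_inner\<close>)

lemma L2_norm_nonneg [simp]: "0 \<le> L2_norm \<Omega> u"
  by (simp add: L2_norm_def)

lemma L2_norm_power2: "(L2_norm \<Omega> u)\<^sup>2 = (\<integral>x. (norm (u x))\<^sup>2 \<partial>lebesgue_on \<Omega>)"
  by (simp add: L2_norm_def)

section \<open>The Hilbert space of square-integrable functions\<close>

text \<open>A partial equivalence: a function outside \<open>L2 UNIV\<close> is related to nothing,
  so the quotient contains square-integrable classes only. The domain is the whole space; \<Omega>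
  enters later through extension by zero.\<close>

definition lsq_rel :: "('a::euclidean_space \<Rightarrow> 'b::euclidean_space) \<Rightarrow> ('a \<Rightarrow> 'b) \<Rightarrow> bool" where
  "lsq_rel u v \<longleftrightarrow> u \<in> L2 UNIV \<and> v \<in> L2 UNIV \<and> (AE x in lebesgue. u x = v x)"

lemma part_equivp_lsq_rel: "part_equivp lsq_rel"
proof (rule part_equivpI)
  show "\<exists>u. lsq_rel u u" by (rule exI[of _ "\<lambda>x. 0"]) (simp add: lsq_rel_def)
  show "symp lsq_rel" by (auto simp: symp_def lsq_rel_def elim!: eventually_mono)
  show "transp lsq_rel"
    unfolding transp_def lsq_rel_def by (intro allI impI conjI; (elim conjE)?) (auto elim: eventually_elim2)
qed

quotient_type (overloaded) ('a, 'b) lsq = "'a::euclidean_space \<Rightarrow> 'b::euclidean_space" / partial: lsq_rel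
  by (rule part_equivp_lsq_rel)

instantiation lsq :: (euclidean_space, euclidean_space) real_vector
begin

lift_definition zero_lsq :: "('a, 'b) lsq" is "\<lambda>x. 0"
  by (simp add: lsq_rel_def)

lift_definition plus_lsq :: "('a, 'b) lsq \<Rightarrow> ('a, 'b) lsq \<Rightarrow> ('a, 'b) lsq" is "\<lambda>u v x. u x + v x"
  by (auto simp: lsq_rel_def L2_add elim: eventually_elim2)

lift_definition minus_lsq :: "('a, 'b) lsq \<Rightarrow> ('a, 'b) lsq \<Rightarrow> ('a, 'b) lsq" is "\<lambda>u v x. u x - v x"
  by (auto simp: lsq_rel_def L2_diff elim: eventually_elim2)

lift_definition uminus_lsq :: "('a, 'b) lsq \<Rightarrow> ('a, 'b) lsq" is "\<lambda>u x. (-1) *\<^sub>R u x"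
  by (auto simp only: lsq_rel_def L2_scaleR elim!: eventually_mono)

lift_definition scaleR_lsq :: "real \<Rightarrow> ('a, 'b) lsq \<Rightarrow> ('a, 'b) lsq" is "\<lambda>c u x. c *\<^sub>R u x"
  by (auto simp: lsq_rel_def L2_scaleR elim: eventually_mono)

instance
proof
  fix x y z :: "('a, 'b) lsq" and r s :: real
  show "x + y + z = x + (y + z)" by transfer (auto simp: lsq_rel_def L2_add add.assoc)
  show "x + y = y + x" by transfer (auto simp: lsq_rel_def L2_add add.commute)
  show "0 + x = x" by transfer (auto simp: lsq_rel_def)
  show "- x + x = 0" by transfer (auto simp: lsq_rel_def)
  show "x - y = x + - y" by transfer (auto simp: lsq_rel_def L2_diff)
  show "r *\<^sub>R (x + y) = r *\<^sub>R x + r *\<^sub>R y"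
    by transfer (auto simp: lsq_rel_def L2_add L2_scaleR scaleR_right_distrib)
  show "(r + s) *\<^sub>R x = r *\<^sub>R x + s *\<^sub>R x"
    by transfer (auto simp: lsq_rel_def L2_add L2_scaleR scaleR_left_distrib)
  show "r *\<^sub>R s *\<^sub>R x = (r * s) *\<^sub>R x"
    by transfer (auto simp: lsq_rel_def L2_scaleR)
  show "1 *\<^sub>R x = x" by transfer (auto simp: lsq_rel_def)
qed

end

instantiation lsq :: (euclidean_space, euclidean_space) real_inner
begin

lift_definition inner_lsq :: "('a, 'b) lsq \<Rightarrow> ('a, 'b) lsq \<Rightarrow> real" is "\<lambda>u v. \<integral>x. u x \<bullet> v x \<partial>lebesgue"
proof -
  fix u u' v v' :: "'a \<Rightarrow> 'b"
  assume uu: "lsq_rel u u'" and vv: "lsq_rel v v'"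
  have "AE x in lebesgue. u x \<bullet> v x = u' x \<bullet> v' x"
    using uu vv by (auto simp: lsq_rel_def elim: eventually_elim2)
  moreover have "u \<in> borel_measurable lebesgue" "u' \<in> borel_measurable lebesgue"
    "v \<in> borel_measurable lebesgue" "v' \<in> borel_measurable lebesgue"
    using uu vv L2_measurable[of _ UNIV] by (auto simp: lsq_rel_def lebesgue_on_UNIV_eq)
  ultimately show "(\<integral>x. u x \<bullet> v x \<partial>lebesgue) = (\<integral>x. u' x \<bullet> v' x \<partial>lebesgue)"
    by (intro integral_cong_AE) (auto intro!: borel_measurable_inner)
qed

definition norm_lsq :: "('a, 'b) lsq \<Rightarrow> real" where "norm_lsq x = sqrt (inner x x)"
definition dist_lsq :: "('a, 'b) lsq \<Rightarrow> ('a, 'b) lsq \<Rightarrow> real" where "dist_lsq x y = norm (x - y)"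
definition sgn_lsq :: "('a, 'b) lsq \<Rightarrow> ('a, 'b) lsq" where "sgn_lsq x = x /\<^sub>R norm x"
definition uniformity_lsq :: "(('a, 'b) lsq \<times> ('a, 'b) lsq) filter" where
  [code del]: "uniformity_lsq = (INF e\<in>{0 <..}. principal {(x, y). dist x y < e})"
definition open_lsq :: "('a, 'b) lsq set \<Rightarrow> bool" where
  [code del]: "open_lsq S = (\<forall>x\<in>S. \<forall>\<^sub>F (x', y) in uniformity. x' = x \<longrightarrow> y \<in> S)"

instance
proof
  fix x y z :: "('a, 'b) lsq" and r s :: real
  show "dist x y = norm (x - y)" by (simp add: dist_lsq_def)
  show "sgn x = x /\<^sub>R norm x" by (simp add: sgn_lsq_def)
  show "uniformity = (INF e\<in>{0 <..}. principal {(x, y). dist x y < (e::real)} :: (('a, 'b) lsq \<times> ('a, 'b) lsq) filter)"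
    by (simp add: uniformity_lsq_def)
  show "open S \<longleftrightarrow> (\<forall>x\<in>S. \<forall>\<^sub>F (x', y) in uniformity. x' = x \<longrightarrow> y \<in> S)" for S :: "('a, 'b) lsq set"
    by (simp add: open_lsq_def)
  show "x \<bullet> y = y \<bullet> x" by transfer (simp add: inner_commute)
  show "(x + y) \<bullet> z = x \<bullet> z + y \<bullet> z"
  proof transfer
    fix u v w :: "'a \<Rightarrow> 'b"
    assume "lsq_rel u u" "lsq_rel v v" "lsq_rel w w"
    then have "integrable lebesgue (\<lambda>x. u x \<bullet> w x)" "integrable lebesgue (\<lambda>x. v x \<bullet> w x)"
      using L2_inner_integrable[of _ UNIV] by (simp_all add: lsq_rel_def lebesgue_on_UNIV_eq)
    then show "(\<integral>x. (u x + v x) \<bullet> w x \<partial>lebesgue) =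
        (\<integral>x. u x \<bullet> w x \<partial>lebesgue) + (\<integral>x. v x \<bullet> w x \<partial>lebesgue)"
      unfolding inner_add_left by (rule Bochner_Integration.integral_add)
  qed
  show "(r *\<^sub>R x) \<bullet> y = r * (x \<bullet> y)" by transfer simp
  show "0 \<le> x \<bullet> x" by transfer simp
  show "x \<bullet> x = 0 \<longleftrightarrow> x = 0"
  proof transfer
    fix u :: "'a \<Rightarrow> 'b"
    assume u: "lsq_rel u u"
    then have "integrable lebesgue (\<lambda>x. u x \<bullet> u x)"
      using L2_inner_integrable[of u UNIV u] by (simp add: lsq_rel_def lebesgue_on_UNIV_eq)
    then show "(\<integral>x. u x \<bullet> u x \<partial>lebesgue) = 0 \<longleftrightarrow> lsq_rel u (\<lambda>x. 0)"
      using u by (subst integral_nonneg_eq_0_iff_AE) (auto simp: lsq_rel_def)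
  qed
  show "norm x = sqrt (x \<bullet> x)" by (simp add: norm_lsq_def)
qed

end


text \<open>Extension by zero turns L2 of \<Omega> into a subspace of one fixed Hilbert space. A
  type cannot depend on the set \<Omega>, so this takes the place of a separate quotient for each
  domain.\<close>

definition lsq_of :: "'a::euclidean_space set \<Rightarrow> ('a \<Rightarrow> 'b::euclidean_space) \<Rightarrow> ('a, 'b) lsq" where
  "lsq_of \<Omega> u = abs_lsq (\<lambda>x. if x \<in> \<Omega> then u x else 0)"

lemma L2_extend:
  assumes "\<Omega> \<in> sets lebesgue" "u \<in> L2 \<Omega>"
  shows "(\<lambda>x. if x \<in> \<Omega> then u x else 0) \<in> L2 UNIV"
proof -
  have "(\<lambda>x. if x \<in> \<Omega> then u x else 0) \<in> borel_measurable lebesgue"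
    using assms by (simp add: L2_iff borel_measurable_if)
  moreover have "integrable lebesgue (\<lambda>x. (norm (if x \<in> \<Omega> then u x else 0))\<^sup>2)"
  proof -
    have "integrable lebesgue (\<lambda>x. indicator \<Omega> x *\<^sub>R (norm (u x))\<^sup>2)"
      using assms by (simp add: L2_iff integrable_restrict_space)
    then show ?thesis
      by (rule back_subst[of "integrable lebesgue"]) auto
  qed
  ultimately show ?thesis by (simp add: L2_iff lebesgue_on_UNIV_eq)
qed

lemma lsq_rel_extend:
  assumes "\<Omega> \<in> sets lebesgue" "u \<in> L2 \<Omega>"
  shows "lsq_rel (\<lambda>x. if x \<in> \<Omega> then u x else 0) (\<lambda>x. if x \<in> \<Omega> then u x else 0)"
  using L2_extend[OF assms] by (simp add: lsq_rel_def)

lemma lsq_of_add: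
  assumes "\<Omega> \<in> sets lebesgue" "u \<in> L2 \<Omega>" "v \<in> L2 \<Omega>"
  shows "lsq_of \<Omega> (\<lambda>x. u x + v x) = lsq_of \<Omega> u + lsq_of \<Omega> v"
proof -
  have "(\<lambda>x. if x \<in> \<Omega> then u x + v x else 0) =
      (\<lambda>x. (if x \<in> \<Omega> then u x else 0) + (if x \<in> \<Omega> then v x else 0))"
    by auto
  then show ?thesis
    unfolding lsq_of_def using assms by (simp add: plus_lsq.abs_eq lsq_rel_extend)
qed

lemma lsq_of_diff:
  assumes "\<Omega> \<in> sets lebesgue" "u \<in> L2 \<Omega>" "v \<in> L2 \<Omega>"
  shows "lsq_of \<Omega> (\<lambda>x. u x - v x) = lsq_of \<Omega> u - lsq_of \<Omega> v"
proof -
  have "(\<lambda>x. if x \<in> \<Omega> then u x - v x else 0) =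
      (\<lambda>x. (if x \<in> \<Omega> then u x else 0) - (if x \<in> \<Omega> then v x else 0))"
    by auto
  then show ?thesis
    unfolding lsq_of_def using assms by (simp add: minus_lsq.abs_eq lsq_rel_extend)
qed

lemma lsq_of_scaleR:
  assumes "\<Omega> \<in> sets lebesgue" "u \<in> L2 \<Omega>"
  shows "lsq_of \<Omega> (\<lambda>x. c *\<^sub>R u x) = c *\<^sub>R lsq_of \<Omega> u"
proof -
  have "(\<lambda>x. if x \<in> \<Omega> then c *\<^sub>R u x else 0) = (\<lambda>x. c *\<^sub>R (if x \<in> \<Omega> then u x else 0))"
    by auto
  then show ?thesis
    unfolding lsq_of_def using assms by (simp add: scaleR_lsq.abs_eq lsq_rel_extend)
qed

lemma lsq_of_zero [simp]: "lsq_of \<Omega> (\<lambda>x. 0) = 0"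
  by (simp add: lsq_of_def zero_lsq.abs_eq)

lemma inner_lsq_of:
  assumes "\<Omega> \<in> sets lebesgue" "u \<in> L2 \<Omega>" "v \<in> L2 \<Omega>"
  shows "lsq_of \<Omega> u \<bullet> lsq_of \<Omega> v = (\<integral>x. u x \<bullet> v x \<partial>lebesgue_on \<Omega>)"
proof -
  have "lsq_of \<Omega> u \<bullet> lsq_of \<Omega> v
      = (\<integral>x. (if x \<in> \<Omega> then u x else 0) \<bullet> (if x \<in> \<Omega> then v x else 0) \<partial>lebesgue)"
    unfolding lsq_of_def using assms by (simp add: inner_lsq.abs_eq lsq_rel_extend)
  also have "\<dots> = (\<integral>x. indicator \<Omega> x *\<^sub>R (u x \<bullet> v x) \<partial>lebesgue)"
    by (rule Bochner_Integration.integral_cong) auto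
  also have "\<dots> = (\<integral>x. u x \<bullet> v x \<partial>lebesgue_on \<Omega>)"
    using assms by (simp add: integral_restrict_space)
  finally show ?thesis .
qed

lemma norm_lsq_of:
  assumes "\<Omega> \<in> sets lebesgue" "u \<in> L2 \<Omega>"
  shows "norm (lsq_of \<Omega> u) = L2_norm \<Omega> u"
  using inner_lsq_of[OF assms assms(2)]
  by (simp add: norm_eq_sqrt_inner L2_norm_def power2_norm_eq_inner)

lemma L2_norm_eq_0_iff:
  assumes "u \<in> L2 \<Omega>"
  shows "L2_norm \<Omega> u = 0 \<longleftrightarrow> (AE x in lebesgue_on \<Omega>. u x = 0)"
  unfolding L2_norm_def using assms
  by (subst real_sqrt_eq_0_iff, subst integral_nonneg_eq_0_iff_AE) (auto simp: L2_iff)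

lemma lsq_of_eq_iff:
  assumes "\<Omega> \<in> sets lebesgue" "u \<in> L2 \<Omega>" "v \<in> L2 \<Omega>"
  shows "lsq_of \<Omega> u = lsq_of \<Omega> v \<longleftrightarrow> (AE x in lebesgue_on \<Omega>. u x = v x)"
proof -
  have "lsq_of \<Omega> u = lsq_of \<Omega> v \<longleftrightarrow> norm (lsq_of \<Omega> (\<lambda>x. u x - v x)) = 0"
    using assms by (simp add: lsq_of_diff)
  also have "\<dots> \<longleftrightarrow> (AE x in lebesgue_on \<Omega>. u x - v x = 0)"
    using assms by (simp add: norm_lsq_of L2_diff L2_norm_eq_0_iff)
  finally show ?thesis by simp
qed

lemma rep_lsq_in_L2: "rep_lsq x \<in> L2 UNIV"
proof -
  have "lsq_rel (rep_lsq x) (rep_lsq x)"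
    by (rule Quotient_rep_reflp[OF Quotient_lsq])
  then show ?thesis by (simp add: lsq_rel_def)
qed

lemma lsq_of_rep_lsq [simp]: "lsq_of UNIV (rep_lsq x) = x"
  using Quotient_abs_rep[OF Quotient_lsq] by (simp add: lsq_of_def)

lemma L2_subset:
  assumes "u \<in> L2 UNIV" "\<Omega> \<in> sets lebesgue"
  shows "u \<in> L2 \<Omega>"
proof -
  have "integrable lebesgue (\<lambda>x. (norm (u x))\<^sup>2)"
    using assms(1) by (simp add: L2_iff lebesgue_on_UNIV_eq)
  then have "integrable lebesgue (\<lambda>x. indicator \<Omega> x *\<^sub>R (norm (u x))\<^sup>2)"
    by (rule integrable_mult_indicator[OF assms(2)])
  then have "integrable (lebesgue_on \<Omega>) (\<lambda>x. (norm (u x))\<^sup>2)"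
    using assms(2) by (simp add: integrable_restrict_space)
  moreover have "u \<in> borel_measurable (lebesgue_on \<Omega>)"
    using assms(1) by (auto simp: L2_iff lebesgue_on_UNIV_eq intro: measurable_restrict_space1)
  ultimately show ?thesis by (simp add: L2_iff)
qed

lemma L2_norm_mono_domain:
  assumes "u \<in> L2 UNIV" "\<Omega> \<in> sets lebesgue"
  shows "L2_norm \<Omega> u \<le> L2_norm UNIV u"
proof -
  have i: "integrable lebesgue (\<lambda>x. (norm (u x))\<^sup>2)"
    using assms(1) by (simp add: L2_iff lebesgue_on_UNIV_eq)
  have "(\<integral>x. (norm (u x))\<^sup>2 \<partial>lebesgue_on \<Omega>) = (\<integral>x. indicator \<Omega> x *\<^sub>R (norm (u x))\<^sup>2 \<partial>lebesgue)"
    using assms(2) by (simp add: integral_restrict_space)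
  also have "\<dots> \<le> (\<integral>x. (norm (u x))\<^sup>2 \<partial>lebesgue)"
    by (rule integral_mono[OF integrable_mult_indicator[OF assms(2) i] i]) (auto simp: indicator_def)
  finally show ?thesis by (simp add: L2_norm_def lebesgue_on_UNIV_eq)
qed

text \<open>
  Riesz--Fischer. Once \<open>\<parallel>u\<^sub>n\<^sub>+\<^sub>1 - u\<^sub>n\<parallel> \<le> 2\<^sup>-\<^sup>n\<close>, the series \<open>\<Sum>n. 2\<^sup>n |u\<^sub>n\<^sub>+\<^sub>1 - u\<^sub>n|\<^sup>2\<close> is integrable, and
  \<open>2 |d| \<le> 2\<^sup>-\<^sup>n + 2\<^sup>n |d|\<^sup>2\<close> turns its finiteness into pointwise absolute convergence.
\<close>

lemma L2_AE_convergent: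
  fixes u :: "nat \<Rightarrow> 'a::euclidean_space \<Rightarrow> 'b::euclidean_space"
  assumes u: "\<And>n. u n \<in> L2 UNIV"
    and d: "\<And>n. L2_norm UNIV (\<lambda>x. u (Suc n) x - u n x) \<le> (1/2)^n"
  shows "AE x in lebesgue. convergent (\<lambda>n. u n x)"
proof -
  define d where "d n x = norm (u (Suc n) x - u n x)" for n x
  have meas [measurable]: "u n \<in> borel_measurable lebesgue" for n
    using u[of n] by (simp add: L2_iff lebesgue_on_UNIV_eq)
  have d_meas [measurable]: "d n \<in> borel_measurable lebesgue" for n
    unfolding d_def by measurable
  have int: "integrable lebesgue (\<lambda>x. (d n x)\<^sup>2)" for n
    using L2_diff[OF u[of "Suc n"] u[of n]] by (simp add: L2_iff lebesgue_on_UNIV_eq d_def)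
  have le: "(\<integral>x. (d n x)\<^sup>2 \<partial>lebesgue) \<le> (1/4)^n" for n
  proof -
    have "(\<integral>x. (d n x)\<^sup>2 \<partial>lebesgue) = (L2_norm UNIV (\<lambda>x. u (Suc n) x - u n x))\<^sup>2"
      by (simp add: L2_norm_power2 lebesgue_on_UNIV_eq d_def)
    also have "\<dots> \<le> ((1/2)^n)\<^sup>2"
      using d[of n] by (intro power_mono) auto
    also have "\<dots> = (1/4)^n"
      by (simp add: power_mult[symmetric] power_divide) (simp add: power_mult mult.commute[of n])
    finally show ?thesis .
  qed
  have "(\<integral>\<^sup>+x. (\<Sum>n. ennreal (2^n * (d n x)\<^sup>2)) \<partial>lebesgue)
      = (\<Sum>n. \<integral>\<^sup>+x. ennreal (2^n * (d n x)\<^sup>2) \<partial>lebesgue)"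
    by (rule nn_integral_suminf) measurable
  also have "\<dots> \<le> (\<Sum>n. ennreal ((1/2)^n))"
  proof (rule suminf_le)
    fix n
    have "(\<integral>\<^sup>+x. ennreal (2^n * (d n x)\<^sup>2) \<partial>lebesgue) = ennreal (\<integral>x. 2^n * (d n x)\<^sup>2 \<partial>lebesgue)"
      using int by (intro nn_integral_eq_integral) auto
    also have "\<dots> \<le> ennreal (2^n * (1/4)^n)"
      using le[of n] by (intro ennreal_leI) simp
    also have "(2::real)^n * (1/4)^n = (1/2)^n"
      by (simp flip: power_mult_distrib)
    finally show "(\<integral>\<^sup>+x. ennreal (2^n * (d n x)\<^sup>2) \<partial>lebesgue) \<le> ennreal ((1/2)^n)" .
  qed auto
  also have "\<dots> = ennreal (\<Sum>n. (1/2)^n)"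
    by (rule suminf_ennreal2) (auto intro: summable_geometric)
  also have "\<dots> < \<infinity>" by simp
  finally have "AE x in lebesgue. (\<Sum>n. ennreal (2^n * (d n x)\<^sup>2)) \<noteq> \<infinity>"
    by (intro nn_integral_noteq_infinite) auto
  then show ?thesis
  proof eventually_elim
    case (elim x)
    have s1: "summable (\<lambda>n. 2^n * (d n x)\<^sup>2)"
      by (rule summable_suminf_not_top) (use elim in auto)
    have "summable (\<lambda>n. d n x)"
    proof (rule summable_comparison_test'[of _ 0])
      show "summable (\<lambda>n. (1/2)^n + 2^n * (d n x)\<^sup>2)"
        by (intro summable_add s1 summable_geometric) simp
      fix n :: nat
      have d0: "0 \<le> d n x" by (simp add: d_def)
      have "0 \<le> (1/2)^n * (2^n * d n x - 1)\<^sup>2" by simp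
      also have "\<dots> = (1/2)^n * 2^n * 2^n * (d n x)\<^sup>2 - 2 * ((1/2)^n * 2^n * d n x) + (1/2)^n"
        by (simp add: power2_diff algebra_simps power2_eq_square)
      also have "\<dots> = 2^n * (d n x)\<^sup>2 - 2 * d n x + (1/2)^n"
        by (simp flip: power_mult_distrib)
      finally show "norm (d n x) \<le> (1/2)^n + 2^n * (d n x)\<^sup>2"
        using d0 by simp
    qed
    then have "summable (\<lambda>n. u (Suc n) x - u n x)"
      unfolding d_def by (rule summable_norm_cancel)
    then have "convergent (\<lambda>n. u 0 x + (\<Sum>i<n. u (Suc i) x - u i x))"
      by (intro convergent_add convergent_const) (simp add: summable_iff_convergent)
    moreover have "u 0 x + (\<Sum>i<n. u (Suc i) x - u i x) = u n x" for n
      using sum_lessThan_telescope[of "\<lambda>i. u i x" n] by simp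
    ultimately show ?case by simp
  qed
qed

text \<open>A subsequence with geometric increments converges almost everywhere by
  \<open>L2_AE_convergent\<close>. Fatou's lemma upgrades the pointwise limit to a limit in norm
  with the same rate, and the Cauchy property carries it to the whole sequence.\<close>

instance lsq :: (euclidean_space, euclidean_space) complete_space
proof
  fix X :: "nat \<Rightarrow> ('a, 'b) lsq"
  assume X: "Cauchy X"
  have "\<exists>N. \<forall>m\<ge>N. \<forall>n\<ge>N. norm (X m - X n) < (1/2)^k" for k
    using X unfolding Cauchy_iff by simp
  then obtain N where N: "\<And>k m n. m \<ge> N k \<Longrightarrow> n \<ge> N k \<Longrightarrow> norm (X m - X n) < (1/2)^k"
    by metis
  \<comment> \<open>The sum makes \<open>r k\<close> at least every \<open>N i\<close> with i \<le>
    k, although \<open>N\<close> need not be monotone.\<close>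
  define r where "r k = k + (\<Sum>i\<le>k. N i)" for k
  have rS: "N k \<le> r (k + j)" for k j
    unfolding r_def by (rule trans_le_add2) (simp add: member_le_sum)
  note rN = rS[of _ 0, simplified]
  define u where "u k = rep_lsq (X (r k))" for k
  have u: "u k \<in> L2 UNIV" for k
    unfolding u_def by (rule rep_lsq_in_L2)
  have of_u: "lsq_of UNIV (u k) = X (r k)" for k
    by (simp add: u_def)
  have dist_u: "L2_norm UNIV (\<lambda>x. u m x - u n x) = norm (X (r m) - X (r n))" for m n
    by (simp add: norm_lsq_of[symmetric] lsq_of_diff L2_diff u of_u)
  have "AE x in lebesgue. convergent (\<lambda>n. u n x)"
    by (rule L2_AE_convergent[OF u]) (simp add: dist_u N rN rS[of _ 1, simplified] less_imp_le)
  then have conv: "AE x in lebesgue. (\<lambda>n. u n x) \<longlonglongrightarrow> lim (\<lambda>n. u n x)"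
    by eventually_elim (simp add: convergent_LIMSEQ_iff)
  define w where "w x = lim (\<lambda>n. u n x)" for x
  have [measurable]: "u n \<in> borel_measurable lebesgue" for n
    using u[of n] by (simp add: L2_iff lebesgue_on_UNIV_eq)
  have [measurable]: "w \<in> borel_measurable lebesgue"
    unfolding w_def by (rule borel_measurable_lim_metric) measurable
  \<comment> \<open>Fatou's lemma with \<open>k\<close> fixed and n tending to infinity;
    \<open>w\<close> is not yet known to be square-integrable, hence the nonnegative
    integral.\<close>
  have bound: "(\<integral>\<^sup>+x. ennreal ((norm (w x - u k x))\<^sup>2) \<partial>lebesgue) \<le> ennreal (((1/2)^k)\<^sup>2)" for k
  proof -
    have "(\<integral>\<^sup>+x. ennreal ((norm (w x - u k x))\<^sup>2) \<partial>lebesgue)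
        = (\<integral>\<^sup>+x. liminf (\<lambda>n. ennreal ((norm (u n x - u k x))\<^sup>2)) \<partial>lebesgue)"
      using conv
    proof (intro nn_integral_cong_AE, eventually_elim)
      case (elim x)
      then have "(\<lambda>n. ennreal ((norm (u n x - u k x))\<^sup>2)) \<longlonglongrightarrow> ennreal ((norm (w x - u k x))\<^sup>2)"
        unfolding w_def by (intro tendsto_intros)
      then show ?case
        by (intro lim_imp_Liminf[symmetric] sequentially_bot)
    qed
    also have "\<dots> \<le> liminf (\<lambda>n. \<integral>\<^sup>+x. ennreal ((norm (u n x - u k x))\<^sup>2) \<partial>lebesgue)"
      by (rule nn_integral_liminf) measurable
    also have "\<dots> \<le> ennreal (((1/2)^k)\<^sup>2)"
    proof -
      have "(\<integral>\<^sup>+x. ennreal ((norm (u n x - u k x))\<^sup>2) \<partial>lebesgue) \<le> ennreal (((1/2)^k)\<^sup>2)"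
        if "n \<ge> k" for n
      proof -
        have "integrable lebesgue (\<lambda>x. (norm (u n x - u k x))\<^sup>2)"
          using L2_diff[OF u[of n] u[of k]] by (simp add: L2_iff lebesgue_on_UNIV_eq)
        then have "(\<integral>\<^sup>+x. ennreal ((norm (u n x - u k x))\<^sup>2) \<partial>lebesgue)
            = ennreal ((L2_norm UNIV (\<lambda>x. u n x - u k x))\<^sup>2)"
          by (simp add: nn_integral_eq_integral L2_norm_power2 lebesgue_on_UNIV_eq)
        also have "\<dots> \<le> ennreal (((1/2)^k)\<^sup>2)"
          using N[of k "r n" "r k"] rN[of k] rS[of k "n - k"] that
          by (intro ennreal_leI power_mono) (simp_all add: dist_u)
        finally show ?thesis .
      qed
      then have "\<forall>\<^sub>F n in sequentially. (\<integral>\<^sup>+x. ennreal ((norm (u n x - u k x))\<^sup>2) \<partial>lebesgue)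
          \<le> ennreal (((1/2)^k)\<^sup>2)"
        by (rule eventually_sequentiallyI)
      then show ?thesis
        by (intro Liminf_le) auto
    qed
    finally show ?thesis .
  qed
  have diff_L2: "(\<lambda>x. w x - u k x) \<in> L2 UNIV" for k
  proof -
    have "integrable lebesgue (\<lambda>x. (norm (w x - u k x))\<^sup>2)"
      using le_less_trans[OF bound[of k] ennreal_less_top] by (intro integrableI_nonneg) auto
    then show ?thesis by (simp add: L2_iff lebesgue_on_UNIV_eq)
  qed
  have w: "w \<in> L2 UNIV"
    using L2_add[OF diff_L2[of 0] u[of 0]] by simp
  have le: "norm (lsq_of UNIV w - X (r k)) \<le> (1/2)^k" for k
  proof -
    have "ennreal ((L2_norm UNIV (\<lambda>x. w x - u k x))\<^sup>2) \<le> ennreal (((1/2)^k)\<^sup>2)"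
      using bound[of k] diff_L2[of k]
      by (simp add: L2_norm_power2 lebesgue_on_UNIV_eq nn_integral_eq_integral L2_iff)
    then have "L2_norm UNIV (\<lambda>x. w x - u k x) \<le> (1/2)^k"
      by (simp add: power2_le_iff_abs_le)
    then show ?thesis
      by (simp add: norm_lsq_of[symmetric] lsq_of_diff diff_L2 w u of_u)
  qed
  have "X \<longlonglongrightarrow> lsq_of UNIV w"
  proof (rule LIMSEQ_I)
    fix e :: real
    assume "e > 0"
    then obtain k where k: "(1/2)^k < e / 2"
      using real_arch_pow_inv[of "e/2" "1/2"] by auto
    show "\<exists>no. \<forall>n\<ge>no. norm (X n - lsq_of UNIV w) < e"
    proof (intro exI[of _ "N k"] allI impI)
      fix n assume "n \<ge> N k"
      then have "norm (X n - X (r k)) < (1/2)^k"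
        using N rN by simp
      moreover have "norm (X n - lsq_of UNIV w) \<le> norm (X n - X (r k)) + norm (X (r k) - lsq_of UNIV w)"
        using norm_triangle_ineq[of "X n - X (r k)" "X (r k) - lsq_of UNIV w"] by simp
      moreover have "norm (X (r k) - lsq_of UNIV w) \<le> (1/2)^k"
        using le[of k] by (simp add: norm_minus_commute)
      ultimately show "norm (X n - lsq_of UNIV w) < e" using k by linarith
    qed
  qed
  then show "convergent X" by (auto simp: convergent_def)
qed

instance lsq :: (euclidean_space, euclidean_space) banach ..

text \<open>Every term vanishes outside \<Omega>, so restricting a representative of the limit to
  \<Omega> cannot increase its distance to the terms; the restriction is then itself the limit. This
  is what makes the image of \<open>L2 \<Omega>\<close> closed.\<close>

lemma L2_limit_lsq_of:
  assumes \<Omega>: "\<Omega> \<in> sets lebesgue" and u: "\<And>n. u n \<in> L2 \<Omega>" and lim: "(\<lambda>n. lsq_of \<Omega> (u n)) \<longlonglongrightarrow> x"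
  shows "\<exists>w\<in>L2 \<Omega>. x = lsq_of \<Omega> w"
proof -
  define w where "w = rep_lsq x"
  have w: "w \<in> L2 UNIV" "lsq_of UNIV w = x"
    by (simp_all add: w_def rep_lsq_in_L2)
  then have w': "w \<in> L2 \<Omega>" using \<Omega> by (simp add: L2_subset)
  let ?e = "\<lambda>n x. if x \<in> \<Omega> then u n x else 0"
  have e: "?e n \<in> L2 UNIV" for n by (rule L2_extend[OF \<Omega> u])
  have le: "norm (lsq_of \<Omega> (u n) - lsq_of \<Omega> w) \<le> norm (lsq_of \<Omega> (u n) - x)" for n
  proof -
    have "norm (lsq_of \<Omega> (u n) - lsq_of \<Omega> w) = L2_norm \<Omega> (\<lambda>x. u n x - w x)"
      using \<Omega> u w' by (simp add: lsq_of_diff[symmetric] norm_lsq_of L2_diff)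
    also have "\<dots> = L2_norm \<Omega> (\<lambda>x. ?e n x - w x)"
      unfolding L2_norm_def
      by (rule arg_cong[where f=sqrt], rule Bochner_Integration.integral_cong)
        (auto simp: space_restrict_space)
    also have "\<dots> \<le> L2_norm UNIV (\<lambda>x. ?e n x - w x)"
      by (rule L2_norm_mono_domain[OF L2_diff[OF e w(1)] \<Omega>])
    also have "\<dots> = norm (lsq_of UNIV (?e n) - lsq_of UNIV w)"
      using norm_lsq_of[OF _ L2_diff[OF e[of n] w(1)]] lsq_of_diff[OF _ e[of n] w(1)] by simp
    also have "lsq_of UNIV (?e n) = lsq_of \<Omega> (u n)"
      by (simp add: lsq_of_def)
    finally show ?thesis by (simp add: w)
  qed
  have "(\<lambda>n. norm (lsq_of \<Omega> (u n) - x)) \<longlonglongrightarrow> 0"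
    by (rule tendsto_norm_zero[OF LIM_zero[OF lim]])
  then have "(\<lambda>n. lsq_of \<Omega> (u n) - lsq_of \<Omega> w) \<longlonglongrightarrow> 0"
    by (rule Lim_null_comparison[rotated]) (simp add: le)
  then have "(\<lambda>n. lsq_of \<Omega> (u n)) \<longlonglongrightarrow> lsq_of \<Omega> w"
    by (rule LIM_zero_cancel)
  then have "x = lsq_of \<Omega> w" by (rule LIMSEQ_unique[OF lim])
  then show ?thesis using w' by blast
qed

section \<open>Contraction semigroups on a closed subspace\<close>

text \<open>Riemann sums are linear combinations of values of \<open>f\<close>, hence lie in
  \<open>V\<close>, and they approximate the integral. The lemma serves twice: for orbits in
  \<open>V\<close>, and for the graph of one semigroup operator.\<close>

lemma integral_in_closed_subspace:
  fixes f :: "real \<Rightarrow> 'b::banach"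
  assumes V: "subspace V" "closed V" and f: "f integrable_on {a..b}" "\<And>s. s \<in> {a..b} \<Longrightarrow> f s \<in> V"
  shows "integral {a..b} f \<in> V"
proof -
  have "integral {a..b} f \<in> closure V"
    unfolding closure_approachable
  proof (intro allI impI)
    fix e :: real
    assume "e > 0"
    have "(f has_integral integral {a..b} f) (cbox a b)"
      using f(1) by (simp add: has_integral_integral)
    then obtain \<gamma> where \<gamma>: "gauge \<gamma>" "\<And>p. p tagged_division_of (cbox a b) \<Longrightarrow> \<gamma> fine p \<Longrightarrow>
        norm ((\<Sum>(x, k)\<in>p. measure lborel k *\<^sub>R f x) - integral {a..b} f) < e"
      unfolding has_integral using \<open>e > 0\<close> by metis
    obtain p where p: "p tagged_division_of (cbox a b)" "\<gamma> fine p"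
      using fine_division_exists[OF \<gamma>(1)] by blast
    have "(\<Sum>(x, k)\<in>p. measure lborel k *\<^sub>R f x) \<in> V"
    proof (rule subspace_sum[OF V(1)], clarify)
      fix x k assume "(x, k) \<in> p"
      then have "x \<in> {a..b}" using tag_in_interval[OF p(1)] by simp
      then show "measure lborel k *\<^sub>R f x \<in> V" using f(2) V(1) by (simp add: subspace_scale)
    qed
    then show "\<exists>y\<in>V. dist y (integral {a..b} f) < e"
      using \<gamma>(2)[OF p] by (auto simp: dist_norm)
  qed
  then show ?thesis using V(2) by simp
qed

text \<open>The mean over [c, c + h] differs from \<open>f c\<close> by at most the oscillation of
  \<open>f\<close> there. Continuity on a half-line is the form in which orbits provide it, since
  they exist for nonnegative times only.\<close>

lemma integral_approx_right:
  fixes f :: "real \<Rightarrow> 'b::banach"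
  assumes "continuous_on {c..} f"
  shows "((\<lambda>h. (1 / h) *\<^sub>R integral {c..c + h} f) \<longlongrightarrow> f c) (at_right 0)"
proof (rule tendstoI)
  fix e :: real
  assume e: "e > 0"
  have "continuous (at c within {c..}) f"
    using assms by (simp add: continuous_on_eq_continuous_within)
  then obtain d where d: "d > 0" "\<And>s. s \<ge> c \<Longrightarrow> dist s c < d \<Longrightarrow> dist (f s) (f c) < e / 2"
    unfolding continuous_within_eps_delta using e by (metis atLeast_iff half_gt_zero)
  have "dist ((1 / h) *\<^sub>R integral {c..c + h} f) (f c) < e" if h: "0 < h" "h < d" for h
  proof -
    have int: "f integrable_on {c..c + h}"
      by (rule integrable_continuous_real, rule continuous_on_subset[OF assms]) auto
    have "((\<lambda>s. f s - f c) has_integral (integral {c..c + h} f - h *\<^sub>R f c)) {c..c + h}"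
      using has_integral_diff[OF integrable_integral[OF int] has_integral_const_real[of "f c" c "c + h"]] h
      by simp
    then have "norm (integral {c..c + h} f - h *\<^sub>R f c) \<le> (e / 2) * measure lborel {c..c + h}"
    proof (rule has_integral_bound_real[rotated 2])
      fix x assume "x \<in> {c..c + h} - {}"
      then show "norm (f x - f c) \<le> e / 2"
        using d(2)[of x] h by (auto simp: dist_norm intro: less_imp_le)
    qed (use e in auto)
    then have "norm (integral {c..c + h} f - h *\<^sub>R f c) / h \<le> e / 2"
      using h by (simp add: field_simps)
    then have "norm ((1 / h) *\<^sub>R (integral {c..c + h} f - h *\<^sub>R f c)) \<le> e / 2"
      using h by (simp del: scaleR_diff_right)
    moreover have "(1 / h) *\<^sub>R (integral {c..c + h} f - h *\<^sub>R f c) = (1 / h) *\<^sub>R integral {c..c + h} f - f c"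
      using h by (simp add: scaleR_diff_right)
    ultimately show ?thesis using e by (simp add: dist_norm)
  qed
  then show "\<forall>\<^sub>F h in at_right 0. dist ((1 / h) *\<^sub>R integral {c..c + h} f) (f c) < e"
    unfolding eventually_at_right_field using d(1) by auto
qed

text \<open>All axioms are relative to \<open>V\<close>, because the energy space is realised as a
  closed subspace of a larger Banach space and the operators carry no information outside it.
  Scalars are real, as they are in the space of square-integrable classes.\<close>

locale contraction_semigroup_on =
  fixes V :: "'b::banach set" and S :: "real \<Rightarrow> 'b \<Rightarrow> 'b"
  assumes subspace_V: "subspace V" and closed_V: "closed V"
    and in_V: "\<And>t x. 0 \<le> t \<Longrightarrow> x \<in> V \<Longrightarrow> S t x \<in> V"
    and contraction: "\<And>t x. 0 \<le> t \<Longrightarrow> x \<in> V \<Longrightarrow> norm (S t x) \<le> norm x"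
    and S_add: "\<And>t x y. 0 \<le> t \<Longrightarrow> x \<in> V \<Longrightarrow> y \<in> V \<Longrightarrow> S t (x + y) = S t x + S t y"
    and S_scaleR: "\<And>t c x. 0 \<le> t \<Longrightarrow> x \<in> V \<Longrightarrow> S t (c *\<^sub>R x) = c *\<^sub>R S t x"
    and S_zero: "\<And>x. x \<in> V \<Longrightarrow> S 0 x = x"
    and S_semigroup: "\<And>s t x. 0 \<le> s \<Longrightarrow> 0 \<le> t \<Longrightarrow> x \<in> V \<Longrightarrow> S (s + t) x = S s (S t x)"
    and S_continuous_0: "\<And>x. x \<in> V \<Longrightarrow> ((\<lambda>t. S t x) \<longlongrightarrow> x) (at_right 0)"
begin

section \<open>Orbits, their integrals and the generator\<close>

definition gen :: "'b \<Rightarrow> 'b \<Rightarrow> bool" where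
  "gen x y \<longleftrightarrow> x \<in> V \<and> y \<in> V \<and> ((\<lambda>t. (1 / t) *\<^sub>R (S t x - x)) \<longlongrightarrow> y) (at_right 0)"

lemmas V_diff = subspace_diff[OF subspace_V]
  and V_add = subspace_add[OF subspace_V]
  and V_scale = subspace_scale[OF subspace_V]

lemma S_diff:
  assumes "0 \<le> t" "x \<in> V" "y \<in> V"
  shows "S t (x - y) = S t x - S t y"
  using S_add[OF assms(1,2) V_scale[OF assms(3), of "-1"]] S_scaleR[OF assms(1,3), of "-1"] by simp

text \<open>The operator of the earlier time is a common factor of both values, and contraction
  removes it. Right continuity at 0 thereby gives continuity at every time.\<close>

lemma S_dist_le:
  assumes "x \<in> V" "0 \<le> s" "0 \<le> t"
  shows "norm (S s x - S t x) \<le> norm (S \<bar>s - t\<bar> x - x)"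
proof -
  have *: "norm (S (t + h) x - S t x) \<le> norm (S h x - x)" if "0 \<le> t" "0 \<le> h" for t h
    using contraction[of t "S h x - x"] that assms(1)
    by (simp add: S_semigroup S_diff V_diff in_V)
  show ?thesis
  proof (cases "t \<le> s")
    case True
    then show ?thesis using *[of t "s - t"] assms by simp
  next
    case False
    then show ?thesis using *[of s "t - s"] assms by (simp add: norm_minus_commute)
  qed
qed

lemma S_continuous_on:
  assumes "x \<in> V"
  shows "continuous_on {0..} (\<lambda>t. S t x)"
  unfolding continuous_on_iff
proof (intro ballI allI impI)
  fix t e :: real
  assume t: "t \<in> {0..}" and e: "0 < e"
  have "\<forall>\<^sub>F h in at_right 0. dist (S h x) x < e"
    by (rule tendstoD[OF S_continuous_0[OF assms] e])
  then obtain d where d: "d > 0" "\<And>h. 0 < h \<Longrightarrow> h < d \<Longrightarrow> dist (S h x) x < e"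
    unfolding eventually_at_right_field by auto
  have "dist (S s x) (S t x) < e" if s: "s \<in> {0..}" "dist s t < d" for s
  proof (cases "s = t")
    case False
    then have "norm (S \<bar>s - t\<bar> x - x) < e"
      using d(2)[of "\<bar>s - t\<bar>"] s by (simp add: dist_norm)
    then show ?thesis
      using S_dist_le[OF assms, of s t] s t by (simp add: dist_norm)
  qed (use e in simp)
  then show "\<exists>d>0. \<forall>s\<in>{0..}. dist s t < d \<longrightarrow> dist (S s x) (S t x) < e"
    using d(1) by auto
qed

lemma S_integrable: "x \<in> V \<Longrightarrow> 0 \<le> a \<Longrightarrow> (\<lambda>s. S s x) integrable_on {a..b}"
  by (rule integrable_continuous_real, rule continuous_on_subset[OF S_continuous_on]) auto

lemma integral_in_V: "x \<in> V \<Longrightarrow> 0 \<le> a \<Longrightarrow> integral {a..b} (\<lambda>s. S s x) \<in> V"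
  by (rule integral_in_closed_subspace[OF subspace_V closed_V S_integrable]) (auto simp: in_V)

lemma S_tendsto:
  assumes "0 \<le> t" "l \<in> V" "\<forall>\<^sub>F n in F. z n \<in> V" "(z \<longlongrightarrow> l) F"
  shows "((\<lambda>n. S t (z n)) \<longlongrightarrow> S t l) F"
proof (rule LIM_zero_cancel, rule Lim_null_comparison)
  show "\<forall>\<^sub>F n in F. norm (S t (z n) - S t l) \<le> norm (z n - l)"
    using assms(3)
    by eventually_elim (metis S_diff assms(1,2) contraction V_diff)
  show "((\<lambda>n. norm (z n - l)) \<longlongrightarrow> 0) F"
    by (rule tendsto_norm_zero[OF LIM_zero[OF assms(4)]])
qed

text \<open>
  \<open>S h\<close> is only linear on \<open>V\<close>, so it is moved under the integral by applying
  \<open>integral_in_closed_subspace\<close> to its graph.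
\<close>

lemma S_integral:
  assumes x: "x \<in> V" and "0 \<le> h" "0 \<le> a"
  shows "S h (integral {a..b} (\<lambda>s. S s x)) = integral {a + h..b + h} (\<lambda>s. S s x)"
proof -
  define G where "G = {(v, S h v) | v. v \<in> V}"
  have "subspace G"
    unfolding subspace_def
  proof (intro conjI ballI allI)
    have "S h 0 = 0" using S_scaleR[OF \<open>0 \<le> h\<close> x, of 0] by simp
    then show "0 \<in> G" unfolding G_def using subspace_0[OF subspace_V] by (auto simp: zero_prod_def)
    show "u + v \<in> G" if "u \<in> G" "v \<in> G" for u v
      using that \<open>0 \<le> h\<close> unfolding G_def by (force simp: S_add V_add)
    show "c *\<^sub>R u \<in> G" if "u \<in> G" for c u
      using that \<open>0 \<le> h\<close> unfolding G_def by (force simp: S_scaleR V_scale)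
  qed
  moreover have "closed G"
    unfolding closed_sequential_limits
  proof (intro allI impI, elim conjE)
    fix z l assume z: "\<forall>n. z n \<in> G" and l: "z \<longlonglongrightarrow> l"
    have zV: "fst (z n) \<in> V" "snd (z n) = S h (fst (z n))" for n
      using z[rule_format, of n] by (auto simp: G_def)
    have lim1: "(\<lambda>n. fst (z n)) \<longlonglongrightarrow> fst l" by (rule tendsto_fst[OF l])
    have lV: "fst l \<in> V"
      by (rule closed_sequentially[OF closed_V zV(1) lim1])
    have "(\<lambda>n. S h (fst (z n))) \<longlonglongrightarrow> S h (fst l)"
      by (rule S_tendsto[OF \<open>0 \<le> h\<close> lV _ lim1]) (simp add: zV)
    moreover have "(\<lambda>n. S h (fst (z n))) \<longlonglongrightarrow> snd l"
      using tendsto_snd[OF l] by (simp add: zV)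
    ultimately have "snd l = S h (fst l)" by (rule LIMSEQ_unique[symmetric])
    then show "l \<in> G" unfolding G_def using lV by (metis (mono_tags, lifting) mem_Collect_eq prod.collapse)
  qed
  moreover have int1: "(\<lambda>s. S s x) integrable_on {a..b}"
    by (rule S_integrable[OF x \<open>0 \<le> a\<close>])
  have cont: "continuous_on {a..b} (\<lambda>s. S (s + h) x)"
    by (rule continuous_on_compose2[OF S_continuous_on[OF x]])
      (use assms in \<open>auto intro!: continuous_intros\<close>)
  have int2: "(\<lambda>s. S (s + h) x) integrable_on {a..b}"
    by (rule integrable_continuous_real[OF cont])
  have cont1: "continuous_on {a..b} (\<lambda>s. S s x)"
    by (rule continuous_on_subset[OF S_continuous_on[OF x]]) (use \<open>0 \<le> a\<close> in auto)
  have intp: "(\<lambda>s. (S s x, S (s + h) x)) integrable_on {a..b}"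
    by (intro integrable_continuous_real continuous_on_Pair cont cont1)
  moreover have "(S s x, S (s + h) x) \<in> G" if "s \<in> {a..b}" for s
    using that assms S_semigroup[of h s x] unfolding G_def by (auto simp: in_V add.commute)
  ultimately have "integral {a..b} (\<lambda>s. (S s x, S (s + h) x)) \<in> G"
    by (rule integral_in_closed_subspace)
  moreover have "fst (integral {a..b} (\<lambda>s. (S s x, S (s + h) x))) = integral {a..b} (\<lambda>s. S s x)"
    using integral_linear[OF intp bounded_linear_fst] by (simp add: o_def)
  moreover have "snd (integral {a..b} (\<lambda>s. (S s x, S (s + h) x))) = integral {a..b} (\<lambda>s. S (s + h) x)"
    using integral_linear[OF intp bounded_linear_snd] by (simp add: o_def)
  ultimately have "S h (integral {a..b} (\<lambda>s. S s x)) = integral {a..b} (\<lambda>s. S (s + h) x)"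
    unfolding G_def by auto
  also have "\<dots> = integral {a + h..b + h} (\<lambda>s. S s x)"
    using integral_shift_Icc_real[of a b "\<lambda>s. S s x" h] by (simp add: o_def add.commute)
  finally show ?thesis .
qed

text \<open>\<open>S h\<close> shifts the interval of integration by h; the overlap cancels and
  leaves two pieces of length h. Divided by h, these converge to values of the orbit, which computes
  the generator on integrals.\<close>

lemma S_integral_increment:
  assumes x: "x \<in> V" and "0 \<le> h" "0 \<le> t"
  shows "S h (integral {0..t} (\<lambda>s. S s x)) - integral {0..t} (\<lambda>s. S s x)
    = integral {t..t + h} (\<lambda>s. S s x) - integral {0..h} (\<lambda>s. S s x)"
proof -
  have "integral {0..h} (\<lambda>s. S s x) + integral {h..t + h} (\<lambda>s. S s x) = integral {0..t + h} (\<lambda>s. S s x)"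
    by (rule Henstock_Kurzweil_Integration.integral_combine) (use assms S_integrable in auto)
  moreover have "integral {0..t} (\<lambda>s. S s x) + integral {t..t + h} (\<lambda>s. S s x) = integral {0..t + h} (\<lambda>s. S s x)"
    by (rule Henstock_Kurzweil_Integration.integral_combine) (use assms S_integrable in auto)
  ultimately show ?thesis
    using S_integral[OF x \<open>0 \<le> h\<close>, of 0 t] by (simp add: algebra_simps)
qed

lemma gen_integral:
  assumes x: "x \<in> V" and t: "0 \<le> t"
  shows "gen (integral {0..t} (\<lambda>s. S s x)) (S t x - x)"
  unfolding gen_def
proof (intro conjI)
  show "integral {0..t} (\<lambda>s. S s x) \<in> V" using x by (simp add: integral_in_V)
  show "S t x - x \<in> V" using x t by (simp add: in_V V_diff)
  have lim: "((\<lambda>h. (1 / h) *\<^sub>R integral {c..c + h} (\<lambda>s. S s x)) \<longlongrightarrow> S c x) (at_right 0)" if "0 \<le> c" for c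
    by (rule integral_approx_right, rule continuous_on_subset[OF S_continuous_on[OF x]]) (use that in auto)
  have "((\<lambda>h. (1 / h) *\<^sub>R integral {t..t + h} (\<lambda>s. S s x) - (1 / h) *\<^sub>R integral {0..0 + h} (\<lambda>s. S s x))
      \<longlongrightarrow> S t x - S 0 x) (at_right 0)"
    by (intro tendsto_diff lim t order_refl)
  then have "((\<lambda>h. (1 / h) *\<^sub>R integral {t..t + h} (\<lambda>s. S s x) - (1 / h) *\<^sub>R integral {0..0 + h} (\<lambda>s. S s x))
      \<longlongrightarrow> S t x - x) (at_right 0)"
    by (simp only: S_zero[OF x])
  then show "((\<lambda>h. (1 / h) *\<^sub>R (S h (integral {0..t} (\<lambda>s. S s x)) - integral {0..t} (\<lambda>s. S s x)))
      \<longlongrightarrow> S t x - x) (at_right 0)"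
  proof (rule Lim_transform_eventually[OF _ eventually_mono[OF eventually_at_right_less[of 0]]])
    fix h :: real assume "0 < h"
    then show "(1 / h) *\<^sub>R integral {t..t + h} (\<lambda>s. S s x) - (1 / h) *\<^sub>R integral {0..0 + h} (\<lambda>s. S s x)
      = (1 / h) *\<^sub>R (S h (integral {0..t} (\<lambda>s. S s x)) - integral {0..t} (\<lambda>s. S s x))"
      using S_integral_increment[OF x _ t, of h] by (simp add: scaleR_diff_right)
  qed
qed

lemma gen_scaleR:
  assumes "gen x y"
  shows "gen (c *\<^sub>R x) (c *\<^sub>R y)"
  unfolding gen_def
proof (intro conjI)
  have "((\<lambda>t. c *\<^sub>R (1 / t) *\<^sub>R (S t x - x)) \<longlongrightarrow> c *\<^sub>R y) (at_right 0)"
    using assms by (intro tendsto_intros) (simp add: gen_def)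
  then show "((\<lambda>t. (1 / t) *\<^sub>R (S t (c *\<^sub>R x) - c *\<^sub>R x)) \<longlongrightarrow> c *\<^sub>R y) (at_right 0)"
  proof (rule Lim_transform_eventually[OF _ eventually_mono[OF eventually_at_right_less[of 0]]])
    fix t :: real assume "0 < t"
    then show "c *\<^sub>R (1 / t) *\<^sub>R (S t x - x) = (1 / t) *\<^sub>R (S t (c *\<^sub>R x) - c *\<^sub>R x)"
      using assms by (simp add: S_scaleR gen_def scaleR_diff_right mult.commute)
  qed
qed (use assms V_scale in \<open>auto simp: gen_def\<close>)

text \<open>Means of the orbit over [0, h] lie in the domain by \<open>gen_integral\<close> and tend
  to \<open>x\<close>. The exponential estimate of the converse is proved on the domain, where
  orbits are differentiable, and density extends it to \<open>V\<close>.\<close>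

lemma gen_dense:
  assumes x: "x \<in> V" and "0 < e"
  shows "\<exists>y z. gen y z \<and> norm (y - x) < e"
proof -
  have "((\<lambda>h. (1 / h) *\<^sub>R integral {0..0 + h} (\<lambda>s. S s x)) \<longlongrightarrow> S 0 x) (at_right 0)"
    by (rule integral_approx_right[OF S_continuous_on[OF x]])
  then have "\<forall>\<^sub>F h in at_right 0. dist ((1 / h) *\<^sub>R integral {0..0 + h} (\<lambda>s. S s x)) x < e"
    using S_zero[OF x] tendstoD \<open>0 < e\<close> by fastforce
  moreover have "\<forall>\<^sub>F h in at_right (0::real). 0 < h" by (rule eventually_at_right_less)
  ultimately have "\<forall>\<^sub>F h in at_right 0. 0 < h \<and> dist ((1 / h) *\<^sub>R integral {0..0 + h} (\<lambda>s. S s x)) x < e"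
    by eventually_elim simp
  then obtain h :: real where h: "0 < h" "dist ((1 / h) *\<^sub>R integral {0..0 + h} (\<lambda>s. S s x)) x < e"
    using eventually_happens'[of "at_right (0::real)"] by auto
  show ?thesis
    using gen_scaleR[OF gen_integral[OF x, of h], of "1 / h"] h by (auto simp: dist_norm)
qed

text \<open>\<open>S t\<close> commutes with the difference quotients. Invariance of the domain lets
  an estimate for a single element of the domain be applied along its whole orbit.\<close>

lemma gen_S:
  assumes g: "gen x y" and t: "0 \<le> t"
  shows "gen (S t x) (S t y)"
  unfolding gen_def
proof (intro conjI)
  have xy: "x \<in> V" "y \<in> V" using g by (auto simp: gen_def)
  show "S t x \<in> V" "S t y \<in> V" using xy t by (auto simp: in_V)
  have "((\<lambda>h. S t ((1 / h) *\<^sub>R (S h x - x))) \<longlongrightarrow> S t y) (at_right 0)"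
  proof (rule S_tendsto[OF t xy(2)])
    show "\<forall>\<^sub>F h in at_right 0. (1 / h) *\<^sub>R (S h x - x) \<in> V"
      using eventually_at_right_less[of "0::real"]
      by eventually_elim (simp add: V_scale V_diff in_V xy)
  qed (use g in \<open>simp add: gen_def\<close>)
  then show "((\<lambda>h. (1 / h) *\<^sub>R (S h (S t x) - S t x)) \<longlongrightarrow> S t y) (at_right 0)"
  proof (rule Lim_transform_eventually[OF _ eventually_mono[OF eventually_at_right_less[of 0]]])
    fix h :: real assume h: "0 < h"
    have "S h (S t x) = S t (S h x)"
      using S_semigroup[of h t x] S_semigroup[of t h x] h t xy by (simp add: add.commute)
    then show "S t ((1 / h) *\<^sub>R (S h x - x)) = (1 / h) *\<^sub>R (S h (S t x) - S t x)"
      using h t xy by (simp add: S_scaleR S_diff V_diff in_V)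
  qed
qed

text \<open>\<open>gen\<close> only provides a right derivative at time 0. To the right of t the
  remainder is the image under \<open>S t\<close> of the remainder at 0. To the left, t = s + h and
  the remainder is the image under \<open>S s\<close> of the remainder at 0 together with h (S h y -
  y), the cost of evaluating the derivative at the far end of the interval; each of the two takes
  half of \<open>e\<close>.\<close>

lemma gen_has_vector_derivative:
  assumes g: "gen x y" and t: "0 \<le> t"
  shows "((\<lambda>s. S s x) has_vector_derivative S t y) (at t within {0..})"
  unfolding has_vector_derivative_def has_derivative_within_alt2
proof (intro conjI allI impI)
  show "bounded_linear (\<lambda>h. h *\<^sub>R S t y)" by (rule bounded_linear_scaleR_left)
  fix e :: real
  assume e: "0 < e"
  have xy: "x \<in> V" "y \<in> V" using g by (auto simp: gen_def)
  have "\<forall>\<^sub>F h in at_right 0. dist ((1 / h) *\<^sub>R (S h x - x)) y < e / 2 \<and> dist (S h y) y < e / 2"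
    using g S_continuous_0[OF xy(2)] e
    by (intro eventually_conj tendstoD) (auto simp: gen_def)
  then obtain d where d: "d > 0" "\<And>h. 0 < h \<Longrightarrow> h < d \<Longrightarrow>
      norm ((1 / h) *\<^sub>R (S h x - x) - y) < e / 2 \<and> norm (S h y - y) < e / 2"
    unfolding eventually_at_right_field dist_norm by auto
  have main: "norm (S h x - x - h *\<^sub>R y) \<le> h * (e / 2)" if h: "0 < h" "h < d" for h
  proof -
    have "S h x - x - h *\<^sub>R y = h *\<^sub>R ((1 / h) *\<^sub>R (S h x - x) - y)"
      using h by (simp add: scaleR_diff_right)
    then show ?thesis using d(2)[OF h] h by (simp add: less_imp_le)
  qed
  have "norm (S s x - S t x - (s - t) *\<^sub>R S t y) \<le> e * norm (s - t)"
    if s: "0 \<le> s" "dist s t < d" for s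
  proof (cases s t rule: linorder_cases)
    case equal
    then show ?thesis by simp
  next
    case greater
    define h where "h = s - t"
    have h: "0 < h" "h < d" "s = t + h" using greater s by (auto simp: h_def dist_norm)
    have "S s x - S t x - h *\<^sub>R S t y = S t (S h x - x - h *\<^sub>R y)"
      using h t xy by (simp add: S_semigroup S_diff V_diff in_V S_scaleR V_scale)
    then have "norm (S s x - S t x - h *\<^sub>R S t y) \<le> norm (S h x - x - h *\<^sub>R y)"
      using contraction[OF t, of "S h x - x - h *\<^sub>R y"] h xy by (simp add: in_V V_diff V_scale)
    also have "\<dots> \<le> h * (e / 2)" by (rule main[OF h(1,2)])
    also have "\<dots> \<le> e * h" using h e by simp
    finally show ?thesis using h by simp
  next
    case less
    define h where "h = t - s"
    have h: "0 < h" "h < d" "t = s + h" using less s by (auto simp: h_def dist_norm)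
    have "S s (h *\<^sub>R (S h y - y) - (S h x - x - h *\<^sub>R y))
        = h *\<^sub>R (S s (S h y) - S s y) - (S s (S h x) - S s x - h *\<^sub>R S s y)"
      using h s xy by (simp add: S_diff V_diff in_V S_scaleR V_scale)
    moreover have "S t x = S s (S h x)" "S t y = S s (S h y)"
      unfolding h(3) using h s xy by (simp_all add: S_semigroup)
    ultimately have "S s x - S t x + h *\<^sub>R S t y = S s (h *\<^sub>R (S h y - y) - (S h x - x - h *\<^sub>R y))"
      by (simp add: algebra_simps)
    then have "norm (S s x - S t x + h *\<^sub>R S t y) \<le> norm (h *\<^sub>R (S h y - y) - (S h x - x - h *\<^sub>R y))"
      using contraction[OF s(1), of "h *\<^sub>R (S h y - y) - (S h x - x - h *\<^sub>R y)"] h xy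
      by (simp add: in_V V_diff V_scale)
    also have "\<dots> \<le> norm (h *\<^sub>R (S h y - y)) + norm (S h x - x - h *\<^sub>R y)"
      by (rule norm_triangle_ineq4)
    also have "\<dots> \<le> h * (e / 2) + h * (e / 2)"
      using main[OF h(1,2)] d(2)[OF h(1,2)] h by (intro add_mono) (auto intro: less_imp_le)
    finally show ?thesis using h by (simp add: mult.commute)
  qed
  then show "\<forall>\<^sub>F s in at t within {0..}. norm (S s x - S t x - (s - t) *\<^sub>R S t y) \<le> e * norm (s - t)"
    unfolding eventually_at using d(1) by auto
qed

text \<open>
  The potential operator: \<open>R = \<integral>\<^sub>0\<^sup>\<infinity> S s x ds\<close> satisfies \<open>S h R - R = - \<integral>\<^sub>0\<^sup>h S s x ds\<close>, so the generator
  maps it to \<open>- x\<close>.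
\<close>

lemma exponentially_stable_imp_gen_surj:
  assumes decay: "\<And>t x. 0 \<le> t \<Longrightarrow> x \<in> V \<Longrightarrow> norm (S t x) \<le> C * exp (- \<nu> * t) * norm x"
    and "0 < \<nu>" "0 \<le> C" and x: "x \<in> V"
  shows "\<exists>R. gen R (- x) \<and> norm R \<le> C / \<nu> * norm x"
proof -
  define I where "I a b = integral {a..b} (\<lambda>s. S s x)" for a b
  have bound: "norm (I a b) \<le> C * norm x * (exp (- \<nu> * a) - exp (- \<nu> * b)) / \<nu>" if "0 \<le> a" "a \<le> b" for a b
  proof -
    have e: "((\<lambda>s. C * norm x * exp (- \<nu> * s)) has_integral
        (- C * norm x * exp (- \<nu> * b) / \<nu> - - C * norm x * exp (- \<nu> * a) / \<nu>)) {a..b}"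
      using that \<open>0 < \<nu>\<close>
      by (intro fundamental_theorem_of_calculus)
        (auto intro!: derivative_eq_intros simp: has_real_derivative_iff_has_vector_derivative[symmetric])
    have "norm (I a b) \<le> integral {a..b} (\<lambda>s. C * norm x * exp (- \<nu> * s))"
      unfolding I_def
      by (rule integral_norm_bound_integral)
        (use that x e decay in \<open>auto simp: S_integrable has_integral_integrable mult_ac\<close>)
    also have "\<dots> = C * norm x * (exp (- \<nu> * a) - exp (- \<nu> * b)) / \<nu>"
      using integral_unique[OF e] \<open>0 < \<nu>\<close> by (simp add: field_simps)
    finally show ?thesis .
  qed
  have bound': "norm (I a b) \<le> C / \<nu> * norm x * exp (- \<nu> * a)" if "0 \<le> a" "a \<le> b" for a b
  proof -
    have "norm (I a b) \<le> C / \<nu> * norm x * (exp (- \<nu> * a) - exp (- \<nu> * b))"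
      using bound[OF that] by (simp add: field_simps)
    also have "\<dots> \<le> C / \<nu> * norm x * exp (- \<nu> * a)"
      by (rule mult_left_mono) (use assms in auto)
    finally show ?thesis .
  qed
  have exp0: "(\<lambda>n. exp (- \<nu> * real n)) \<longlonglongrightarrow> 0"
  proof -
    have "(\<lambda>n. exp (- \<nu>) ^ n) \<longlonglongrightarrow> 0"
      using \<open>0 < \<nu>\<close> by (intro LIMSEQ_power_zero) simp
    then show ?thesis by (simp add: exp_of_nat_mult[symmetric] mult.commute)
  qed
  have split: "I 0 a + I a b = I 0 b" if "0 \<le> a" "a \<le> b" for a b
    unfolding I_def
    by (rule Henstock_Kurzweil_Integration.integral_combine) (use that x S_integrable in auto)
  have "Cauchy (\<lambda>n. I 0 (real n))"
  proof (rule CauchyI)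
    fix e :: real assume "0 < e"
    have "(\<lambda>n. C / \<nu> * norm x * exp (- \<nu> * real n)) \<longlonglongrightarrow> C / \<nu> * norm x * 0"
      by (intro tendsto_mult_left exp0)
    then have "\<forall>\<^sub>F n in sequentially. C / \<nu> * norm x * exp (- \<nu> * real n) < e / 2"
      using \<open>0 < e\<close> by (intro order_tendstoD) auto
    then obtain N where N: "C / \<nu> * norm x * exp (- \<nu> * real N) < e / 2"
      unfolding eventually_sequentially by blast
    have *: "norm (I 0 (real n) - I 0 (real N)) < e / 2" if "N \<le> n" for n
    proof -
      have "I 0 (real n) - I 0 (real N) = I (real N) (real n)"
        using split[of "real N" "real n"] that by (simp add: algebra_simps)
      then show ?thesis using le_less_trans[OF bound'[of "real N" "real n"] N] that by simp
    qed
    show "\<exists>M. \<forall>m\<ge>M. \<forall>n\<ge>M. norm (I 0 (real m) - I 0 (real n)) < e"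
    proof (intro exI[of _ N] allI impI)
      fix m n assume "N \<le> m" "N \<le> n"
      then show "norm (I 0 (real m) - I 0 (real n)) < e"
        using *[of m] *[of n] norm_triangle_ineq4[of "I 0 (real m) - I 0 (real N)" "I 0 (real n) - I 0 (real N)"]
        by simp
    qed
  qed
  then obtain R where R: "(\<lambda>n. I 0 (real n)) \<longlonglongrightarrow> R"
    using Cauchy_convergent convergent_def by blast
  have IV: "I 0 (real n) \<in> V" for n
    unfolding I_def by (simp add: integral_in_V x)
  have RV: "R \<in> V"
    by (rule closed_sequentially[OF closed_V IV R])
  have "norm (I 0 (real n)) \<le> C / \<nu> * norm x" for n
    using bound'[of 0 "real n"] by simp
  then have normR: "norm R \<le> C / \<nu> * norm x"
    by (intro Lim_norm_ubound[OF _ R]) auto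
  \<comment> \<open>In \<open>S_integral_increment\<close> with t = n, the piece over [n, n + h] is
    removed by the decay and only the piece at the origin survives.\<close>
  have inc: "S h R - R = - I 0 h" if h: "0 \<le> h" for h
  proof (rule LIMSEQ_unique)
    show "(\<lambda>n. S h (I 0 (real n)) - I 0 (real n)) \<longlonglongrightarrow> S h R - R"
      by (intro tendsto_diff R S_tendsto[OF h RV _ R]) (simp add: IV)
    have "(\<lambda>n. C / \<nu> * norm x * exp (- \<nu> * real n)) \<longlonglongrightarrow> C / \<nu> * norm x * 0"
      by (intro tendsto_mult_left exp0)
    then have "(\<lambda>n. C / \<nu> * norm x * exp (- \<nu> * real n)) \<longlonglongrightarrow> 0" by simp
    then have "(\<lambda>n. I (real n) (real n + h)) \<longlonglongrightarrow> 0"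
      by (rule Lim_null_comparison[rotated]) (use bound' h in simp)
    then have "(\<lambda>n. I (real n) (real n + h) - I 0 h) \<longlonglongrightarrow> 0 - I 0 h"
      by (intro tendsto_intros)
    then show "(\<lambda>n. S h (I 0 (real n)) - I 0 (real n)) \<longlonglongrightarrow> - I 0 h"
      using S_integral_increment[OF x h] by (simp add: I_def)
  qed
  have "((\<lambda>h. - ((1 / h) *\<^sub>R I 0 (0 + h))) \<longlongrightarrow> - S 0 x) (at_right 0)"
    unfolding I_def by (intro tendsto_minus integral_approx_right S_continuous_on x)
  then have "((\<lambda>h. - ((1 / h) *\<^sub>R I 0 (0 + h))) \<longlongrightarrow> - x) (at_right 0)"
    by (simp only: S_zero[OF x])
  then have "((\<lambda>h. (1 / h) *\<^sub>R (S h R - R)) \<longlongrightarrow> - x) (at_right 0)"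
  proof (rule Lim_transform_eventually[OF _ eventually_mono[OF eventually_at_right_less[of 0]]])
    fix h :: real assume "0 < h"
    then show "- ((1 / h) *\<^sub>R I 0 (0 + h)) = (1 / h) *\<^sub>R (S h R - R)"
      using inc[of h] by simp
  qed
  then have "gen R (- x)"
    unfolding gen_def using RV V_scale[OF x, of "-1"] by simp
  then show ?thesis using normR by blast
qed

end

section \<open>Test functions\<close>

lemma partial_deriv_eq:
  "(\<phi> has_derivative D) (at x) \<Longrightarrow> partial_deriv i \<phi> x = D (axis i 1)"
  by (simp add: partial_deriv_def frechet_derivative_at[symmetric])

lemma partial_deriv_bounded_linear:
  assumes "bounded_linear h" "\<phi> differentiable (at x)"
  shows "partial_deriv i (\<lambda>x. h (\<phi> x)) x = h (partial_deriv i \<phi> x)"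
    and "(\<lambda>x. h (\<phi> x)) differentiable (at x)"
proof -
  obtain D where D: "(\<phi> has_derivative D) (at x)"
    using assms(2) by (auto simp: differentiable_def)
  have hD: "((\<lambda>x. h (\<phi> x)) has_derivative (\<lambda>y. h (D y))) (at x)"
    by (rule bounded_linear.has_derivative[OF assms(1) D])
  show "partial_deriv i (\<lambda>x. h (\<phi> x)) x = h (partial_deriv i \<phi> x)"
    by (simp add: partial_deriv_eq[OF D] partial_deriv_eq[OF hD])
  show "(\<lambda>x. h (\<phi> x)) differentiable (at x)" using hD by (auto simp: differentiable_def)
qed

lemma partial_deriv_add:
  assumes "\<phi> differentiable (at x)" "\<psi> differentiable (at x)"
  shows "partial_deriv i (\<lambda>x. \<phi> x + \<psi> x) x = partial_deriv i \<phi> x + partial_deriv i \<psi> x"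
proof -
  obtain D E where D: "(\<phi> has_derivative D) (at x)" and E: "(\<psi> has_derivative E) (at x)"
    using assms by (auto simp: differentiable_def)
  show ?thesis
    by (simp add: partial_deriv_eq[OF D] partial_deriv_eq[OF E] partial_deriv_eq[OF has_derivative_add[OF D E]])
qed

lemma partial_deriv_mult:
  assumes "\<phi> differentiable (at x)" "\<psi> differentiable (at x)"
  shows "partial_deriv i (\<lambda>x. \<phi> x * \<psi> x) x = \<phi> x * partial_deriv i \<psi> x + partial_deriv i \<phi> x * \<psi> x"
proof -
  obtain D E where D: "(\<phi> has_derivative D) (at x)" and E: "(\<psi> has_derivative E) (at x)"
    using assms by (auto simp: differentiable_def)
  show ?thesis
    by (simp add: partial_deriv_eq[OF D] partial_deriv_eq[OF E] partial_deriv_eq[OF has_derivative_mult[OF D E]])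
qed

lemma C_k_Suc_imp: "C_k (Suc k) \<phi> \<Longrightarrow> C_k k \<phi>"
proof (induction k arbitrary: \<phi>)
  case 0
  then show ?case
    by (auto simp: continuous_on_eq_continuous_at differentiable_imp_continuous_within)
next
  case (Suc k)
  from Suc.prems have "\<phi> differentiable (at x)" for x by simp
  moreover from Suc.prems have "C_k (Suc k) (partial_deriv i \<phi>)" for i by simp
  ultimately show ?case using Suc.IH by simp
qed

lemma C_k_bounded_linear:
  assumes "bounded_linear h"
  shows "C_k k \<phi> \<Longrightarrow> C_k k (\<lambda>x. h (\<phi> x))"
proof (induction k arbitrary: \<phi>)
  case 0
  then show ?case
    using bounded_linear.continuous_on[OF assms] by simp
next
  case (Suc k)
  have "partial_deriv i (\<lambda>x. h (\<phi> x)) = (\<lambda>x. h (partial_deriv i \<phi> x))" for i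
    using Suc.prems by (intro ext) (simp add: partial_deriv_bounded_linear(1)[OF assms])
  then show ?case
    using Suc by (simp add: partial_deriv_bounded_linear(2)[OF assms])
qed

lemma C_k_add: "C_k k \<phi> \<Longrightarrow> C_k k \<psi> \<Longrightarrow> C_k k (\<lambda>x. \<phi> x + \<psi> x)"
proof (induction k arbitrary: \<phi> \<psi>)
  case 0
  then show ?case by (auto intro: continuous_on_add)
next
  case (Suc k)
  have "partial_deriv i (\<lambda>x. \<phi> x + \<psi> x) = (\<lambda>x. partial_deriv i \<phi> x + partial_deriv i \<psi> x)" for i
    using Suc.prems by (intro ext) (simp add: partial_deriv_add)
  then show ?case using Suc by simp
qed

lemma C_k_mult: "C_k k \<phi> \<Longrightarrow> C_k k \<psi> \<Longrightarrow> C_k k (\<lambda>x. \<phi> x * \<psi> x)"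
proof (induction k arbitrary: \<phi> \<psi>)
  case 0
  then show ?case by (auto intro: continuous_on_mult)
next
  case (Suc k)
  have "partial_deriv i (\<lambda>x. \<phi> x * \<psi> x) =
      (\<lambda>x. \<phi> x * partial_deriv i \<psi> x + partial_deriv i \<phi> x * \<psi> x)" for i
    using Suc.prems by (intro ext) (simp add: partial_deriv_mult)
  moreover have "C_k k \<phi>" "C_k k \<psi>" using Suc.prems C_k_Suc_imp by blast+
  ultimately show ?case using Suc by (auto intro!: C_k_add)
qed

text \<open>Plane waves are the smooth multipliers of \<open>H01_grad_zero_imp_zero\<close>: they
  have modulus one, so L2 norms are kept, and differentiation only multiplies them by a
  constant.\<close>

lemma plane_wave_derivative:
  "((\<lambda>x. exp (\<i> * of_real (s * x $ j))) has_derivative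
    (\<lambda>y. exp (\<i> * of_real (s * x $ j)) * (\<i> * of_real (s * y $ j)))) (at x)"
  for s :: real and x :: "real^'d"
proof -
  have "bounded_linear (\<lambda>y::real^'d. \<i> * complex_of_real (s * y $ j))"
    by (intro bounded_linear_compose[OF bounded_linear_mult_right]
        bounded_linear_compose[OF bounded_linear_of_real] bounded_linear_compose[OF bounded_linear_mult_right]
        bounded_linear_vec_nth)
  then have "((\<lambda>y::real^'d. \<i> * complex_of_real (s * y $ j)) has_derivative (\<lambda>y. \<i> * of_real (s * y $ j))) (at x)"
    by (rule bounded_linear_imp_has_derivative)
  moreover have "(exp has_derivative (*) (exp (\<i> * complex_of_real (s * x $ j))))
      (at (\<i> * complex_of_real (s * x $ j)))"
    using DERIV_exp by (simp add: has_field_derivative_def)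
  ultimately show ?thesis
    by (rule has_derivative_compose)
qed

lemma partial_deriv_plane_wave:
  "partial_deriv i (\<lambda>x. exp (\<i> * of_real (s * x $ j))) x
    = (if i = j then \<i> * of_real s else 0) * exp (\<i> * of_real (s * x $ j))"
  unfolding partial_deriv_eq[OF plane_wave_derivative] by (simp add: axis_def)

lemma C_k_plane_wave: "C_k k (\<lambda>x. exp (\<i> * of_real (s * x $ j)))"
proof (induction k)
  case 0
  then show ?case by (auto intro!: continuous_intros)
next
  case (Suc k)
  have "(\<lambda>x. exp (\<i> * of_real (s * x $ j))) differentiable (at x)" for x
    using plane_wave_derivative[of s j x] unfolding differentiable_def by blast
  moreover have "partial_deriv i (\<lambda>x. exp (\<i> * of_real (s * x $ j)))
      = (\<lambda>x. (if i = j then \<i> * of_real s else 0) * exp (\<i> * of_real (s * x $ j)))" for i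
    by (rule ext, rule partial_deriv_plane_wave)
  moreover have "C_k k (\<lambda>x. c * exp (\<i> * of_real (s * x $ j)))" for c
    by (rule C_k_bounded_linear[OF bounded_linear_mult_right Suc])
  ultimately show ?case by simp
qed

text \<open>Any compact subset of \<Omega> off which \<phi> vanishes may replace the exact support.
  Supports of sums, products and derivatives then never have to be computed.\<close>

lemma test_functions_iff:
  "\<phi> \<in> test_functions \<Omega> \<longleftrightarrow> (\<forall>k. C_k k \<phi>) \<and> (\<exists>K. compact K \<and> K \<subseteq> \<Omega> \<and> (\<forall>x. x \<notin> K \<longrightarrow> \<phi> x = 0))"
proof
  assume "\<phi> \<in> test_functions \<Omega>"
  then show "(\<forall>k. C_k k \<phi>) \<and> (\<exists>K. compact K \<and> K \<subseteq> \<Omega> \<and> (\<forall>x. x \<notin> K \<longrightarrow> \<phi> x = 0))"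
    using closure_subset[of "{x. \<phi> x \<noteq> 0}"]
    by (auto simp: test_functions_def intro!: exI[of _ "closure {x. \<phi> x \<noteq> 0}"])
next
  assume *: "(\<forall>k. C_k k \<phi>) \<and> (\<exists>K. compact K \<and> K \<subseteq> \<Omega> \<and> (\<forall>x. x \<notin> K \<longrightarrow> \<phi> x = 0))"
  then obtain K where K: "compact K" "K \<subseteq> \<Omega>" "\<And>x. x \<notin> K \<Longrightarrow> \<phi> x = 0" by blast
  have "closure {x. \<phi> x \<noteq> 0} \<subseteq> K"
    by (rule closure_minimal) (use K compact_imp_closed in auto)
  then show "\<phi> \<in> test_functions \<Omega>"
    using * K compact_Int_closed[OF K(1), of "closure {x. \<phi> x \<noteq> 0}"]
    by (auto simp: test_functions_def inf.absorb2)
qed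

lemma test_functions_C_k: "\<phi> \<in> test_functions \<Omega> \<Longrightarrow> C_k k \<phi>"
  by (simp add: test_functions_iff)

lemma test_functions_differentiable: "\<phi> \<in> test_functions \<Omega> \<Longrightarrow> \<phi> differentiable (at x)"
  using test_functions_C_k[of \<phi> \<Omega> 1] by simp

lemma test_functions_continuous: "\<phi> \<in> test_functions \<Omega> \<Longrightarrow> continuous_on UNIV \<phi>"
  using test_functions_C_k[of \<phi> \<Omega> 0] by simp

section \<open>Algebraic operations on test functions\<close>

lemma test_functions_zero: "(\<lambda>x. 0) \<in> test_functions (\<Omega> :: (real^'d) set)"
proof -
  have "C_k k (\<lambda>x::real^'d. 0)" for k
  proof (induction k)
    case (Suc k)
    have "partial_deriv i (\<lambda>x::real^'d. 0) = (\<lambda>x. 0)" for i by (intro ext) (simp add: partial_deriv_def)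
    then show ?case using Suc by simp
  qed simp
  then show ?thesis by (auto simp: test_functions_iff intro: exI[of _ "{}"])
qed

lemma test_functions_add:
  assumes "\<phi> \<in> test_functions \<Omega>" "\<psi> \<in> test_functions \<Omega>"
  shows "(\<lambda>x. \<phi> x + \<psi> x) \<in> test_functions \<Omega>"
proof -
  obtain K L where "compact K" "K \<subseteq> \<Omega>" "\<And>x. x \<notin> K \<Longrightarrow> \<phi> x = 0"
    and "compact L" "L \<subseteq> \<Omega>" "\<And>x. x \<notin> L \<Longrightarrow> \<psi> x = 0"
    using assms by (auto simp: test_functions_iff)
  then show ?thesis
    using assms by (auto simp: test_functions_iff C_k_add intro!: exI[of _ "K \<union> L"])
qed

lemma test_functions_bounded_linear:
  assumes "bounded_linear h" "\<phi> \<in> test_functions \<Omega>"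
  shows "(\<lambda>x. h (\<phi> x)) \<in> test_functions \<Omega>"
proof -
  have "h 0 = 0" using assms(1) by (simp add: linear_0 bounded_linear.linear)
  then show ?thesis using assms by (auto simp: test_functions_iff C_k_bounded_linear)
qed

lemma test_functions_mult:
  assumes "\<And>k. C_k k w" "\<phi> \<in> test_functions \<Omega>"
  shows "(\<lambda>x. w x * \<phi> x) \<in> test_functions \<Omega>"
  using assms by (auto simp: test_functions_iff C_k_mult)

lemma test_functions_diff:
  assumes "\<phi> \<in> test_functions \<Omega>" "\<psi> \<in> test_functions \<Omega>"
  shows "(\<lambda>x. \<phi> x - \<psi> x) \<in> test_functions \<Omega>"
  using test_functions_add[OF assms(1) test_functions_bounded_linear[OF bounded_linear_minus[OF bounded_linear_ident] assms(2)]]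
  by simp

lemma test_functions_partial_deriv:
  assumes "\<phi> \<in> test_functions \<Omega>"
  shows "partial_deriv i \<phi> \<in> test_functions \<Omega>"
proof -
  obtain K where K: "compact K" "K \<subseteq> \<Omega>" "\<And>x. x \<notin> K \<Longrightarrow> \<phi> x = 0"
    using assms by (auto simp: test_functions_iff)
  have "partial_deriv i \<phi> x = 0" if "x \<notin> K" for x
  proof -
    have "((\<lambda>_. 0::complex) has_derivative (\<lambda>_. 0)) (at x)" by simp
    then have "(\<phi> has_derivative (\<lambda>_. 0)) (at x)"
      by (rule has_derivative_transform_within_open[of _ _ _ _ "- K"])
        (use that K compact_imp_closed in auto)
    then show ?thesis by (simp add: partial_deriv_eq)
  qed
  moreover have "C_k k (partial_deriv i \<phi>)" for k
    using test_functions_C_k[OF assms, of "Suc k"] by simp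
  ultimately show ?thesis using K by (auto simp: test_functions_iff)
qed

section \<open>Integrability of test functions and integration by parts\<close>

lemma compact_support_integrable:
  fixes f :: "'a::euclidean_space \<Rightarrow> 'b::euclidean_space"
  assumes "continuous_on UNIV f" "compact K" "\<And>x. x \<notin> K \<Longrightarrow> f x = 0"
  shows "integrable lborel f"
proof -
  have "set_integrable lborel K f"
    unfolding set_integrable_def
    by (rule borel_integrable_compact) (use assms continuous_on_subset[OF assms(1), of K] in auto)
  then show ?thesis
    unfolding set_integrable_def
    by (rule back_subst[of "integrable lborel"]) (use assms(3) in \<open>auto simp: indicator_def\<close>)
qed

lemma integrable_lborel_imp_lebesgue_on:
  fixes f :: "'a::euclidean_space \<Rightarrow> 'b::euclidean_space"
  assumes "integrable lborel f" "\<Omega> \<in> sets lebesgue"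
  shows "integrable (lebesgue_on \<Omega>) f"
proof -
  have "integrable lebesgue f"
    using assms(1) by (subst integrable_completion) auto
  then show ?thesis
    using assms(2) by (simp add: integrable_restrict_space integrable_mult_indicator)
qed

lemma compact_support_L2:
  fixes f :: "'a::euclidean_space \<Rightarrow> 'b::euclidean_space"
  assumes f: "continuous_on UNIV f" and K: "compact K" "\<And>x. x \<notin> K \<Longrightarrow> f x = 0"
    and \<Omega>: "\<Omega> \<in> sets lebesgue"
  shows "f \<in> L2 \<Omega>"
proof -
  have "integrable lborel (\<lambda>x. (norm (f x))\<^sup>2)"
    by (rule compact_support_integrable[OF _ K(1)]) (use f K(2) in \<open>auto intro!: continuous_intros\<close>)
  moreover have "f \<in> borel_measurable (lebesgue_on \<Omega>)"
    using f by (intro measurable_restrict_space1 measurable_completion) (simp add: borel_measurable_continuous_onI)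
  ultimately show ?thesis
    using \<Omega> by (simp add: L2_iff integrable_lborel_imp_lebesgue_on)
qed

lemma test_functions_L2:
  assumes "\<phi> \<in> test_functions U" "\<Omega> \<in> sets lebesgue"
  shows "\<phi> \<in> L2 \<Omega>"
proof -
  obtain K where "compact K" "\<And>x. x \<notin> K \<Longrightarrow> \<phi> x = 0"
    using assms(1) by (auto simp: test_functions_iff)
  then show ?thesis
    by (rule compact_support_L2[OF test_functions_continuous[OF assms(1)] _ _ assms(2)])
qed

lemma grad_L2:
  assumes "\<phi> \<in> test_functions U" "\<Omega> \<in> sets lebesgue"
  shows "grad \<phi> \<in> L2 \<Omega>"
proof -
  have "\<exists>K. compact K \<and> (\<forall>x. x \<notin> K \<longrightarrow> partial_deriv i \<phi> x = 0)" for i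
    using test_functions_partial_deriv[OF assms(1), of i] by (auto simp: test_functions_iff)
  then obtain K where K: "\<And>i. compact (K i)" "\<And>i x. x \<notin> K i \<Longrightarrow> partial_deriv i \<phi> x = 0"
    by metis
  show ?thesis
  proof (rule compact_support_L2[OF _ _ _ assms(2)])
    show "continuous_on UNIV (grad \<phi>)"
      unfolding grad_def
      by (intro continuous_on_vec_lambda test_functions_continuous[OF test_functions_partial_deriv[OF assms(1)]])
    show "compact (\<Union>i. K i)" using K(1) by (intro compact_UN) auto
    show "grad \<phi> x = 0" if "x \<notin> (\<Union>i. K i)" for x
      using that K(2) by (auto simp: grad_def vec_eq_iff)
  qed
qed

text \<open>
  By translation invariance the difference quotients of \<open>\<phi>\<close> have integral zero; they converge
  boundedly, with supports in a fixed compact set, to the partial derivative.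
\<close>

lemma integral_partial_deriv_lborel:
  fixes \<phi> :: "real^'d \<Rightarrow> complex"
  assumes \<phi>: "\<phi> \<in> test_functions UNIV"
  shows "(\<integral>x. partial_deriv i \<phi> x \<partial>lborel) = 0"
proof -
  obtain K where K: "compact K" "\<And>x. x \<notin> K \<Longrightarrow> \<phi> x = 0"
    using \<phi> by (auto simp: test_functions_iff)
  obtain L where L: "compact L" "\<And>x. x \<notin> L \<Longrightarrow> partial_deriv i \<phi> x = 0"
    using test_functions_partial_deriv[OF \<phi>, of i] by (auto simp: test_functions_iff)
  have cont: "continuous_on UNIV \<phi>" "continuous_on UNIV (partial_deriv i \<phi>)"
    using test_functions_continuous \<phi> test_functions_partial_deriv by blast+
  have "compact (partial_deriv i \<phi> ` L)"
    by (rule compact_continuous_image[OF continuous_on_subset[OF cont(2)] L(1)]) simp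
  then obtain B where B: "0 < B" "\<And>x. x \<in> L \<Longrightarrow> norm (partial_deriv i \<phi> x) \<le> B"
    using compact_imp_bounded bounded_pos by (metis imageI)
  have B': "norm (partial_deriv i \<phi> x) \<le> B" for x
    using B L(2)[of x] by (cases "x \<in> L") auto
  have [measurable]: "\<phi> \<in> borel_measurable borel" "partial_deriv i \<phi> \<in> borel_measurable borel"
    using cont by (simp_all add: borel_measurable_continuous_onI)
  let ?e = "axis i 1 :: real^'d"
  have line: "((\<lambda>s. \<phi> (x + s *\<^sub>R ?e)) has_derivative (\<lambda>h. h *\<^sub>R partial_deriv i \<phi> (x + s *\<^sub>R ?e))) (at s)" for x s
  proof -
    obtain D where D: "(\<phi> has_derivative D) (at (x + s *\<^sub>R ?e))"
      using test_functions_differentiable[OF \<phi>] by (auto simp: differentiable_def)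
    have "((\<lambda>s. x + s *\<^sub>R ?e) has_derivative (\<lambda>h. h *\<^sub>R ?e)) (at s)"
      by (auto intro!: derivative_eq_intros)
    then have "((\<lambda>s. \<phi> (x + s *\<^sub>R ?e)) has_derivative (\<lambda>h. D (h *\<^sub>R ?e))) (at s)"
      using D by (rule has_derivative_compose)
    then show ?thesis
      using linear_scale[OF has_derivative_linear[OF D]] by (simp add: partial_deriv_eq[OF D])
  qed
  define h where "h n = inverse (real (Suc n))" for n
  have h: "0 < h n" "h n \<le> 1" for n by (simp_all add: h_def field_simps)
  define Q where "Q n x = (1 / h n) *\<^sub>R (\<phi> (x + h n *\<^sub>R ?e) - \<phi> x)" for n x
  have int: "integrable lborel \<phi>"
    by (rule compact_support_integrable[OF cont(1) K])
  have "(\<integral>x. Q n x \<partial>lborel) = 0" for n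
  proof -
    have "(\<integral>x. \<phi> (h n *\<^sub>R ?e + x) \<partial>lborel) = (\<integral>x. \<phi> x \<partial>distr lborel borel ((+) (h n *\<^sub>R ?e)))"
      by (rule integral_distr[symmetric]) auto
    also have "\<dots> = (\<integral>x. \<phi> x \<partial>lborel)" by (simp add: lborel_distr_plus)
    finally have "(\<integral>x. \<phi> (x + h n *\<^sub>R ?e) \<partial>lborel) = (\<integral>x. \<phi> x \<partial>lborel)" by (simp add: add.commute)
    moreover have "integrable lborel (\<lambda>x. \<phi> (x + h n *\<^sub>R ?e))"
    proof -
      have "integrable (distr lborel borel ((+) (h n *\<^sub>R ?e))) \<phi>"
        using int by (simp add: lborel_distr_plus)
      then show ?thesis
        by (subst (asm) integrable_distr_eq) (auto simp: add.commute)
    qed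
    ultimately show ?thesis using int by (simp add: Q_def)
  qed
  moreover have "(\<lambda>n. \<integral>x. Q n x \<partial>lborel) \<longlonglongrightarrow> (\<integral>x. partial_deriv i \<phi> x \<partial>lborel)"
  proof (rule integral_dominated_convergence)
    \<comment> \<open>\<open>K'\<close> sweeps \<open>K\<close> backwards along the axis by every
      shift in [0, 1], because 0 < h n \<le> 1. For x outside \<open>K'\<close>, neither x nor its
      shift by \<open>h n\<close> lies in \<open>K\<close>, so \<open>Q n\<close> vanishes at
      x.\<close>
    define K' where "K' = (\<lambda>(x, s). x - s *\<^sub>R ?e) ` (K \<times> {0..1})"
    have K': "compact K'"
      unfolding K'_def
      by (intro compact_continuous_image compact_Times K(1))
        (auto simp: case_prod_beta intro!: continuous_intros)
    show "integrable lborel (\<lambda>x. indicator K' x *\<^sub>R B)"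
      using borel_integrable_compact[OF K', of "\<lambda>x. B"] by simp
    show "AE x in lborel. norm (Q n x) \<le> indicator K' x *\<^sub>R B" for n
    proof (rule AE_I2)
      fix x
      show "norm (Q n x) \<le> indicator K' x *\<^sub>R B"
      proof (cases "x \<in> K'")
        case True
        have "norm (\<phi> (x + h n *\<^sub>R ?e) - \<phi> (x + 0 *\<^sub>R ?e)) \<le> B * norm (h n - 0)"
        proof (rule differentiable_bound[where S = UNIV and f = "\<lambda>s. \<phi> (x + s *\<^sub>R ?e)"])
          show "onorm (\<lambda>h. h *\<^sub>R partial_deriv i \<phi> (x + s *\<^sub>R ?e)) \<le> B" for s
            by (rule onorm_le) (use B' in \<open>auto simp: mult.commute[of B] intro!: mult_left_mono\<close>)
        qed (use line in auto)
        then have "norm (\<phi> (x + h n *\<^sub>R ?e) - \<phi> x) / h n \<le> B"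
          using h[of n] by (simp add: field_simps)
        then show ?thesis using h(1)[of n] True by (simp add: Q_def del: scaleR_diff_right)
      next
        case False
        have "x \<notin> K" "x + h n *\<^sub>R ?e \<notin> K"
        proof -
          show "x \<notin> K"
          proof
            assume "x \<in> K"
            then have "(\<lambda>(x, s). x - s *\<^sub>R ?e) (x, 0) \<in> K'" unfolding K'_def by (intro imageI) auto
            then show False using False by simp
          qed
          show "x + h n *\<^sub>R ?e \<notin> K"
          proof
            assume "x + h n *\<^sub>R ?e \<in> K"
            then have "(\<lambda>(x, s). x - s *\<^sub>R ?e) (x + h n *\<^sub>R ?e, h n) \<in> K'"
              unfolding K'_def using h[of n] by (intro imageI) auto
            then show False using False by simp
          qed
        qed
        then show ?thesis using K(2) False by (simp add: Q_def)
      qed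
    qed
    show "AE x in lborel. (\<lambda>n. Q n x) \<longlonglongrightarrow> partial_deriv i \<phi> x"
    proof (rule AE_I2)
      fix x
      have "(\<lambda>s. norm (\<phi> (x + s *\<^sub>R ?e) - \<phi> x - s *\<^sub>R partial_deriv i \<phi> x) / norm s) \<midarrow>0\<rightarrow> 0"
        using line[of x 0] unfolding has_derivative_at by simp
      moreover have "filterlim h (at 0) sequentially"
        unfolding filterlim_at using LIMSEQ_inverse_real_of_nat h(1)
        by (auto simp: h_def[abs_def] simp del: of_nat_Suc)
      ultimately have lim: "(\<lambda>n. norm (\<phi> (x + h n *\<^sub>R ?e) - \<phi> x - h n *\<^sub>R partial_deriv i \<phi> x) / norm (h n)) \<longlonglongrightarrow> 0"
        by (rule filterlim_compose)
      have "norm (Q n x - partial_deriv i \<phi> x)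
          = norm (\<phi> (x + h n *\<^sub>R ?e) - \<phi> x - h n *\<^sub>R partial_deriv i \<phi> x) / norm (h n)" for n
      proof -
        have "Q n x - partial_deriv i \<phi> x
            = (1 / h n) *\<^sub>R (\<phi> (x + h n *\<^sub>R ?e) - \<phi> x - h n *\<^sub>R partial_deriv i \<phi> x)"
          using h(1)[of n] by (simp add: Q_def scaleR_diff_right)
        then show ?thesis using h(1)[of n] by (simp del: scaleR_diff_right)
      qed
      then have "(\<lambda>n. norm (Q n x - partial_deriv i \<phi> x)) \<longlonglongrightarrow> 0"
        using lim by (simp only:)
      then show "(\<lambda>n. Q n x) \<longlonglongrightarrow> partial_deriv i \<phi> x"
        by (rule LIM_zero_cancel[OF tendsto_norm_zero_cancel])
    qed
  qed (auto simp: Q_def)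
  ultimately show ?thesis by (simp add: LIMSEQ_const_iff)
qed

lemma integral_partial_deriv:
  fixes \<phi> :: "real^'d \<Rightarrow> complex"
  assumes \<phi>: "\<phi> \<in> test_functions \<Omega>" and \<Omega>: "\<Omega> \<in> sets lebesgue"
  shows "(\<integral>x. partial_deriv i \<phi> x \<partial>lebesgue_on \<Omega>) = 0"
proof -
  have d: "partial_deriv i \<phi> \<in> test_functions \<Omega>" by (rule test_functions_partial_deriv[OF \<phi>])
  then have z: "partial_deriv i \<phi> x = 0" if "x \<notin> \<Omega>" for x
    using that by (auto simp: test_functions_iff)
  have "(\<integral>x. partial_deriv i \<phi> x \<partial>lebesgue_on \<Omega>) = (\<integral>x. indicator \<Omega> x *\<^sub>R partial_deriv i \<phi> x \<partial>lebesgue)"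
    using \<Omega> by (simp add: integral_restrict_space)
  also have "\<dots> = (\<integral>x. partial_deriv i \<phi> x \<partial>lebesgue)"
    by (rule Bochner_Integration.integral_cong) (use z in \<open>auto simp: indicator_def\<close>)
  also have "\<dots> = (\<integral>x. partial_deriv i \<phi> x \<partial>lborel)"
    using test_functions_continuous[OF d] by (intro integral_completion) (simp add: borel_measurable_continuous_onI)
  also have "\<dots> = 0"
    using \<phi> by (intro integral_partial_deriv_lborel) (auto simp: test_functions_iff)
  finally show ?thesis .
qed

section \<open>Weak gradients\<close>

text \<open>Cauchy-Schwarz in the real Hilbert space of classes, applied to the pointwise norms.
  Passing to norms allows \<open>u\<close>, \<open>v\<close> and \<open>f\<close> to take values in
  different spaces.\<close>

lemma L2_Hoelder:
  fixes u :: "'a::euclidean_space \<Rightarrow> 'b::euclidean_space" and v :: "'a \<Rightarrow> 'c::euclidean_space"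
    and f :: "'a \<Rightarrow> 'e::euclidean_space"
  assumes \<Omega>: "\<Omega> \<in> sets lebesgue" and u: "u \<in> L2 \<Omega>" and v: "v \<in> L2 \<Omega>"
    and f: "f \<in> borel_measurable (lebesgue_on \<Omega>)"
    and le: "AE x in lebesgue_on \<Omega>. norm (f x) \<le> norm (u x) * norm (v x)"
  shows "norm (\<integral>x. f x \<partial>lebesgue_on \<Omega>) \<le> L2_norm \<Omega> u * L2_norm \<Omega> v"
proof -
  have nu: "(\<lambda>x. norm (u x)) \<in> L2 \<Omega>" and nv: "(\<lambda>x. norm (v x)) \<in> L2 \<Omega>"
    using u v by (auto simp: L2_iff)
  have "norm (\<integral>x. f x \<partial>lebesgue_on \<Omega>) \<le> (\<integral>x. norm (f x) \<partial>lebesgue_on \<Omega>)"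
    by (rule integral_norm_bound)
  also have "\<dots> \<le> (\<integral>x. norm (u x) \<bullet> norm (v x) \<partial>lebesgue_on \<Omega>)"
    using L2_product_integrable[OF u v f le] L2_inner_integrable[OF nu nv] le
    by (intro integral_mono_AE) auto
  also have "\<dots> = lsq_of \<Omega> (\<lambda>x. norm (u x)) \<bullet> lsq_of \<Omega> (\<lambda>x. norm (v x))"
    by (rule inner_lsq_of[OF \<Omega> nu nv, symmetric])
  also have "\<dots> \<le> norm (lsq_of \<Omega> (\<lambda>x. norm (u x))) * norm (lsq_of \<Omega> (\<lambda>x. norm (v x)))"
    by (rule norm_cauchy_schwarz)
  also have "\<dots> = L2_norm \<Omega> u * L2_norm \<Omega> v"
    using \<Omega> nu nv by (simp add: norm_lsq_of) (simp add: L2_norm_def)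
  finally show ?thesis .
qed

lemma L2_minus:
  assumes "u \<in> L2 \<Omega>" "v \<in> L2 \<Omega>"
  shows "u - v \<in> L2 \<Omega>"
  using L2_diff[OF assms] by (simp add: fun_diff_def)

lemma bounded_linear_measurable:
  fixes P :: "'b::euclidean_space \<Rightarrow> 'c::euclidean_space"
  assumes "bounded_linear P" "u \<in> borel_measurable M"
  shows "(\<lambda>x. P (u x)) \<in> borel_measurable M"
  using measurable_compose[OF assms(2) borel_measurable_continuous_onI[OF linear_continuous_on[OF assms(1)]]] .

text \<open>\<open>P\<close> is the identity when functions converge and a coordinate projection
  when gradients converge; one Hoelder estimate treats both cases.\<close>

lemma L2_tendsto_integral:
  fixes u :: "'a::euclidean_space \<Rightarrow> 'b::euclidean_space" and v :: "'a \<Rightarrow> complex" and P :: "'b \<Rightarrow> complex"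
  assumes \<Omega>: "\<Omega> \<in> sets lebesgue" and P: "bounded_linear P" "\<And>y. norm (P y) \<le> norm y"
    and un: "\<And>n. un n \<in> L2 \<Omega>" and u: "u \<in> L2 \<Omega>" and v: "v \<in> L2 \<Omega>"
    and lim: "(\<lambda>n. L2_norm \<Omega> (un n - u)) \<longlonglongrightarrow> 0"
  shows "(\<lambda>n. \<integral>x. P (un n x) * v x \<partial>lebesgue_on \<Omega>) \<longlonglongrightarrow> (\<integral>x. P (u x) * v x \<partial>lebesgue_on \<Omega>)"
proof -
  let ?I = "\<lambda>w. \<integral>x. P (w x) * v x \<partial>lebesgue_on \<Omega>"
  have meas: "(\<lambda>x. P (w x) * v x) \<in> borel_measurable (lebesgue_on \<Omega>)" if "w \<in> L2 \<Omega>" for w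
    by (intro borel_measurable_times bounded_linear_measurable[OF P(1)] L2_measurable that v)
  have bound: "norm (P (w x) * v x) \<le> norm (w x) * norm (v x)" for w x
    by (simp add: norm_mult P(2) mult_right_mono)
  have int: "integrable (lebesgue_on \<Omega>) (\<lambda>x. P (w x) * v x)" if "w \<in> L2 \<Omega>" for w
    by (rule L2_product_integrable[OF that v meas[OF that]]) (simp add: bound)
  have "norm (?I (un n) - ?I u)
      \<le> L2_norm \<Omega> (un n - u) * L2_norm \<Omega> v" for n
  proof -
    have "P (un n x) * v x - P (u x) * v x = P ((un n - u) x) * v x" for x
      using linear_diff[OF bounded_linear.linear[OF P(1)]] by (simp add: fun_diff_def left_diff_distrib)
    then have "?I (un n) - ?I u
        = ?I (un n - u)"
      using int[OF un] int[OF u] by (simp flip: Bochner_Integration.integral_diff)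
    moreover have "norm (?I (un n - u)) \<le> L2_norm \<Omega> (un n - u) * L2_norm \<Omega> v"
      by (rule L2_Hoelder[OF \<Omega> L2_minus[OF un u] v meas[OF L2_minus[OF un u]]]) (intro AE_I2 bound)
    ultimately show ?thesis by (simp only:)
  qed
  moreover have "(\<lambda>n. L2_norm \<Omega> (un n - u) * L2_norm \<Omega> v) \<longlonglongrightarrow> 0"
    using tendsto_mult_right[OF lim, of "L2_norm \<Omega> v"] by simp
  ultimately have "(\<lambda>n. ?I (un n) - ?I u) \<longlonglongrightarrow> 0"
    by (metis (no_types, lifting) Lim_null_comparison always_eventually)
  then show ?thesis by (rule LIM_zero_cancel)
qed

text \<open>The product of two test functions is again a test function, so its derivative has
  integral zero; the product rule splits that integral into the two required ones.\<close>

lemma has_weak_gradient_test: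
  assumes \<Omega>: "\<Omega> \<in> sets lebesgue" and \<phi>: "\<phi> \<in> test_functions \<Omega>"
  shows "has_weak_gradient \<Omega> \<phi> (grad \<phi>)"
  unfolding has_weak_gradient_def
proof (intro ballI allI)
  fix \<eta> i assume \<eta>: "\<eta> \<in> test_functions \<Omega>"
  have int: "integrable (lebesgue_on \<Omega>) (\<lambda>x. \<psi> x * \<theta> x)" if "\<psi> \<in> test_functions \<Omega>" "\<theta> \<in> test_functions \<Omega>" for \<psi> \<theta>
  proof (rule L2_product_integrable)
    show L2: "\<psi> \<in> L2 \<Omega>" "\<theta> \<in> L2 \<Omega>"
      using that \<Omega> by (simp_all add: test_functions_L2)
    show "(\<lambda>x. \<psi> x * \<theta> x) \<in> borel_measurable (lebesgue_on \<Omega>)"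
      by (intro borel_measurable_times L2_measurable L2)
  qed (simp add: norm_mult)
  have prod: "(\<lambda>x. \<phi> x * \<eta> x) \<in> test_functions \<Omega>"
    by (rule test_functions_mult[OF test_functions_C_k[OF \<phi>] \<eta>])
  have "(\<integral>x. \<phi> x * partial_deriv i \<eta> x + partial_deriv i \<phi> x * \<eta> x \<partial>lebesgue_on \<Omega>)
      = (\<integral>x. partial_deriv i (\<lambda>x. \<phi> x * \<eta> x) x \<partial>lebesgue_on \<Omega>)"
    using \<phi> \<eta> by (simp add: partial_deriv_mult test_functions_differentiable)
  also have "\<dots> = 0" by (rule integral_partial_deriv[OF prod \<Omega>])
  finally show "(\<integral>x. \<phi> x * partial_deriv i \<eta> x \<partial>lebesgue_on \<Omega>)
      = - (\<integral>x. grad \<phi> x $ i * \<eta> x \<partial>lebesgue_on \<Omega>)"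
    using int[OF \<phi> test_functions_partial_deriv[OF \<eta>, of i]] int[OF test_functions_partial_deriv[OF \<phi>, of i] \<eta>]
    by (simp add: grad_def eq_neg_iff_add_eq_0)
qed

lemma has_weak_gradient_limit:
  assumes \<Omega>: "\<Omega> \<in> sets lebesgue" and \<phi>: "\<And>n. \<phi> n \<in> test_functions \<Omega>"
    and u: "u \<in> L2 \<Omega>" "(\<lambda>n. L2_norm \<Omega> (\<phi> n - u)) \<longlonglongrightarrow> 0"
    and G: "G \<in> L2 \<Omega>" "(\<lambda>n. L2_norm \<Omega> (grad (\<phi> n) - G)) \<longlonglongrightarrow> 0"
  shows "has_weak_gradient \<Omega> u G"
  unfolding has_weak_gradient_def
proof (intro ballI allI)
  fix \<eta> i assume \<eta>: "\<eta> \<in> test_functions \<Omega>"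
  have "(\<lambda>n. \<integral>x. \<phi> n x * partial_deriv i \<eta> x \<partial>lebesgue_on \<Omega>) \<longlonglongrightarrow> (\<integral>x. u x * partial_deriv i \<eta> x \<partial>lebesgue_on \<Omega>)"
    by (rule L2_tendsto_integral[OF \<Omega> bounded_linear_ident order_refl _ u(1) _ u(2)])
      (use \<Omega> \<phi> \<eta> test_functions_L2 test_functions_partial_deriv in blast)+
  moreover have "(\<lambda>n. \<integral>x. grad (\<phi> n) x $ i * \<eta> x \<partial>lebesgue_on \<Omega>) \<longlonglongrightarrow> (\<integral>x. G x $ i * \<eta> x \<partial>lebesgue_on \<Omega>)"
    by (rule L2_tendsto_integral[OF \<Omega> bounded_linear_vec_nth Finite_Cartesian_Product.norm_nth_le _ G(1) _ G(2)])
      (use \<Omega> \<phi> \<eta> test_functions_L2 grad_L2 in blast)+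
  then have "(\<lambda>n. - (\<integral>x. grad (\<phi> n) x $ i * \<eta> x \<partial>lebesgue_on \<Omega>)) \<longlonglongrightarrow> - (\<integral>x. G x $ i * \<eta> x \<partial>lebesgue_on \<Omega>)"
    by (rule tendsto_minus)
  moreover have "(\<integral>x. \<phi> n x * partial_deriv i \<eta> x \<partial>lebesgue_on \<Omega>) = - (\<integral>x. grad (\<phi> n) x $ i * \<eta> x \<partial>lebesgue_on \<Omega>)" for n
    using has_weak_gradient_test[OF \<Omega> \<phi>] \<eta> by (simp add: has_weak_gradient_def)
  ultimately show "(\<integral>x. u x * partial_deriv i \<eta> x \<partial>lebesgue_on \<Omega>) = - (\<integral>x. G x $ i * \<eta> x \<partial>lebesgue_on \<Omega>)"
    by (simp add: LIMSEQ_unique)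
qed

lemma L2_norm_zero_fun [simp]: "L2_norm \<Omega> 0 = 0"
  by (simp add: L2_norm_def zero_fun_def)

text \<open>The weak-gradient clause of \<open>H01_grad\<close> passes to limits of test functions,
  so only the approximation has to be checked.\<close>

lemma H01_gradI:
  assumes "\<Omega> \<in> sets lebesgue" "\<And>n. \<phi> n \<in> test_functions \<Omega>"
    and "u \<in> L2 \<Omega>" "(\<lambda>n. L2_norm \<Omega> (\<phi> n - u)) \<longlonglongrightarrow> 0"
    and "G \<in> L2 \<Omega>" "(\<lambda>n. L2_norm \<Omega> (grad (\<phi> n) - G)) \<longlonglongrightarrow> 0"
  shows "H01_grad \<Omega> u G"
  unfolding H01_grad_def using assms has_weak_gradient_limit[OF assms] by blast

lemma H01_grad_test:
  assumes "\<Omega> \<in> sets lebesgue" "\<phi> \<in> test_functions \<Omega>"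
  shows "H01_grad \<Omega> \<phi> (grad \<phi>)"
  by (rule H01_gradI[of _ "\<lambda>n. \<phi>"]) (use assms in \<open>auto simp: test_functions_L2 grad_L2\<close>)

lemma L2_norm_triangle_diff:
  assumes "\<Omega> \<in> sets lebesgue" "u \<in> L2 \<Omega>" "v \<in> L2 \<Omega>"
  shows "L2_norm \<Omega> (u - v) \<le> L2_norm \<Omega> u + L2_norm \<Omega> v"
  using norm_triangle_ineq4[of "lsq_of \<Omega> u" "lsq_of \<Omega> v"] assms
  by (simp add: lsq_of_diff[symmetric] norm_lsq_of L2_diff fun_diff_def)

lemma grad_diff:
  assumes "\<phi> \<in> test_functions \<Omega>" "\<psi> \<in> test_functions \<Omega>"
  shows "grad (\<phi> - \<psi>) = grad \<phi> - grad \<psi>"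
proof -
  have "partial_deriv i (\<lambda>x. \<phi> x + - \<psi> x) x = partial_deriv i \<phi> x + - partial_deriv i \<psi> x" for i x
    using assms
    by (simp add: partial_deriv_add partial_deriv_bounded_linear[OF bounded_linear_minus[OF bounded_linear_ident]]
        test_functions_differentiable del: add_uminus_conv_diff)
  then show ?thesis by (auto simp: grad_def fun_diff_def vec_eq_iff)
qed

lemma L2_norm_diff_tendsto:
  assumes \<Omega>: "\<Omega> \<in> sets lebesgue" and "\<And>n. un n \<in> L2 \<Omega>" "u \<in> L2 \<Omega>" "\<And>n. vn n \<in> L2 \<Omega>" "v \<in> L2 \<Omega>"
    and "(\<lambda>n. L2_norm \<Omega> (un n - u)) \<longlonglongrightarrow> 0" "(\<lambda>n. L2_norm \<Omega> (vn n - v)) \<longlonglongrightarrow> 0"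
  shows "(\<lambda>n. L2_norm \<Omega> ((un n - vn n) - (u - v))) \<longlonglongrightarrow> 0"
proof (rule Lim_null_comparison)
  show "(\<lambda>n. L2_norm \<Omega> (un n - u) + L2_norm \<Omega> (vn n - v)) \<longlonglongrightarrow> 0"
    using tendsto_add[OF assms(6,7)] by simp
  have eq: "(un n - vn n) - (u - v) = (un n - u) - (vn n - v)" for n
    by (simp add: fun_diff_def fun_eq_iff)
  have "L2_norm \<Omega> ((un n - vn n) - (u - v)) \<le> L2_norm \<Omega> (un n - u) + L2_norm \<Omega> (vn n - v)" for n
    unfolding eq by (rule L2_norm_triangle_diff[OF \<Omega> L2_minus[OF assms(2,3)] L2_minus[OF assms(4,5)]])
  then show "\<forall>\<^sub>F n in sequentially. norm (L2_norm \<Omega> ((un n - vn n) - (u - v)))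
      \<le> L2_norm \<Omega> (un n - u) + L2_norm \<Omega> (vn n - v)"
    by (auto intro!: always_eventually)
qed

lemma H01_grad_diff:
  assumes \<Omega>: "\<Omega> \<in> sets lebesgue" and "H01_grad \<Omega> u G" "H01_grad \<Omega> v H"
  shows "H01_grad \<Omega> (u - v) (G - H)"
proof -
  have L2: "u \<in> L2 \<Omega>" "G \<in> L2 \<Omega>" "v \<in> L2 \<Omega>" "H \<in> L2 \<Omega>"
    using assms by (auto simp: H01_grad_def)
  obtain \<phi> where \<phi>: "\<And>n. \<phi> n \<in> test_functions \<Omega>" "(\<lambda>n. L2_norm \<Omega> (\<phi> n - u)) \<longlonglongrightarrow> 0"
      "(\<lambda>n. L2_norm \<Omega> (grad (\<phi> n) - G)) \<longlonglongrightarrow> 0"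
    using assms(2) unfolding H01_grad_def by blast
  obtain \<psi> where \<psi>: "\<And>n. \<psi> n \<in> test_functions \<Omega>" "(\<lambda>n. L2_norm \<Omega> (\<psi> n - v)) \<longlonglongrightarrow> 0"
      "(\<lambda>n. L2_norm \<Omega> (grad (\<psi> n) - H)) \<longlonglongrightarrow> 0"
    using assms(3) unfolding H01_grad_def by blast
  show ?thesis
  proof (rule H01_gradI[OF \<Omega>])
    show "\<phi> n - \<psi> n \<in> test_functions \<Omega>" for n
      using test_functions_diff[OF \<phi>(1) \<psi>(1), of n n] by (simp add: fun_diff_def)
    show "(\<lambda>n. L2_norm \<Omega> ((\<phi> n - \<psi> n) - (u - v))) \<longlonglongrightarrow> 0"
      by (intro L2_norm_diff_tendsto \<Omega> L2 \<phi> \<psi> test_functions_L2[OF \<phi>(1) \<Omega>] test_functions_L2[OF \<psi>(1) \<Omega>])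
    show "(\<lambda>n. L2_norm \<Omega> (grad (\<phi> n - \<psi> n) - (G - H))) \<longlonglongrightarrow> 0"
      unfolding grad_diff[OF \<phi>(1) \<psi>(1)]
      by (intro L2_norm_diff_tendsto \<Omega> L2 \<phi> \<psi> grad_L2[OF \<phi>(1) \<Omega>] grad_L2[OF \<psi>(1) \<Omega>])
  qed (use L2 in \<open>simp_all add: L2_minus\<close>)
qed

text \<open>
  Poincare's inequality may fail on \<open>\<Omega>\<close>. Instead, testing the weak gradient with
  \<open>e\<^sup>i\<^sup>s\<^sup>x\<^sub>j cnj \<phi>\<^sub>n\<close> gives \<open>\<integral> e\<^sup>i\<^sup>s\<^sup>x\<^sub>j |u|\<^sup>2 = 0\<close> for every \<open>s \<noteq> 0\<close>, and then \<open>s \<rightarrow> 0\<close>.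
\<close>

lemma H01_grad_zero_imp_zero:
  fixes u :: "real^'d \<Rightarrow> complex"
  assumes \<Omega>: "\<Omega> \<in> sets lebesgue" and H: "H01_grad \<Omega> u G" and G0: "AE x in lebesgue_on \<Omega>. G x = 0"
  shows "AE x in lebesgue_on \<Omega>. u x = 0"
proof -
  have u: "u \<in> L2 \<Omega>" and G: "G \<in> L2 \<Omega>" and weak: "has_weak_gradient \<Omega> u G"
    using H by (auto simp: H01_grad_def)
  obtain \<phi> where \<phi>: "\<And>n. \<phi> n \<in> test_functions \<Omega>" "(\<lambda>n. L2_norm \<Omega> (\<phi> n - u)) \<longlonglongrightarrow> 0"
      "(\<lambda>n. L2_norm \<Omega> (grad (\<phi> n) - G)) \<longlonglongrightarrow> 0"
    using H unfolding H01_grad_def by blast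
  have [measurable]: "u \<in> borel_measurable (lebesgue_on \<Omega>)" by (rule L2_measurable[OF u])
  \<comment> \<open>Any coordinate direction will do; one exists because the index type is
    inhabited.\<close>
  obtain j :: 'd where True by simp
  define e where "e s x = exp (\<i> * complex_of_real (s * x $ j))" for s and x :: "real^'d"
  have e_norm: "norm (e s x) = 1" for s x by (simp add: e_def)
  have e_meas [measurable]: "e s \<in> borel_measurable (lebesgue_on \<Omega>)" for s
  proof -
    have "continuous_on UNIV (e s)" unfolding e_def by (intro continuous_intros)
    then show ?thesis
      by (intro measurable_restrict_space1 measurable_completion) (simp add: borel_measurable_continuous_onI)
  qed
  have uint: "integrable (lebesgue_on \<Omega>) (\<lambda>x. (norm (u x))\<^sup>2)" using u by (simp add: L2_iff)
  have zero: "(\<integral>x. e s x * of_real ((norm (u x))\<^sup>2) \<partial>lebesgue_on \<Omega>) = 0" if s: "s \<noteq> 0" for s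
  proof -
    have ue: "(\<lambda>x. cnj (u x * e s x)) \<in> L2 \<Omega>"
    proof (rule L2_bound[OF u, of _ 1])
      show "(\<lambda>x. cnj (u x * e s x)) \<in> borel_measurable (lebesgue_on \<Omega>)"
        by (intro bounded_linear_measurable[OF bounded_linear_cnj]) measurable
    qed (auto simp: norm_mult e_norm)
    define a where "a n = (\<integral>x. \<phi> n x * cnj (u x * e s x) \<partial>lebesgue_on \<Omega>)" for n
    define b where "b n = (\<integral>x. grad (\<phi> n) x $ j * cnj (u x * e s x) \<partial>lebesgue_on \<Omega>)" for n
    have a: "a \<longlonglongrightarrow> (\<integral>x. u x * cnj (u x * e s x) \<partial>lebesgue_on \<Omega>)"
      unfolding a_def
      by (rule L2_tendsto_integral[OF \<Omega> bounded_linear_ident order_refl test_functions_L2[OF \<phi>(1) \<Omega>] u ue \<phi>(2)])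
    have "b \<longlonglongrightarrow> (\<integral>x. G x $ j * cnj (u x * e s x) \<partial>lebesgue_on \<Omega>)"
      unfolding b_def
      by (rule L2_tendsto_integral[OF \<Omega> bounded_linear_vec_nth Finite_Cartesian_Product.norm_nth_le
            grad_L2[OF \<phi>(1) \<Omega>] G ue \<phi>(3)])
    moreover have "(\<integral>x. G x $ j * cnj (u x * e s x) \<partial>lebesgue_on \<Omega>) = 0"
      by (rule integral_eq_zero_AE) (use G0 in \<open>eventually_elim, simp\<close>)
    ultimately have b: "b \<longlonglongrightarrow> 0" by simp
    \<comment> \<open>The weak identity for \<open>u\<close> has right side zero because
      \<open>G\<close> vanishes. Conjugating it gives integrals in which \<phi> n and its gradient
      appear linearly against the fixed function cnj (u e_s), so that their L2 limits can be
      inserted.\<close>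
    have ab: "- \<i> * of_real s * a n + b n = 0" for n
    proof -
      let ?\<psi> = "\<lambda>x. cnj (\<phi> n x)"
      let ?I = "\<integral>x. - \<i> * of_real s * (\<phi> n x * cnj (u x * e s x)) + grad (\<phi> n) x $ j * cnj (u x * e s x) \<partial>lebesgue_on \<Omega>"
      let ?J = "\<integral>x. u x * partial_deriv j (\<lambda>x. e s x * ?\<psi> x) x \<partial>lebesgue_on \<Omega>"
      have \<psi>: "?\<psi> \<in> test_functions \<Omega>"
        by (rule test_functions_bounded_linear[OF bounded_linear_cnj \<phi>(1)])
      have Ce: "C_k k (e s)" for k unfolding e_def by (rule C_k_plane_wave)
      have \<eta>: "(\<lambda>x. e s x * ?\<psi> x) \<in> test_functions \<Omega>" by (rule test_functions_mult[OF Ce \<psi>])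
      have "partial_deriv j (\<lambda>x. e s x * ?\<psi> x) x = cnj (- \<i> * of_real s * (\<phi> n x * cnj (e s x)) + grad (\<phi> n) x $ j * cnj (e s x))" for x
      proof -
        have "e s differentiable (at x)" using Ce[of 1] by simp
        moreover have "partial_deriv j (e s) x = \<i> * of_real s * e s x"
          unfolding e_def by (subst partial_deriv_plane_wave) simp
        ultimately show ?thesis
          using test_functions_differentiable[OF \<phi>(1)[of n]] test_functions_differentiable[OF \<psi>]
          by (simp add: partial_deriv_mult partial_deriv_bounded_linear(1)[OF bounded_linear_cnj] grad_def)
      qed
      then have "u x * partial_deriv j (\<lambda>x. e s x * ?\<psi> x) x
          = cnj (- \<i> * of_real s * (\<phi> n x * cnj (u x * e s x)) + grad (\<phi> n) x $ j * cnj (u x * e s x))" for x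
        by (simp add: algebra_simps)
      then have "?J
          = cnj ?I"
        by (simp only:) (rule Bochner_Integration.integral_cnj)
      moreover have "?J = - (\<integral>x. G x $ j * (e s x * ?\<psi> x) \<partial>lebesgue_on \<Omega>)"
        using weak \<eta> by (simp add: has_weak_gradient_def)
      moreover have "(\<integral>x. G x $ j * (e s x * ?\<psi> x) \<partial>lebesgue_on \<Omega>) = 0"
        by (rule integral_eq_zero_AE) (use G0 in \<open>eventually_elim, simp\<close>)
      ultimately have "?I = 0"
        by simp
      moreover have "integrable (lebesgue_on \<Omega>) (\<lambda>x. \<phi> n x * cnj (u x * e s x))"
        by (rule L2_product_integrable[OF test_functions_L2[OF \<phi>(1)[of n] \<Omega>] ue
              borel_measurable_times[OF L2_measurable[OF test_functions_L2[OF \<phi>(1)[of n] \<Omega>]] L2_measurable[OF ue]]])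
          (simp add: norm_mult mult.assoc)
      moreover have "integrable (lebesgue_on \<Omega>) (\<lambda>x. grad (\<phi> n) x $ j * cnj (u x * e s x))"
        by (rule L2_product_integrable[OF grad_L2[OF \<phi>(1)[of n] \<Omega>] ue borel_measurable_times[OF
                bounded_linear_measurable[OF bounded_linear_vec_nth L2_measurable[OF grad_L2[OF \<phi>(1)[of n] \<Omega>]]]
                L2_measurable[OF ue]]])
          (simp add: norm_mult Finite_Cartesian_Product.norm_nth_le mult_right_mono flip: mult.assoc)
      ultimately show ?thesis by (simp add: a_def b_def)
    qed
    have "(\<lambda>n. - \<i> * of_real s * a n + b n) \<longlonglongrightarrow> - \<i> * of_real s * (\<integral>x. u x * cnj (u x * e s x) \<partial>lebesgue_on \<Omega>) + 0"
      by (intro tendsto_intros a b)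
    then have "(\<integral>x. u x * cnj (u x * e s x) \<partial>lebesgue_on \<Omega>) = 0"
      unfolding ab using s by (simp add: LIMSEQ_const_iff)
    then have "cnj (\<integral>x. u x * cnj (u x * e s x) \<partial>lebesgue_on \<Omega>) = 0" by simp
    then have "(\<integral>x. cnj (u x * cnj (u x * e s x)) \<partial>lebesgue_on \<Omega>) = 0" by (simp only: Bochner_Integration.integral_cnj)
    moreover have "cnj (u x * cnj (u x * e s x)) = e s x * of_real ((norm (u x))\<^sup>2)" for x
      by (simp add: complex_norm_square algebra_simps del: of_real_power)
    ultimately show ?thesis by (simp only:)
  qed
  have "(\<lambda>n. \<integral>x. e (inverse (real (Suc n))) x * of_real ((norm (u x))\<^sup>2) \<partial>lebesgue_on \<Omega>)
      \<longlonglongrightarrow> (\<integral>x. complex_of_real ((norm (u x))\<^sup>2) \<partial>lebesgue_on \<Omega>)"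
  proof (rule integral_dominated_convergence[OF _ _ uint])
    show "AE x in lebesgue_on \<Omega>. (\<lambda>n. e (inverse (real (Suc n))) x * of_real ((norm (u x))\<^sup>2)) \<longlonglongrightarrow> complex_of_real ((norm (u x))\<^sup>2)"
    proof (rule AE_I2)
      fix x
      have "(\<lambda>n. exp (\<i> * complex_of_real (inverse (real (Suc n)) * x $ j)) * of_real ((norm (u x))\<^sup>2))
          \<longlonglongrightarrow> exp (\<i> * complex_of_real (0 * x $ j)) * of_real ((norm (u x))\<^sup>2)"
        by (intro tendsto_intros LIMSEQ_inverse_real_of_nat)
      then show "(\<lambda>n. e (inverse (real (Suc n))) x * of_real ((norm (u x))\<^sup>2)) \<longlonglongrightarrow> complex_of_real ((norm (u x))\<^sup>2)"
        by (simp add: e_def)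
    qed
    show "AE x in lebesgue_on \<Omega>. norm (e (inverse (real (Suc n))) x * of_real ((norm (u x))\<^sup>2)) \<le> (norm (u x))\<^sup>2" for n
      by (simp add: norm_mult e_norm norm_power)
  qed measurable
  moreover have "(\<integral>x. e (inverse (real (Suc n))) x * of_real ((norm (u x))\<^sup>2) \<partial>lebesgue_on \<Omega>) = 0" for n
    by (rule zero) simp
  ultimately have "(\<integral>x. complex_of_real ((norm (u x))\<^sup>2) \<partial>lebesgue_on \<Omega>) = 0"
    by (simp add: LIMSEQ_const_iff)
  then have "(\<integral>x. (norm (u x))\<^sup>2 \<partial>lebesgue_on \<Omega>) = 0"
    using integral_complex_of_real[of "lebesgue_on \<Omega>" "\<lambda>x. (norm (u x))\<^sup>2"] by (simp del: of_real_power)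
  then show ?thesis
    using L2_norm_eq_0_iff[OF u] by (simp add: L2_norm_def)
qed

section \<open>Locally integrable weights\<close>

text \<open>Local integrability speaks only about compact subsets. Along a compact exhaustion of
  \<Omega> the truncations of \<open>m\<close> are measurable and, at each point, eventually equal
  to \<open>m\<close>.\<close>

lemma L1_loc_measurable:
  assumes "open \<Omega>" "m \<in> L1_loc \<Omega>"
  shows "m \<in> borel_measurable (lebesgue_on \<Omega>)"
proof -
  obtain C where C: "\<And>n. compact (C n)" "\<And>n. C n \<subseteq> \<Omega>" "\<And>n. C n \<subseteq> interior (C (Suc n))" "\<Union>(range C) = \<Omega>"
      "\<And>K. compact K \<Longrightarrow> K \<subseteq> \<Omega> \<Longrightarrow> \<exists>N. \<forall>n\<ge>N. K \<subseteq> C n"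
    by (rule open_Union_compact_subsets[OF assms(1)]) blast
  show ?thesis
  proof (rule borel_measurable_LIMSEQ_real)
    fix x assume "x \<in> space (lebesgue_on \<Omega>)"
    then have "x \<in> \<Omega>" by (simp add: space_restrict_space)
    then obtain N where "\<forall>n\<ge>N. {x} \<subseteq> C n" using C(5)[of "{x}"] by auto
    then have "\<forall>\<^sub>F n in sequentially. indicator (C n) x *\<^sub>R m x = m x"
      by (intro eventually_sequentiallyI[of N]) auto
    then show "(\<lambda>n. indicator (C n) x *\<^sub>R m x) \<longlonglongrightarrow> m x"
      by (rule tendsto_eventually)
  next
    fix n
    have "m absolutely_integrable_on C n" using assms(2) C by (simp add: L1_loc_def)
    then show "(\<lambda>x. indicator (C n) x *\<^sub>R m x) \<in> borel_measurable (lebesgue_on \<Omega>)"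
      unfolding set_integrable_def by (intro measurable_restrict_space1) (rule borel_measurable_integrable)
  qed
qed

lemma sqrt_mult_test_L2:
  assumes \<Omega>: "open \<Omega>" and m: "m \<in> L1_loc \<Omega>" and \<phi>: "\<phi> \<in> test_functions \<Omega>"
  shows "sqrt_mult m \<phi> \<in> L2 \<Omega>"
proof -
  obtain K where K: "compact K" "K \<subseteq> \<Omega>" "\<And>x. x \<notin> K \<Longrightarrow> \<phi> x = 0"
    using \<phi> by (auto simp: test_functions_iff)
  have "compact (\<phi> ` K)"
    by (rule compact_continuous_image[OF continuous_on_subset[OF test_functions_continuous[OF \<phi>]] K(1)]) simp
  then obtain B where B: "\<And>x. x \<in> K \<Longrightarrow> norm (\<phi> x) \<le> B"
    using compact_imp_bounded bounded_pos by (metis imageI)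
  have \<Omega>': "\<Omega> \<in> sets lebesgue" using \<Omega> by simp
  have [measurable]: "m \<in> borel_measurable (lebesgue_on \<Omega>)" "\<phi> \<in> borel_measurable (lebesgue_on \<Omega>)"
    using L1_loc_measurable[OF \<Omega> m] L2_measurable[OF test_functions_L2[OF \<phi> \<Omega>']] by simp_all
  have "integrable lebesgue (\<lambda>x. indicator K x *\<^sub>R m x)"
    using m K by (simp add: L1_loc_def set_integrable_def)
  then have "integrable lebesgue (\<lambda>x. indicator \<Omega> x *\<^sub>R (indicator K x *\<^sub>R m x))"
    by (rule integrable_mult_indicator[OF \<Omega>'])
  then have "integrable (lebesgue_on \<Omega>) (\<lambda>x. indicator K x *\<^sub>R m x)"
    by (rule iffD2[OF integrable_restrict_space, rotated]) (use \<Omega>' in simp)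
  then have "integrable (lebesgue_on \<Omega>) (\<lambda>x. B\<^sup>2 * (indicator K x *\<^sub>R m x))"
    by (rule integrable_mult_right)
  then have "integrable (lebesgue_on \<Omega>) (\<lambda>x. (norm (sqrt_mult m \<phi> x))\<^sup>2)"
  proof (rule Bochner_Integration.integrable_bound)
    show "(\<lambda>x. (norm (sqrt_mult m \<phi> x))\<^sup>2) \<in> borel_measurable (lebesgue_on \<Omega>)"
      unfolding sqrt_mult_def by measurable
    show "AE x in lebesgue_on \<Omega>. norm ((norm (sqrt_mult m \<phi> x))\<^sup>2) \<le> norm (B\<^sup>2 * (indicator K x *\<^sub>R m x))"
    proof (rule AE_I2)
      fix x
      show "norm ((norm (sqrt_mult m \<phi> x))\<^sup>2) \<le> norm (B\<^sup>2 * (indicator K x *\<^sub>R m x))"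
      proof (cases "x \<in> K")
        case True
        have "(norm (\<phi> x))\<^sup>2 \<le> B\<^sup>2" using B[OF True] by (intro power_mono) auto
        then have "(norm (\<phi> x))\<^sup>2 * \<bar>m x\<bar> \<le> B\<^sup>2 * \<bar>m x\<bar>" by (rule mult_right_mono) simp
        \<comment> \<open>The real square root is extended as an odd function, so the square of its
          modulus is the modulus of \<open>m x\<close> for either sign.\<close>
        moreover have "\<bar>sqrt (m x)\<bar>\<^sup>2 = \<bar>m x\<bar>"
          using real_sqrt_pow2[of "m x"] real_sqrt_pow2[of "- m x"]
          by (cases "0 \<le> m x") (auto simp: real_sqrt_minus)
        ultimately show ?thesis using True
          by (simp add: sqrt_mult_def power_mult_distrib abs_mult mult.commute)
      qed (simp add: sqrt_mult_def K(3))
    qed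
  qed
  moreover have "sqrt_mult m \<phi> \<in> borel_measurable (lebesgue_on \<Omega>)"
    unfolding sqrt_mult_def by measurable
  ultimately show ?thesis by (simp add: L2_iff)
qed

lemma test_functions_form_domain:
  assumes "open \<Omega>" "a \<in> L1_loc \<Omega>" "q \<in> L1_loc \<Omega>" "\<phi> \<in> test_functions \<Omega>"
  shows "\<phi> \<in> form_domain \<Omega> a q"
  using assms H01_grad_test[of \<Omega> \<phi>] test_functions_L2[of \<phi> \<Omega> \<Omega>]
  by (auto simp: form_domain_def Dom_sqrt_def sqrt_mult_test_L2)

section \<open>The energy space as a closed subspace of a Hilbert space\<close>

type_synonym 'd w_lsq = "(real^'d, complex^'d) lsq \<times> (real^'d, complex) lsq"

definition embed_W :: "(real^'d) set \<Rightarrow> 'd w_elem \<Rightarrow> 'd w_lsq" where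
  "embed_W \<Omega> u = (lsq_of \<Omega> (W_grad u), lsq_of \<Omega> (W_sqrt_q u))"

definition embed :: "(real^'d) set \<Rightarrow> 'd state \<Rightarrow> 'd w_lsq \<times> (real^'d, complex) lsq" where
  "embed \<Omega> F = (embed_W \<Omega> (fst F), lsq_of \<Omega> (snd F))"

lemma complex_of_real_vector_scale: "complex_of_real r *s v = r *\<^sub>R v"
  by (simp add: vec_eq_iff) (simp add: scaleR_conv_of_real)

lemma state_scale_of_real:
  "state_scale (complex_of_real r) ((G, p), g) = ((\<lambda>x. r *\<^sub>R G x, \<lambda>x. r *\<^sub>R p x), \<lambda>x. r *\<^sub>R g x)"
  by (simp add: complex_of_real_vector_scale scaleR_conv_of_real)

lemma bounded_linear_scaleR_complex: "bounded_linear (\<lambda>z::complex. c *\<^sub>R z)"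
  by (rule bounded_linear_scaleR_right)

lemma grad_add:
  assumes "\<phi> \<in> test_functions \<Omega>" "\<psi> \<in> test_functions \<Omega>"
  shows "grad (\<lambda>x. \<phi> x + \<psi> x) = (\<lambda>x. grad \<phi> x + grad \<psi> x)"
  using assms by (auto simp: grad_def vec_eq_iff partial_deriv_add test_functions_differentiable)

lemma grad_scaleR:
  assumes "\<phi> \<in> test_functions \<Omega>"
  shows "grad (\<lambda>x. c *\<^sub>R \<phi> x) = (\<lambda>x. c *\<^sub>R grad \<phi> x)"
  using assms
  by (auto simp: grad_def vec_eq_iff partial_deriv_bounded_linear[OF bounded_linear_scaleR_complex]
      test_functions_differentiable)

locale damped_wave =
  fixes \<Omega> :: "(real^'d) set" and a q :: "real^'d \<Rightarrow> real" and T :: "real \<Rightarrow> 'd state \<Rightarrow> 'd state"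
  assumes open_\<Omega>: "open \<Omega>"
    and a_L1: "a \<in> L1_loc \<Omega>" and a_nonneg: "AE x in lebesgue_on \<Omega>. 0 \<le> a x"
    and q_L1: "q \<in> L1_loc \<Omega>"
    and semigroup: "damped_wave_semigroup \<Omega> a q T"
begin

abbreviation "\<H> \<equiv> energy_space \<Omega> q"

abbreviation "W_lsq \<equiv> embed_W \<Omega> ` W_space \<Omega> q"

lemma \<Omega>_sets [simp]: "\<Omega> \<in> sets lebesgue"
  using open_\<Omega> by simp

lemma W_space_L2: "u \<in> W_space \<Omega> q \<Longrightarrow> W_grad u \<in> L2 \<Omega> \<and> W_sqrt_q u \<in> L2 \<Omega>"
  by (auto simp: W_space_def)

lemma energy_space_L2:
  assumes "F \<in> \<H>"
  shows "W_grad (fst F) \<in> L2 \<Omega>" "W_sqrt_q (fst F) \<in> L2 \<Omega>" "snd F \<in> L2 \<Omega>"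
  using assms W_space_L2 by (auto simp: energy_space_def)

section \<open>The completion W as the closure of the image of the test functions\<close>

definition test_W :: "(real^'d \<Rightarrow> complex) \<Rightarrow> 'd w_elem" where
  "test_W \<phi> = (grad \<phi>, sqrt_mult q \<phi>)"

lemma test_W_L2:
  assumes "\<phi> \<in> test_functions \<Omega>"
  shows "W_grad (test_W \<phi>) \<in> L2 \<Omega>" "W_sqrt_q (test_W \<phi>) \<in> L2 \<Omega>"
  using assms by (simp_all add: test_W_def grad_L2 sqrt_mult_test_L2 open_\<Omega> q_L1)

definition test_space :: "'d w_lsq set" where
  "test_space = (\<lambda>\<phi>. embed_W \<Omega> (test_W \<phi>)) ` test_functions \<Omega>"

lemma embed_W_test_add:
  assumes "\<phi> \<in> test_functions \<Omega>" "\<psi> \<in> test_functions \<Omega>"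
  shows "embed_W \<Omega> (test_W (\<lambda>x. \<phi> x + \<psi> x)) = embed_W \<Omega> (test_W \<phi>) + embed_W \<Omega> (test_W \<psi>)"
proof -
  have "sqrt_mult q (\<lambda>x. \<phi> x + \<psi> x) = (\<lambda>x. sqrt_mult q \<phi> x + sqrt_mult q \<psi> x)"
    by (simp add: sqrt_mult_def scaleR_right_distrib)
  then show ?thesis
    using test_W_L2[OF assms(1)] test_W_L2[OF assms(2)] assms
    by (simp add: embed_W_def test_W_def grad_add lsq_of_add)
qed

lemma embed_W_test_scaleR:
  assumes "\<phi> \<in> test_functions \<Omega>"
  shows "embed_W \<Omega> (test_W (\<lambda>x. c *\<^sub>R \<phi> x)) = c *\<^sub>R embed_W \<Omega> (test_W \<phi>)"
proof -
  have "sqrt_mult q (\<lambda>x. c *\<^sub>R \<phi> x) = (\<lambda>x. c *\<^sub>R sqrt_mult q \<phi> x)"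
    by (simp add: sqrt_mult_def mult.commute)
  then show ?thesis
    using test_W_L2[OF assms] assms by (simp add: embed_W_def test_W_def grad_scaleR lsq_of_scaleR)
qed

lemma subspace_test_space: "subspace test_space"
  unfolding subspace_def
proof (intro conjI ballI allI)
  have "0 *\<^sub>R embed_W \<Omega> (test_W (\<lambda>x. 0)) = embed_W \<Omega> (test_W (\<lambda>x. 0 *\<^sub>R 0))"
    using embed_W_test_scaleR[OF test_functions_zero, of 0] by simp
  then show "0 \<in> test_space" unfolding test_space_def using test_functions_zero by force
next
  fix x y assume "x \<in> test_space" "y \<in> test_space"
  then show "x + y \<in> test_space"
    unfolding test_space_def by (auto simp: embed_W_test_add[symmetric] intro!: imageI test_functions_add)
next
  fix c x assume "x \<in> test_space"
  then show "c *\<^sub>R x \<in> test_space"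
    unfolding test_space_def
    by (auto simp: embed_W_test_scaleR[symmetric]
        intro!: imageI test_functions_bounded_linear[OF bounded_linear_scaleR_complex])
qed

lemma closure_test_space_iff:
  "y \<in> closure test_space \<longleftrightarrow>
    (\<exists>\<phi>. (\<forall>n. \<phi> n \<in> test_functions \<Omega>) \<and> (\<lambda>n. embed_W \<Omega> (test_W (\<phi> n))) \<longlonglongrightarrow> y)"
proof
  assume "y \<in> closure test_space"
  then obtain x where x: "\<And>n. x n \<in> test_space" "x \<longlonglongrightarrow> y"
    unfolding closure_sequential by blast
  have "\<forall>n. \<exists>\<phi>. \<phi> \<in> test_functions \<Omega> \<and> x n = embed_W \<Omega> (test_W \<phi>)"
    using x(1) unfolding test_space_def by blast
  then obtain \<phi> where \<phi>: "\<And>n. \<phi> n \<in> test_functions \<Omega> \<and> x n = embed_W \<Omega> (test_W (\<phi> n))"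
    by (rule choice[THEN exE]) blast
  then have "x = (\<lambda>n. embed_W \<Omega> (test_W (\<phi> n)))" by (intro ext) simp
  then show "\<exists>\<phi>. (\<forall>n. \<phi> n \<in> test_functions \<Omega>) \<and> (\<lambda>n. embed_W \<Omega> (test_W (\<phi> n))) \<longlonglongrightarrow> y"
    using \<phi> x(2) by (intro exI[of _ \<phi>]) simp
next
  assume "\<exists>\<phi>. (\<forall>n. \<phi> n \<in> test_functions \<Omega>) \<and> (\<lambda>n. embed_W \<Omega> (test_W (\<phi> n))) \<longlonglongrightarrow> y"
  then obtain \<phi> where "\<And>n. \<phi> n \<in> test_functions \<Omega>" "(\<lambda>n. embed_W \<Omega> (test_W (\<phi> n))) \<longlonglongrightarrow> y"
    by blast
  then show "y \<in> closure test_space"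
    unfolding closure_sequential test_space_def
    by (intro exI[of _ "\<lambda>n. embed_W \<Omega> (test_W (\<phi> n))"]) simp
qed

text \<open>Convergence of the two L2 norms is exactly convergence in the product of the two Hilbert
  spaces. Questions about the completion thereby become questions about a closure.\<close>

lemma W_space_iff:
  assumes L2: "W_grad u \<in> L2 \<Omega>" "W_sqrt_q u \<in> L2 \<Omega>"
  shows "u \<in> W_space \<Omega> q \<longleftrightarrow> embed_W \<Omega> u \<in> closure test_space"
proof -
  have dist: "L2_norm \<Omega> (grad \<phi> - W_grad u) = norm (lsq_of \<Omega> (grad \<phi>) - lsq_of \<Omega> (W_grad u))"
    "L2_norm \<Omega> (sqrt_mult q \<phi> - W_sqrt_q u) = norm (lsq_of \<Omega> (sqrt_mult q \<phi>) - lsq_of \<Omega> (W_sqrt_q u))"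
    if "\<phi> \<in> test_functions \<Omega>" for \<phi>
    using L2 test_W_L2[OF that]
    by (simp_all add: test_W_def fun_diff_def lsq_of_diff[symmetric] norm_lsq_of L2_diff)
  have "(\<lambda>n. embed_W \<Omega> (test_W (\<phi> n))) \<longlonglongrightarrow> embed_W \<Omega> u \<longleftrightarrow>
      (\<lambda>n. L2_norm \<Omega> (grad (\<phi> n) - W_grad u)) \<longlonglongrightarrow> 0 \<and>
      (\<lambda>n. L2_norm \<Omega> (sqrt_mult q (\<phi> n) - W_sqrt_q u)) \<longlonglongrightarrow> 0"
    if "\<And>n. \<phi> n \<in> test_functions \<Omega>" for \<phi>
  proof -
    have "(\<lambda>n. embed_W \<Omega> (test_W (\<phi> n))) \<longlonglongrightarrow> embed_W \<Omega> u \<longleftrightarrow>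
        (\<lambda>n. lsq_of \<Omega> (grad (\<phi> n))) \<longlonglongrightarrow> lsq_of \<Omega> (W_grad u) \<and>
        (\<lambda>n. lsq_of \<Omega> (sqrt_mult q (\<phi> n))) \<longlonglongrightarrow> lsq_of \<Omega> (W_sqrt_q u)"
      unfolding embed_W_def test_W_def by (auto dest: tendsto_fst tendsto_snd intro: tendsto_Pair)
    also have "\<dots> \<longleftrightarrow> (\<lambda>n. norm (lsq_of \<Omega> (grad (\<phi> n)) - lsq_of \<Omega> (W_grad u))) \<longlonglongrightarrow> 0 \<and>
        (\<lambda>n. norm (lsq_of \<Omega> (sqrt_mult q (\<phi> n)) - lsq_of \<Omega> (W_sqrt_q u))) \<longlonglongrightarrow> 0"
      by (simp only: tendsto_norm_zero_iff LIM_zero_iff)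
    finally show ?thesis by (simp only: dist[OF that])
  qed
  then have "(\<exists>\<phi>. (\<forall>n. \<phi> n \<in> test_functions \<Omega>) \<and> (\<lambda>n. embed_W \<Omega> (test_W (\<phi> n))) \<longlonglongrightarrow> embed_W \<Omega> u) \<longleftrightarrow>
      (\<exists>\<phi>. (\<forall>n. \<phi> n \<in> test_functions \<Omega>) \<and> (\<lambda>n. L2_norm \<Omega> (grad (\<phi> n) - W_grad u)) \<longlonglongrightarrow> 0 \<and>
        (\<lambda>n. L2_norm \<Omega> (sqrt_mult q (\<phi> n) - W_sqrt_q u)) \<longlonglongrightarrow> 0)"
    by (intro ex_cong1 conj_cong refl) simp
  then show ?thesis
    using L2 unfolding closure_test_space_iff W_space_def case_prod_beta mem_Collect_eq by simp
qed

text \<open>The inclusion from right to left needs that a limit taken among classes on the whole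
  space is still represented by functions on \<Omega>, which \<open>L2_limit_lsq_of\<close> supplies
  for each component. It makes the embedded space closed.\<close>

lemma embed_W_image: "W_lsq = closure test_space"
proof
  show "W_lsq \<subseteq> closure test_space"
    using W_space_iff W_space_L2 by blast
  show "closure test_space \<subseteq> W_lsq"
  proof
    fix y assume y: "y \<in> closure test_space"
    then obtain \<phi> where \<phi>: "\<And>n. \<phi> n \<in> test_functions \<Omega>" "(\<lambda>n. embed_W \<Omega> (test_W (\<phi> n))) \<longlonglongrightarrow> y"
      unfolding closure_test_space_iff by blast
    have "\<exists>G\<in>L2 \<Omega>. fst y = lsq_of \<Omega> G"
      by (rule L2_limit_lsq_of[OF \<Omega>_sets test_W_L2(1)[OF \<phi>(1)]])
        (use tendsto_fst[OF \<phi>(2)] in \<open>simp add: embed_W_def\<close>)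
    moreover have "\<exists>p\<in>L2 \<Omega>. snd y = lsq_of \<Omega> p"
      by (rule L2_limit_lsq_of[OF \<Omega>_sets test_W_L2(2)[OF \<phi>(1)]])
        (use tendsto_snd[OF \<phi>(2)] in \<open>simp add: embed_W_def\<close>)
    ultimately obtain G p where "G \<in> L2 \<Omega>" "p \<in> L2 \<Omega>" "y = embed_W \<Omega> (G, p)"
      by (metis embed_W_def fst_conv snd_conv prod.collapse)
    then show "y \<in> W_lsq"
      using y W_space_iff[of "(G, p)"] by auto
  qed
qed

lemma test_W_in_W_space: "\<phi> \<in> test_functions \<Omega> \<Longrightarrow> test_W \<phi> \<in> W_space \<Omega> q"
  using W_space_iff[OF test_W_L2] closure_subset by (force simp: test_space_def)

lemma subspace_W: "subspace W_lsq"
  unfolding embed_W_image subspace_def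
proof (intro conjI ballI allI)
  show "0 \<in> closure test_space"
    using subspace_0[OF subspace_test_space] closure_subset by blast
next
  fix x y assume "x \<in> closure test_space" "y \<in> closure test_space"
  then obtain f g where "\<And>n. f n \<in> test_space" "f \<longlonglongrightarrow> x" "\<And>n. g n \<in> test_space" "g \<longlonglongrightarrow> y"
    unfolding closure_sequential by blast
  then show "x + y \<in> closure test_space"
    unfolding closure_sequential
    by (intro exI[of _ "\<lambda>n. f n + g n"]) (auto intro: tendsto_add subspace_add[OF subspace_test_space])
next
  fix c x assume "x \<in> closure test_space"
  then obtain f where "\<And>n. f n \<in> test_space" "f \<longlonglongrightarrow> x"
    unfolding closure_sequential by blast
  then show "c *\<^sub>R x \<in> closure test_space"
    unfolding closure_sequential
    by (intro exI[of _ "\<lambda>n. c *\<^sub>R f n"]) (auto intro: tendsto_scaleR subspace_scale[OF subspace_test_space])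
qed

lemma subspace_lsq_of_L2: "subspace (lsq_of \<Omega> ` L2 \<Omega>)"
  unfolding subspace_def
proof (intro conjI ballI allI)
  show "0 \<in> lsq_of \<Omega> ` L2 \<Omega>" using L2_zero lsq_of_zero by (metis imageI)
qed (auto simp flip: lsq_of_add lsq_of_scaleR intro!: imageI L2_add L2_scaleR)

lemma closed_lsq_of_L2: "closed (lsq_of \<Omega> ` L2 \<Omega>)"
  unfolding closed_sequential_limits
proof (intro allI impI, elim conjE)
  fix x l assume x: "\<forall>n. x n \<in> lsq_of \<Omega> ` L2 \<Omega>" and l: "x \<longlonglongrightarrow> l"
  then obtain u where u: "\<And>n. u n \<in> L2 \<Omega>" "x = (\<lambda>n. lsq_of \<Omega> (u n))"
  proof -
    have "\<forall>n. \<exists>u. u \<in> L2 \<Omega> \<and> x n = lsq_of \<Omega> u" using x by blast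
    then obtain u where u: "\<And>n. u n \<in> L2 \<Omega> \<and> x n = lsq_of \<Omega> (u n)"
      by (rule choice[THEN exE]) blast
    show ?thesis by (rule that[of u]) (use u in auto)
  qed
  show "l \<in> lsq_of \<Omega> ` L2 \<Omega>"
    using L2_limit_lsq_of[of \<Omega> u l] l u by auto
qed

section \<open>The energy space and its norm among classes\<close>

definition V :: "('d w_lsq \<times> (real^'d, complex) lsq) set" where
  "V = embed \<Omega> ` \<H>"

lemma V_eq: "V = W_lsq \<times> (lsq_of \<Omega> ` L2 \<Omega>)"
proof -
  have "embed \<Omega> = map_prod (embed_W \<Omega>) (lsq_of \<Omega>)"
    by (intro ext) (simp add: embed_def map_prod_def case_prod_beta)
  then show ?thesis
    by (simp add: V_def energy_space_def map_prod_surj_on)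
qed

lemma subspace_V: "subspace V"
  unfolding V_eq using subspace_W subspace_lsq_of_L2 by (rule subspace_Times)

lemma closed_V: "closed V"
  unfolding V_eq using closed_lsq_of_L2 by (intro closed_Times) (simp_all add: embed_W_image)

lemma embed_in_V: "F \<in> \<H> \<Longrightarrow> embed \<Omega> F \<in> V"
  by (simp add: V_def)

lemma norm_embed_W:
  assumes "W_grad u \<in> L2 \<Omega>" "W_sqrt_q u \<in> L2 \<Omega>"
  shows "norm (embed_W \<Omega> u) = W_norm \<Omega> u"
  using assms by (simp add: embed_W_def norm_Pair W_norm_def norm_lsq_of)

lemma norm_embed:
  assumes "W_grad (fst F) \<in> L2 \<Omega>" "W_sqrt_q (fst F) \<in> L2 \<Omega>" "snd F \<in> L2 \<Omega>"
  shows "norm (embed \<Omega> F) = energy_norm \<Omega> F"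
  using assms by (simp add: embed_def norm_Pair energy_norm_def norm_lsq_of norm_embed_W)

lemma embed_add:
  assumes "F \<in> \<H>" "K \<in> \<H>"
  shows "embed \<Omega> (F + K) = embed \<Omega> F + embed \<Omega> K"
  using energy_space_L2[OF assms(1)] energy_space_L2[OF assms(2)]
  by (simp add: embed_def embed_W_def plus_fun_def lsq_of_add)

lemma embed_diff:
  assumes "F \<in> \<H>" "K \<in> \<H>"
  shows "embed \<Omega> (F - K) = embed \<Omega> F - embed \<Omega> K"
  using energy_space_L2[OF assms(1)] energy_space_L2[OF assms(2)]
  by (simp add: embed_def embed_W_def fun_diff_def lsq_of_diff)

lemma embed_scale:
  assumes "F \<in> \<H>"
  shows "embed \<Omega> (state_scale (of_real r) F) = r *\<^sub>R embed \<Omega> F"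
proof -
  obtain G p g where F: "F = ((G, p), g)" by (metis prod.collapse)
  show ?thesis
    using energy_space_L2[OF assms] unfolding F state_scale_of_real
    by (simp add: embed_def embed_W_def lsq_of_scaleR)
qed

text \<open>Membership of a concrete state is tested in \<open>V\<close>, where the subspace laws
  are available; this is how sums, differences and real multiples of states are seen to stay in the
  energy space.\<close>

lemma energy_space_iff:
  assumes "W_grad (fst F) \<in> L2 \<Omega>" "W_sqrt_q (fst F) \<in> L2 \<Omega>" "snd F \<in> L2 \<Omega>"
  shows "F \<in> \<H> \<longleftrightarrow> embed \<Omega> F \<in> V"
  using assms W_space_iff[OF assms(1,2)]
  by (auto simp: energy_space_def V_eq embed_def embed_W_image mem_Times_iff)

lemma energy_space_add:
  assumes "F \<in> \<H>" "K \<in> \<H>"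
  shows "F + K \<in> \<H>"
proof (subst energy_space_iff)
  show "embed \<Omega> (F + K) \<in> V"
    using assms by (simp add: embed_add embed_in_V subspace_add[OF subspace_V])
qed (use energy_space_L2[OF assms(1)] energy_space_L2[OF assms(2)] in \<open>simp_all add: plus_fun_def L2_add\<close>)

lemma energy_space_diff:
  assumes "F \<in> \<H>" "K \<in> \<H>"
  shows "F - K \<in> \<H>"
proof (subst energy_space_iff)
  show "embed \<Omega> (F - K) \<in> V"
    using assms by (simp add: embed_diff embed_in_V subspace_diff[OF subspace_V])
qed (use energy_space_L2[OF assms(1)] energy_space_L2[OF assms(2)] in \<open>simp_all add: fun_diff_def L2_diff\<close>)

lemma energy_space_scale:
  assumes "F \<in> \<H>"
  shows "state_scale (of_real r) F \<in> \<H>"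
proof -
  obtain G p g where F: "F = ((G, p), g)" by (metis prod.collapse)
  show ?thesis
  proof (subst energy_space_iff)
    show "embed \<Omega> (state_scale (of_real r) F) \<in> V"
      using assms by (simp add: embed_scale embed_in_V subspace_scale[OF subspace_V])
  qed (use energy_space_L2[OF assms] in \<open>unfold F state_scale_of_real, simp_all add: L2_scaleR\<close>)
qed

lemma norm_embed_energy: "F \<in> \<H> \<Longrightarrow> norm (embed \<Omega> F) = energy_norm \<Omega> F"
  by (intro norm_embed energy_space_L2)

lemma embed_eq_iff:
  assumes "F \<in> \<H>" "K \<in> \<H>"
  shows "embed \<Omega> F = embed \<Omega> K \<longleftrightarrow> energy_norm \<Omega> (F - K) = 0"
  using norm_embed_energy[OF energy_space_diff[OF assms]] embed_diff[OF assms] by auto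

section \<open>The semigroup transported to equivalence classes\<close>

lemma C0: "C0_contraction_semigroup \<Omega> q T"
  using semigroup by (simp add: damped_wave_semigroup_def)

lemma T_in: "0 \<le> t \<Longrightarrow> F \<in> \<H> \<Longrightarrow> T t F \<in> \<H>"
  using C0 by (simp add: C0_contraction_semigroup_def)

lemma T_contraction: "0 \<le> t \<Longrightarrow> F \<in> \<H> \<Longrightarrow> energy_norm \<Omega> (T t F) \<le> energy_norm \<Omega> F"
  using C0 by (simp add: C0_contraction_semigroup_def)

text \<open>The semigroup laws hold only up to states of vanishing energy norm; \<open>embed\<close>
  identifies such states with zero and turns the laws into equations.\<close>

lemma embed_T_linear:
  assumes t: "0 \<le> t" and F: "F \<in> \<H>" and K: "K \<in> \<H>"
  shows "embed \<Omega> (T t (state_scale (of_real b) F + state_scale (of_real c) K))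
    = b *\<^sub>R embed \<Omega> (T t F) + c *\<^sub>R embed \<Omega> (T t K)"
proof -
  let ?D = "state_scale (of_real b) F + state_scale (of_real c) K"
  let ?E = "state_scale (of_real b) (T t F) + state_scale (of_real c) (T t K)"
  have "energy_norm \<Omega> (T t ?D
      - ?E) = 0"
    using C0 t F K unfolding C0_contraction_semigroup_def by blast
  then have "embed \<Omega> (T t ?D)
      = embed \<Omega> ?E"
    using t F K by (simp add: embed_eq_iff T_in energy_space_add energy_space_scale)
  then show ?thesis
    using t F K by (simp add: embed_add embed_scale energy_space_scale T_in)
qed

text \<open>\<open>T\<close> acts on representatives, and its definition does not say that it
  respects almost-everywhere equality. It does so because linearity and contraction bound the
  difference of the images by the energy norm of F - K, which is zero.\<close>

lemma embed_T_cong: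
  assumes t: "0 \<le> t" and F: "F \<in> \<H>" and K: "K \<in> \<H>"
    and eq: "embed \<Omega> F = embed \<Omega> K"
  shows "embed \<Omega> (T t F) = embed \<Omega> (T t K)"
proof -
  let ?D = "state_scale (of_real 1) F + state_scale (of_real (- 1)) K"
  have D: "?D \<in> \<H>" using F K by (intro energy_space_add energy_space_scale)
  have "norm (embed \<Omega> (T t ?D)) \<le> norm (embed \<Omega> ?D)"
    using D t by (simp only: norm_embed_energy T_in T_contraction)
  also have "embed \<Omega> ?D = 1 *\<^sub>R embed \<Omega> F + (- 1) *\<^sub>R embed \<Omega> K"
    by (simp only: embed_add[OF energy_space_scale[OF F] energy_space_scale[OF K]] embed_scale F K)
  also have "\<dots> = 0" using eq by simp
  finally have "1 *\<^sub>R embed \<Omega> (T t F) + (- 1) *\<^sub>R embed \<Omega> (T t K) = 0"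
    by (simp only: embed_T_linear[OF t F K] norm_zero norm_le_zero_iff)
  then show ?thesis by simp
qed

text \<open>\<open>inv_into\<close> selects an arbitrary representative of the class;
  \<open>embed_T_cong\<close> makes the selection irrelevant.\<close>

definition S :: "real \<Rightarrow> 'd w_lsq \<times> (real^'d, complex) lsq \<Rightarrow> 'd w_lsq \<times> (real^'d, complex) lsq" where
  "S t x = embed \<Omega> (T t (inv_into (\<H>) (embed \<Omega>) x))"

lemma S_embed:
  assumes "0 \<le> t" "F \<in> \<H>"
  shows "S t (embed \<Omega> F) = embed \<Omega> (T t F)"
  unfolding S_def using assms
  by (intro embed_T_cong inv_into_into f_inv_into_f) auto

sublocale contraction_semigroup_on V S
proof
  show "subspace V" by (rule subspace_V)
  show "closed V" by (rule closed_V)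
next
  fix t :: real and x assume t: "0 \<le> t" and "x \<in> V"
  then obtain F where F: "F \<in> \<H>" "x = embed \<Omega> F" by (auto simp: V_def)
  show "S t x \<in> V" "norm (S t x) \<le> norm x"
    using t F by (simp_all add: S_embed embed_in_V T_in norm_embed_energy T_contraction)
  fix c
  \<comment> \<open>Linearity of \<open>T\<close> is available for two-term combinations, so a
    multiple of \<open>F\<close> is written with a second term of coefficient 0.\<close>
  let ?D = "state_scale (of_real c) F + state_scale (of_real 0) F"
  have "embed \<Omega> (T t ?D) = c *\<^sub>R embed \<Omega> (T t F) + 0 *\<^sub>R embed \<Omega> (T t F)"
    by (rule embed_T_linear[OF t F(1) F(1)])
  then have "S t (embed \<Omega> ?D) = c *\<^sub>R embed \<Omega> (T t F)"
    by (simp only: S_embed[OF t energy_space_add[OF energy_space_scale[OF F(1)] energy_space_scale[OF F(1)]]]) simp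
  moreover have "embed \<Omega> ?D = c *\<^sub>R x"
    by (simp only: embed_add[OF energy_space_scale[OF F(1)] energy_space_scale[OF F(1)]] embed_scale[OF F(1)] F(2)) simp
  ultimately show "S t (c *\<^sub>R x) = c *\<^sub>R S t x"
    using t F by (simp add: S_embed)
next
  fix t :: real and x y assume t: "0 \<le> t" and "x \<in> V" "y \<in> V"
  then obtain F K where F: "F \<in> \<H>" "x = embed \<Omega> F" and K: "K \<in> \<H>" "y = embed \<Omega> K"
    by (auto simp: V_def)
  let ?D = "state_scale (of_real 1) F + state_scale (of_real 1) K"
  have "S t (embed \<Omega> ?D) = 1 *\<^sub>R embed \<Omega> (T t F) + 1 *\<^sub>R embed \<Omega> (T t K)"
    by (simp only: S_embed[OF t energy_space_add[OF energy_space_scale[OF F(1)] energy_space_scale[OF K(1)]]]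
        embed_T_linear[OF t F(1) K(1)])
  moreover have "embed \<Omega> ?D = x + y"
    by (simp only: embed_add[OF energy_space_scale[OF F(1)] energy_space_scale[OF K(1)]] embed_scale F K) simp
  ultimately show "S t (x + y) = S t x + S t y"
    using t F K by (simp add: S_embed)
next
  fix x assume "x \<in> V"
  then obtain F where F: "F \<in> \<H>" "x = embed \<Omega> F" by (auto simp: V_def)
  have "energy_norm \<Omega> (T 0 F - F) = 0" using C0 F(1) by (simp add: C0_contraction_semigroup_def)
  then show "S 0 x = x" using F by (simp add: S_embed embed_eq_iff T_in)
  have "((\<lambda>t. energy_norm \<Omega> (T t F - F)) \<longlongrightarrow> 0) (at_right 0)"
    using C0 F(1) by (simp add: C0_contraction_semigroup_def)
  then have "((\<lambda>t. norm (S t x - x)) \<longlongrightarrow> 0) (at_right 0)"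
  proof (rule Lim_transform_eventually[OF _ eventually_mono[OF eventually_at_right_less[of 0]]])
    fix t :: real assume "0 < t"
    then show "energy_norm \<Omega> (T t F - F) = norm (S t x - x)"
      using F by (simp add: S_embed embed_diff[symmetric] norm_embed_energy energy_space_diff T_in)
  qed
  then show "((\<lambda>t. S t x) \<longlongrightarrow> x) (at_right 0)"
    by (rule LIM_zero_cancel[OF tendsto_norm_zero_cancel])
next
  fix s t :: real and x assume st: "0 \<le> s" "0 \<le> t" and "x \<in> V"
  then obtain F where F: "F \<in> \<H>" "x = embed \<Omega> F" by (auto simp: V_def)
  have "energy_norm \<Omega> (T (s + t) F - T s (T t F)) = 0"
    using C0 F(1) st by (simp add: C0_contraction_semigroup_def)
  then show "S (s + t) x = S s (S t x)"
    using F st by (simp add: S_embed embed_eq_iff T_in)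
qed

text \<open>\<open>embed\<close> commutes with the difference quotients and its norm is the energy
  norm, so both sides describe the same limit. This is the bridge from abstract semigroup theory to
  the differential operator.\<close>

lemma gen_embed_iff:
  assumes F: "F \<in> \<H>" and K: "K \<in> \<H>"
  shows "gen (embed \<Omega> F) (embed \<Omega> K) \<longleftrightarrow> damped_wave_op \<Omega> a q F K"
proof -
  let ?D = "\<lambda>t. state_scale (of_real (1 / t)) (T t F - F) - K"
  let ?Q = "\<lambda>t. (1 / t) *\<^sub>R (S t (embed \<Omega> F) - embed \<Omega> F) - embed \<Omega> K"
  have eq: "energy_norm \<Omega> (?D t)
      = norm (?Q t)" if "0 < t" for t
  proof -
    have D: "T t F - F \<in> \<H>" using that F by (simp add: T_in energy_space_diff)
    have "energy_norm \<Omega> (?D t)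
        = norm (embed \<Omega> (?D t))"
      by (rule norm_embed_energy[OF energy_space_diff[OF energy_space_scale[OF D] K], symmetric])
    also have "embed \<Omega> (?D t) = (1 / t) *\<^sub>R embed \<Omega> (T t F - F) - embed \<Omega> K"
      by (simp only: embed_diff[OF energy_space_scale[OF D] K] embed_scale[OF D])
    also have "embed \<Omega> (T t F - F) = S t (embed \<Omega> F) - embed \<Omega> F"
      using that F by (simp add: S_embed embed_diff T_in)
    finally show ?thesis .
  qed
  have "gen (embed \<Omega> F) (embed \<Omega> K) \<longleftrightarrow>
      ((\<lambda>t. norm (?Q t)) \<longlongrightarrow> 0) (at_right 0)"
    using F K by (simp add: gen_def embed_in_V tendsto_norm_zero_iff LIM_zero_iff)
  also have "\<dots> \<longleftrightarrow> ((\<lambda>t. energy_norm \<Omega> (?D t)) \<longlongrightarrow> 0) (at_right 0)"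
    by (rule tendsto_cong[OF eventually_mono[OF eventually_at_right_less[of 0]]]) (simp only: eq)
  also have "\<dots> \<longleftrightarrow> semigroup_generator \<Omega> q T F K"
    using F K by (simp add: semigroup_generator_def)
  also have "\<dots> \<longleftrightarrow> damped_wave_op \<Omega> a q F K"
    using semigroup unfolding damped_wave_semigroup_def by blast
  finally show ?thesis .
qed

end

section \<open>Stability and the damping bound\<close>

text \<open>With the complex numbers seen as a real plane, z \<bullet> w is the real part of z cnj
  w.\<close>

lemma Re_L2_inner:
  assumes "\<Omega> \<in> sets lebesgue" "u \<in> L2 \<Omega>" "v \<in> L2 \<Omega>"
  shows "Re (L2_inner \<Omega> u v) = lsq_of \<Omega> u \<bullet> lsq_of \<Omega> v"
proof -
  have "integrable (lebesgue_on \<Omega>) (\<lambda>x. u x * cnj (v x))"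
    using L2_measurable[OF assms(2)] bounded_linear_measurable[OF bounded_linear_cnj L2_measurable[OF assms(3)]]
    by (intro L2_product_integrable[OF assms(2,3)] borel_measurable_times) (auto simp: norm_mult)
  then have "Re (L2_inner \<Omega> u v) = (\<integral>x. Re (u x * cnj (v x)) \<partial>lebesgue_on \<Omega>)"
    unfolding L2_inner_def by (rule integral_Re[symmetric])
  then show ?thesis
    using assms by (simp add: inner_lsq_of inner_complex_def)
qed

lemma Re_L2_inner_vec:
  fixes u v :: "real^'d \<Rightarrow> complex^'d"
  assumes "\<Omega> \<in> sets lebesgue" "u \<in> L2 \<Omega>" "v \<in> L2 \<Omega>"
  shows "Re (L2_inner_vec \<Omega> u v) = lsq_of \<Omega> u \<bullet> lsq_of \<Omega> v"
proof -
  have "integrable (lebesgue_on \<Omega>) (\<lambda>x. u x $ i * cnj (v x $ i))" for i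
  proof (rule L2_product_integrable[OF assms(2,3)])
    show "(\<lambda>x. u x $ i * cnj (v x $ i)) \<in> borel_measurable (lebesgue_on \<Omega>)"
      by (intro borel_measurable_times bounded_linear_measurable[OF bounded_linear_cnj]
          bounded_linear_measurable[OF bounded_linear_vec_nth] L2_measurable assms)
    show "AE x in lebesgue_on \<Omega>. norm (u x $ i * cnj (v x $ i)) \<le> norm (u x) * norm (v x)"
      by (auto simp: norm_mult intro!: mult_mono Finite_Cartesian_Product.norm_nth_le)
  qed
  then have "integrable (lebesgue_on \<Omega>) (\<lambda>x. \<Sum>i\<in>UNIV. u x $ i * cnj (v x $ i))"
    by (intro Bochner_Integration.integrable_sum)
  then have "Re (L2_inner_vec \<Omega> u v) = (\<integral>x. Re (\<Sum>i\<in>UNIV. u x $ i * cnj (v x $ i)) \<partial>lebesgue_on \<Omega>)"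
    unfolding L2_inner_vec_def by (rule integral_Re[symmetric])
  then show ?thesis
    using assms by (simp add: inner_lsq_of inner_vec_def inner_complex_def)
qed

text \<open>The weight is split into two square roots, one for each factor, which is where its sign
  enters.\<close>

lemma Re_weighted_integral:
  assumes \<Omega>: "\<Omega> \<in> sets lebesgue" and m: "m \<in> borel_measurable (lebesgue_on \<Omega>)" "AE x in lebesgue_on \<Omega>. 0 \<le> m x"
    and u: "sqrt_mult m u \<in> L2 \<Omega>" "u \<in> L2 \<Omega>" and v: "sqrt_mult m v \<in> L2 \<Omega>" "v \<in> L2 \<Omega>"
  shows "Re (\<integral>x. m x *\<^sub>R (u x * cnj (v x)) \<partial>lebesgue_on \<Omega>) = lsq_of \<Omega> (sqrt_mult m u) \<bullet> lsq_of \<Omega> (sqrt_mult m v)"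
proof -
  have "(\<integral>x. m x *\<^sub>R (u x * cnj (v x)) \<partial>lebesgue_on \<Omega>) = L2_inner \<Omega> (sqrt_mult m u) (sqrt_mult m v)"
    unfolding L2_inner_def
  proof (rule integral_cong_AE)
    show "(\<lambda>x. m x *\<^sub>R (u x * cnj (v x))) \<in> borel_measurable (lebesgue_on \<Omega>)"
      by (intro borel_measurable_scaleR m(1) borel_measurable_times
          bounded_linear_measurable[OF bounded_linear_cnj] L2_measurable u v)
    show "(\<lambda>x. sqrt_mult m u x * cnj (sqrt_mult m v x)) \<in> borel_measurable (lebesgue_on \<Omega>)"
      by (intro borel_measurable_times bounded_linear_measurable[OF bounded_linear_cnj] L2_measurable u v)
    show "AE x in lebesgue_on \<Omega>. m x *\<^sub>R (u x * cnj (v x)) = sqrt_mult m u x * cnj (sqrt_mult m v x)"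
      using m(2) by eventually_elim (simp add: sqrt_mult_def)
  qed
  then show ?thesis using Re_L2_inner[OF \<Omega> u(1) v(1)] by simp
qed

section \<open>The graph of the generator, and the damping bound from exponential decay\<close>

context damped_wave
begin

lemma form_domain_L2:
  assumes "u \<in> form_domain \<Omega> a q"
  shows "u \<in> L2 \<Omega>" "sqrt_mult q u \<in> L2 \<Omega>" "sqrt_mult a u \<in> L2 \<Omega>"
  using assms by (auto simp: form_domain_def Dom_sqrt_def)

lemma damped_wave_op_image:
  assumes "damped_wave_op \<Omega> a q (f, g) (w, h)"
  obtains Dg where "H01_grad \<Omega> g Dg" "embed_W \<Omega> w = (lsq_of \<Omega> Dg, lsq_of \<Omega> (sqrt_mult q g))"
proof -
  obtain Dg where Dg: "H01_grad \<Omega> g Dg"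
      "AE x in lebesgue_on \<Omega>. W_grad w x = Dg x \<and> W_sqrt_q w x = sqrt_mult q g x"
    and w: "w \<in> W_space \<Omega> q" and g: "g \<in> form_domain \<Omega> a q"
    using assms by (auto simp: damped_wave_op_def)
  have "embed_W \<Omega> w = (lsq_of \<Omega> Dg, lsq_of \<Omega> (sqrt_mult q g))"
    using Dg W_space_L2[OF w] form_domain_L2[OF g]
    by (auto simp: embed_W_def lsq_of_eq_iff H01_grad_def elim: eventually_mono)
  then show ?thesis using that Dg(1) by blast
qed

text \<open>Three choices of \<open>v\<close> are inserted later: a test function for the damping
  bound, the velocity for the dissipation of energy, and the displacement for the term that recovers
  the energy in W. Real parts suffice for all three.\<close>

lemma damped_wave_op_weak:
  assumes op: "damped_wave_op \<Omega> a q (f, g) (w, h)" and v: "v \<in> form_domain \<Omega> a q" "H01_grad \<Omega> v Dv"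
  shows "lsq_of \<Omega> h \<bullet> lsq_of \<Omega> v = - (embed_W \<Omega> f \<bullet> (lsq_of \<Omega> Dv, lsq_of \<Omega> (sqrt_mult q v)))
    - lsq_of \<Omega> (sqrt_mult a g) \<bullet> lsq_of \<Omega> (sqrt_mult a v)"
proof -
  have fh: "f \<in> W_space \<Omega> q" "h \<in> L2 \<Omega>" "g \<in> form_domain \<Omega> a q" and
    eq: "L2_inner \<Omega> h v = - L2_inner_vec \<Omega> (W_grad f) Dv - L2_inner \<Omega> (W_sqrt_q f) (sqrt_mult q v)
      - (\<integral>x. a x *\<^sub>R (g x * cnj (v x)) \<partial>lebesgue_on \<Omega>)"
    using op v by (auto simp: damped_wave_op_def)
  have Dv: "Dv \<in> L2 \<Omega>" using v(2) by (simp add: H01_grad_def)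
  show ?thesis
    using arg_cong[OF eq, of Re] W_space_L2[OF fh(1)] fh(2) form_domain_L2[OF fh(3)] form_domain_L2[OF v(1)] Dv
    by (simp add: Re_L2_inner Re_L2_inner_vec Re_weighted_integral a_nonneg L1_loc_measurable[OF open_\<Omega> a_L1]
        embed_W_def)
qed

lemma decay_estimate_imp_norm_S:
  assumes "decay_estimate \<Omega> q T \<nu> C" "0 \<le> t" "x \<in> V"
  shows "norm (S t x) \<le> C * exp (- \<nu> * t) * norm x"
proof -
  obtain F where F: "F \<in> \<H>" "x = embed \<Omega> F" using assms(3) by (auto simp: V_def)
  obtain u v where uv: "T t F = (u, v)" by (metis prod.collapse)
  have "norm (S t x) = energy_norm \<Omega> (u, v)"
    using F assms(2) by (simp add: S_embed norm_embed_energy T_in uv[symmetric])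
  also have "\<dots> \<le> W_norm \<Omega> u + L2_norm \<Omega> v"
    unfolding energy_norm_def fst_conv snd_conv
    by (rule sqrt_sum_squares_le_sum) (simp_all add: W_norm_def)
  also have "W_norm \<Omega> u \<le> L2_norm \<Omega> (W_grad u) + L2_norm \<Omega> (W_sqrt_q u)"
    unfolding W_norm_def by (simp add: sqrt_sum_squares_le_sum)
  finally have "norm (S t x) \<le> L2_norm \<Omega> (W_grad u) + L2_norm \<Omega> (W_sqrt_q u) + L2_norm \<Omega> v" by simp
  also have "\<dots> \<le> C * exp (- \<nu> * t) * energy_norm \<Omega> F"
    using assms(1,2) F(1) uv unfolding decay_estimate_def by fastforce
  finally show ?thesis using F by (simp add: norm_embed_energy)
qed

text \<open>The factor 3 counts the three L2 norms in the estimate, each of which is at most the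
  energy norm.\<close>

lemma norm_S_imp_decay_estimate:
  assumes "\<And>t x. 0 \<le> t \<Longrightarrow> x \<in> V \<Longrightarrow> norm (S t x) \<le> C * exp (- \<nu> * t) * norm x"
  shows "decay_estimate \<Omega> q T \<nu> (3 * C)"
  unfolding decay_estimate_def
proof (intro ballI allI impI)
  fix F and t :: real assume F: "F \<in> \<H>" and t: "0 \<le> t"
  obtain u v where uv: "T t F = (u, v)" by (metis prod.collapse)
  have H: "(u, v) \<in> \<H>" using T_in[OF t F] uv by simp
  have "norm (embed \<Omega> (u, v)) \<le> C * exp (- \<nu> * t) * energy_norm \<Omega> F"
    using assms[OF t embed_in_V[OF F]] t F by (simp add: S_embed uv norm_embed_energy)
  moreover have "norm (embed_W \<Omega> u) \<le> norm (embed \<Omega> (u, v))" "norm (lsq_of \<Omega> v) \<le> norm (embed \<Omega> (u, v))"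
    by (simp_all add: embed_def norm_Pair real_le_rsqrt)
  moreover have "norm (lsq_of \<Omega> (W_grad u)) \<le> norm (embed_W \<Omega> u)" "norm (lsq_of \<Omega> (W_sqrt_q u)) \<le> norm (embed_W \<Omega> u)"
    by (simp_all add: embed_W_def norm_Pair real_le_rsqrt)
  ultimately show "case T t F of (u, u\<^sub>t) \<Rightarrow>
        L2_norm \<Omega> (W_grad u) + L2_norm \<Omega> (W_sqrt_q u) + L2_norm \<Omega> u\<^sub>t \<le> 3 * C * exp (- \<nu> * t) * energy_norm \<Omega> F"
    using energy_space_L2[OF H] by (simp add: uv norm_lsq_of)
qed

text \<open>With B = C/\<nu> the bound of the inverse and n the W-norm of \<phi>, the second
  component of the solution gives |\<phi>| \<le> B n. Pairing the equation with \<phi> gives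
  |a^(1/2) \<phi>|^2 = - Re <f, \<phi>>_W \<le> B n^2. The constant B + B^2 is the sum of the two
  contributions.\<close>

lemma decay_imp_damping_bound:
  assumes decay: "decay_estimate \<Omega> q T \<nu> C" and "0 < \<nu>" "0 < C"
  shows "damping_bound \<Omega> a q (C / \<nu> + (C / \<nu>)\<^sup>2)"
  unfolding damping_bound_def
proof
  fix \<phi> assume \<phi>: "\<phi> \<in> test_functions \<Omega>"
  define B where "B = C / \<nu>"
  define K :: "'d state" where "K = (test_W \<phi>, \<lambda>x. 0)"
  have K: "K \<in> \<H>"
    using test_W_in_W_space[OF \<phi>] by (simp add: K_def energy_space_def)
  define n where "n = norm (embed_W \<Omega> (test_W \<phi>))"
  have n: "n\<^sup>2 = (L2_norm \<Omega> (grad \<phi>))\<^sup>2 + (L2_norm \<Omega> (sqrt_mult q \<phi>))\<^sup>2"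
    using test_W_L2[OF \<phi>] by (simp add: n_def norm_embed_W W_norm_def) (simp add: test_W_def)
  have nK: "norm (embed \<Omega> K) = n"
    by (simp add: embed_def K_def norm_Pair n_def)
  \<comment> \<open>Integrating the orbit inverts minus the generator, so the argument is negated in
    order to reach \<open>embed \<Omega> K\<close> itself.\<close>
  have "- embed \<Omega> K \<in> V" using subspace_neg[OF subspace_V embed_in_V[OF K]] .
  then obtain R where R: "gen R (embed \<Omega> K)" "norm R \<le> B * n"
    using exponentially_stable_imp_gen_surj[OF decay_estimate_imp_norm_S[OF decay] \<open>0 < \<nu>\<close>, of "- embed \<Omega> K"] \<open>0 < C\<close> nK
    by (auto simp: B_def)
  obtain f g where fg: "(f, g) \<in> \<H>" "R = embed \<Omega> (f, g)"
  proof -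
    have "R \<in> V" using R(1) by (simp add: gen_def)
    then show ?thesis using that by (auto simp: V_def)
  qed
  have op: "damped_wave_op \<Omega> a q (f, g) (test_W \<phi>, \<lambda>x. 0)"
    using R(1) gen_embed_iff[OF fg(1) K] fg(2) by (simp add: K_def)
  obtain Dg where Dg: "H01_grad \<Omega> g Dg" "embed_W \<Omega> (test_W \<phi>) = (lsq_of \<Omega> Dg, lsq_of \<Omega> (sqrt_mult q g))"
    using damped_wave_op_image[OF op] .
  have g: "g \<in> form_domain \<Omega> a q" using op by (simp add: damped_wave_op_def)
  have \<phi>_form: "\<phi> \<in> form_domain \<Omega> a q"
    by (rule test_functions_form_domain[OF open_\<Omega> a_L1 q_L1 \<phi>])
  have grad_\<phi>: "H01_grad \<Omega> \<phi> (grad \<phi>)" by (rule H01_grad_test[OF \<Omega>_sets \<phi>])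
  \<comment> \<open>Equality in W compares gradients and q-parts, not functions. Uniqueness applied
    to g - \<phi>, whose gradient vanishes, is what yields equality of the functions and with it of
    the a-parts.\<close>
  have "lsq_of \<Omega> Dg = lsq_of \<Omega> (grad \<phi>)"
    using Dg(2) by (simp add: embed_W_def test_W_def)
  then have "AE x in lebesgue_on \<Omega>. Dg x = grad \<phi> x"
    using Dg(1) grad_\<phi> by (simp add: lsq_of_eq_iff H01_grad_def)
  then have "AE x in lebesgue_on \<Omega>. (Dg - grad \<phi>) x = 0" by eventually_elim simp
  then have "AE x in lebesgue_on \<Omega>. (g - \<phi>) x = 0"
    by (rule H01_grad_zero_imp_zero[OF \<Omega>_sets H01_grad_diff[OF \<Omega>_sets Dg(1) grad_\<phi>]])
  then have g\<phi>: "AE x in lebesgue_on \<Omega>. g x = \<phi> x" by eventually_elim simp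
  have L2_eq: "lsq_of \<Omega> g = lsq_of \<Omega> \<phi>"
    using g\<phi> form_domain_L2[OF g] form_domain_L2[OF \<phi>_form] by (simp add: lsq_of_eq_iff)
  have "AE x in lebesgue_on \<Omega>. sqrt_mult a g x = sqrt_mult a \<phi> x"
    using g\<phi> by eventually_elim (simp add: sqrt_mult_def)
  then have a_eq: "lsq_of \<Omega> (sqrt_mult a g) = lsq_of \<Omega> (sqrt_mult a \<phi>)"
    using form_domain_L2[OF g] form_domain_L2[OF \<phi>_form] by (simp add: lsq_of_eq_iff)
  have comps: "norm (embed_W \<Omega> f) \<le> B * n" "norm (lsq_of \<Omega> g) \<le> B * n"
    using R(2) order_trans[OF norm_fst_le[of "embed_W \<Omega> f" "lsq_of \<Omega> g"]]
      order_trans[OF norm_snd_le[of "lsq_of \<Omega> g" "embed_W \<Omega> f"]]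
    by (auto simp: fg(2) embed_def)
  have "0 = - (embed_W \<Omega> f \<bullet> embed_W \<Omega> (test_W \<phi>)) - lsq_of \<Omega> (sqrt_mult a \<phi>) \<bullet> lsq_of \<Omega> (sqrt_mult a \<phi>)"
    using damped_wave_op_weak[OF op \<phi>_form grad_\<phi>] by (simp add: a_eq embed_W_def test_W_def)
  then have "(norm (lsq_of \<Omega> (sqrt_mult a \<phi>)))\<^sup>2 = - (embed_W \<Omega> f \<bullet> embed_W \<Omega> (test_W \<phi>))"
    by (simp add: power2_norm_eq_inner)
  also have "\<dots> \<le> norm (embed_W \<Omega> f) * n"
    using Cauchy_Schwarz_ineq2[of "embed_W \<Omega> f" "embed_W \<Omega> (test_W \<phi>)"] by (simp add: n_def)
  also have "\<dots> \<le> B * n * n"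
    using comps(1) by (intro mult_right_mono) (simp_all add: n_def)
  finally have "(L2_norm \<Omega> (sqrt_mult a \<phi>))\<^sup>2 \<le> B * n\<^sup>2"
    using form_domain_L2[OF \<phi>_form] by (simp add: norm_lsq_of power2_eq_square)
  moreover have "(L2_norm \<Omega> \<phi>)\<^sup>2 \<le> B\<^sup>2 * n\<^sup>2"
    using power_mono[OF comps(2), of 2] form_domain_L2[OF \<phi>_form]
    by (simp add: L2_eq norm_lsq_of power_mult_distrib)
  ultimately show "(L2_norm \<Omega> (sqrt_mult a \<phi>))\<^sup>2 + (L2_norm \<Omega> \<phi>)\<^sup>2
      \<le> (C / \<nu> + (C / \<nu>)\<^sup>2) * ((L2_norm \<Omega> (grad \<phi>))\<^sup>2 + (L2_norm \<Omega> (sqrt_mult q \<phi>))\<^sup>2)"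
    unfolding n[symmetric] B_def[symmetric] by (simp add: distrib_right)
qed

end

section \<open>Closedness of multiplication by a weight, and elements of W as functions\<close>

lemma lsq_multiplier_tendsto:
  assumes \<Omega>: "\<Omega> \<in> sets lebesgue" and c: "c \<in> borel_measurable (lebesgue_on \<Omega>)" "\<And>x. \<bar>c x\<bar> \<le> 1"
    and un: "\<And>n. un n \<in> L2 \<Omega>" and u: "u \<in> L2 \<Omega>" and lim: "(\<lambda>n. lsq_of \<Omega> (un n)) \<longlonglongrightarrow> lsq_of \<Omega> u"
  shows "(\<lambda>n. lsq_of \<Omega> (\<lambda>x. c x *\<^sub>R un n x)) \<longlonglongrightarrow> lsq_of \<Omega> (\<lambda>x. c x *\<^sub>R u x)"
proof -
  have L2: "(\<lambda>x. c x *\<^sub>R v x) \<in> L2 \<Omega>" and le: "L2_norm \<Omega> (\<lambda>x. c x *\<^sub>R v x) \<le> L2_norm \<Omega> v" if v: "v \<in> L2 \<Omega>" for v :: "'a \<Rightarrow> 'b"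
  proof -
    have bound: "norm (c x *\<^sub>R v x) \<le> 1 * norm (v x)" for x
      using mult_right_mono[OF c(2)[of x], of "norm (v x)"] by simp
    show L2: "(\<lambda>x. c x *\<^sub>R v x) \<in> L2 \<Omega>"
      by (rule L2_bound[OF v borel_measurable_scaleR[OF c(1) L2_measurable[OF v]] AE_I2[OF bound]])
    have "(\<integral>x. (norm (c x *\<^sub>R v x))\<^sup>2 \<partial>lebesgue_on \<Omega>) \<le> (\<integral>x. (norm (v x))\<^sup>2 \<partial>lebesgue_on \<Omega>)"
      using L2 v bound by (intro integral_mono) (auto simp: L2_iff intro!: power_mono simp del: norm_scaleR)
    then show "L2_norm \<Omega> (\<lambda>x. c x *\<^sub>R v x) \<le> L2_norm \<Omega> v" by (simp add: L2_norm_def)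
  qed
  have diff_le: "norm (lsq_of \<Omega> (\<lambda>x. c x *\<^sub>R un n x) - lsq_of \<Omega> (\<lambda>x. c x *\<^sub>R u x)) \<le> norm (lsq_of \<Omega> (un n) - lsq_of \<Omega> u)" for n
    using le[OF L2_diff[OF un[of n] u]] L2_diff[OF un[of n] u] L2[OF L2_diff[OF un[of n] u]] L2[OF un[of n]] L2[OF u] un[of n] u \<Omega>
    by (simp add: lsq_of_diff[symmetric] norm_lsq_of scaleR_diff_right)
  have "(\<lambda>n. norm (lsq_of \<Omega> (un n) - lsq_of \<Omega> u)) \<longlonglongrightarrow> 0"
    by (rule tendsto_norm_zero[OF LIM_zero[OF lim]])
  then have "(\<lambda>n. lsq_of \<Omega> (\<lambda>x. c x *\<^sub>R un n x) - lsq_of \<Omega> (\<lambda>x. c x *\<^sub>R u x)) \<longlonglongrightarrow> 0"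
    by (rule Lim_null_comparison[rotated]) (simp add: diff_le)
  then show ?thesis by (rule LIM_zero_cancel)
qed

text \<open>Dividing by \<open>1 + |m\<^sup>1\<^sup>/\<^sup>2|\<close> turns multiplication by \<open>m\<^sup>1\<^sup>/\<^sup>2\<close> into bounded operations.\<close>

lemma sqrt_mult_closed:
  assumes \<Omega>: "\<Omega> \<in> sets lebesgue" and m: "m \<in> borel_measurable (lebesgue_on \<Omega>)"
    and un: "\<And>n. un n \<in> L2 \<Omega>" "u \<in> L2 \<Omega>" "(\<lambda>n. lsq_of \<Omega> (un n)) \<longlonglongrightarrow> lsq_of \<Omega> u"
    and s: "\<And>n. sqrt_mult m (un n) \<in> L2 \<Omega>" "s \<in> L2 \<Omega>" "(\<lambda>n. lsq_of \<Omega> (sqrt_mult m (un n))) \<longlonglongrightarrow> lsq_of \<Omega> s"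
  shows "sqrt_mult m u \<in> L2 \<Omega>" "lsq_of \<Omega> s = lsq_of \<Omega> (sqrt_mult m u)"
proof -
  note [measurable] = m L2_measurable[OF un(2)] L2_measurable[OF s(2)]
  define k where "k x = 1 / (1 + \<bar>sqrt (m x)\<bar>)" for x
  have k: "0 < k x" "\<bar>k x\<bar> \<le> 1" "\<bar>k x * sqrt (m x)\<bar> \<le> 1" for x
    by (simp_all add: k_def field_simps abs_mult)
  have [measurable]: "k \<in> borel_measurable (lebesgue_on \<Omega>)" unfolding k_def by measurable
  have "(\<lambda>n. lsq_of \<Omega> (\<lambda>x. k x *\<^sub>R sqrt_mult m (un n) x)) \<longlonglongrightarrow> lsq_of \<Omega> (\<lambda>x. k x *\<^sub>R s x)"
    by (rule lsq_multiplier_tendsto[OF \<Omega> _ k(2) s]) measurable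
  moreover have "(\<lambda>n. lsq_of \<Omega> (\<lambda>x. (k x * sqrt (m x)) *\<^sub>R un n x)) \<longlonglongrightarrow> lsq_of \<Omega> (\<lambda>x. (k x * sqrt (m x)) *\<^sub>R u x)"
    by (rule lsq_multiplier_tendsto[OF \<Omega> _ k(3) un]) measurable
  ultimately have "lsq_of \<Omega> (\<lambda>x. k x *\<^sub>R s x) = lsq_of \<Omega> (\<lambda>x. (k x * sqrt (m x)) *\<^sub>R u x)"
    by (simp add: sqrt_mult_def LIMSEQ_unique)
  moreover have "(\<lambda>x. k x *\<^sub>R s x) \<in> L2 \<Omega>"
    by (rule L2_bound[OF s(2), of _ 1]) (use k(2) in \<open>auto intro!: mult_left_le_one_le\<close>)
  moreover have "(\<lambda>x. (k x * sqrt (m x)) *\<^sub>R u x) \<in> L2 \<Omega>"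
    by (rule L2_bound[OF un(2), of _ 1])
      (use k(3) in \<open>auto intro!: mult_left_le_one_le simp: abs_mult[symmetric]\<close>)
  ultimately have "AE x in lebesgue_on \<Omega>. k x *\<^sub>R s x = (k x * sqrt (m x)) *\<^sub>R u x"
    using \<Omega> by (simp add: lsq_of_eq_iff)
  then have eq: "AE x in lebesgue_on \<Omega>. s x = sqrt_mult m u x"
  proof eventually_elim
    case (elim x)
    then have "k x *\<^sub>R (s x - sqrt_mult m u x) = 0" by (simp add: sqrt_mult_def scaleR_diff_right)
    then show ?case using k(1)[of x] by simp
  qed
  show L2: "sqrt_mult m u \<in> L2 \<Omega>"
    by (rule L2_cong_AE[OF s(2) _ eq]) (unfold sqrt_mult_def, measurable)
  show "lsq_of \<Omega> s = lsq_of \<Omega> (sqrt_mult m u)"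
    using eq L2 s(2) \<Omega> by (simp add: lsq_of_eq_iff)
qed

context damped_wave
begin

text \<open>The bound makes the linear map from a test function \<phi> to the pair (a^(1/2) \<phi>,
  \<phi>) continuous for the W-norm. A sequence of test functions representing \<open>u\<close> is
  therefore Cauchy in L2 as well, also after multiplication by a^(1/2), and its L2 limit
  \<open>w\<close> is the function behind \<open>u\<close>.\<close>

lemma damping_bound_imp_W_function:
  assumes M: "damping_bound \<Omega> a q M" "0 \<le> M" and u: "u \<in> W_space \<Omega> q"
  obtains w where "w \<in> form_domain \<Omega> a q" "H01_grad \<Omega> w (W_grad u)"
    "embed_W \<Omega> u = (lsq_of \<Omega> (W_grad u), lsq_of \<Omega> (sqrt_mult q w))"
    "norm (lsq_of \<Omega> (sqrt_mult a w)) \<le> sqrt M * norm (embed_W \<Omega> u)"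
    "norm (lsq_of \<Omega> w) \<le> sqrt M * norm (embed_W \<Omega> u)"
proof -
  have "embed_W \<Omega> u \<in> closure test_space" using u W_space_L2[OF u] W_space_iff by blast
  then obtain \<phi> where \<phi>: "\<And>n. \<phi> n \<in> test_functions \<Omega>" and lim: "(\<lambda>n. embed_W \<Omega> (test_W (\<phi> n))) \<longlonglongrightarrow> embed_W \<Omega> u"
    unfolding closure_test_space_iff by blast
  define z where "z \<psi> = (lsq_of \<Omega> (sqrt_mult a \<psi>), lsq_of \<Omega> \<psi>)" for \<psi>
  have L2: "\<psi> \<in> L2 \<Omega>" "sqrt_mult a \<psi> \<in> L2 \<Omega>" if "\<psi> \<in> test_functions \<Omega>" for \<psi>
    using form_domain_L2[OF test_functions_form_domain[OF open_\<Omega> a_L1 q_L1 that]] by auto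
  have z_le: "norm (z \<psi>) \<le> sqrt M * norm (embed_W \<Omega> (test_W \<psi>))" if \<psi>: "\<psi> \<in> test_functions \<Omega>" for \<psi>
  proof -
    have "(norm (z \<psi>))\<^sup>2 = (L2_norm \<Omega> (sqrt_mult a \<psi>))\<^sup>2 + (L2_norm \<Omega> \<psi>)\<^sup>2"
      using L2[OF \<psi>] by (simp add: z_def norm_Pair norm_lsq_of)
    also have "\<dots> \<le> M * ((L2_norm \<Omega> (grad \<psi>))\<^sup>2 + (L2_norm \<Omega> (sqrt_mult q \<psi>))\<^sup>2)"
      using M(1) \<psi> by (simp add: damping_bound_def)
    also have "\<dots> = (sqrt M * norm (embed_W \<Omega> (test_W \<psi>)))\<^sup>2"
      using test_W_L2[OF \<psi>] M(2) by (simp add: norm_embed_W W_norm_def power_mult_distrib) (simp add: test_W_def)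
    finally show ?thesis
      by (rule power2_le_imp_le) (simp add: M(2))
  qed
  have z_diff: "z (\<lambda>x. \<psi> x - \<theta> x) = z \<psi> - z \<theta>"
    and W_diff: "embed_W \<Omega> (test_W (\<lambda>x. \<psi> x - \<theta> x)) = embed_W \<Omega> (test_W \<psi>) - embed_W \<Omega> (test_W \<theta>)"
    if \<psi>: "\<psi> \<in> test_functions \<Omega>" and \<theta>: "\<theta> \<in> test_functions \<Omega>" for \<psi> \<theta>
  proof -
    have "sqrt_mult a (\<lambda>x. \<psi> x - \<theta> x) = (\<lambda>x. sqrt_mult a \<psi> x - sqrt_mult a \<theta> x)"
      by (simp add: sqrt_mult_def scaleR_diff_right)
    then show "z (\<lambda>x. \<psi> x - \<theta> x) = z \<psi> - z \<theta>"
      using L2[OF \<psi>] L2[OF \<theta>] by (simp add: z_def lsq_of_diff)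
    have "embed_W \<Omega> (test_W (\<lambda>x. \<psi> x + (- 1) *\<^sub>R \<theta> x))
        = embed_W \<Omega> (test_W \<psi>) + (- 1) *\<^sub>R embed_W \<Omega> (test_W \<theta>)"
      using embed_W_test_add[OF \<psi> test_functions_bounded_linear[OF bounded_linear_scaleR_complex \<theta>, of "- 1"]]
        embed_W_test_scaleR[OF \<theta>, of "- 1"] by simp
    then show "embed_W \<Omega> (test_W (\<lambda>x. \<psi> x - \<theta> x)) = embed_W \<Omega> (test_W \<psi>) - embed_W \<Omega> (test_W \<theta>)"
      by simp
  qed
  have "Cauchy (\<lambda>n. z (\<phi> n))"
  proof (rule CauchyI)
    fix e :: real assume "0 < e"
    have "Cauchy (\<lambda>n. embed_W \<Omega> (test_W (\<phi> n)))" using lim by (rule LIMSEQ_imp_Cauchy)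
    \<comment> \<open>Dividing by sqrt M + 1 instead of sqrt M keeps the tolerance meaningful when
      \<open>M\<close> is 0.\<close>
    then obtain N where N: "\<And>m n. m \<ge> N \<Longrightarrow> n \<ge> N \<Longrightarrow>
        norm (embed_W \<Omega> (test_W (\<phi> m)) - embed_W \<Omega> (test_W (\<phi> n))) < e / (sqrt M + 1)"
      using CauchyD[of _ "e / (sqrt M + 1)"] \<open>0 < e\<close> M(2)
      by (metis add_nonneg_pos divide_pos_pos real_sqrt_ge_zero zero_less_one)
    show "\<exists>N. \<forall>m\<ge>N. \<forall>n\<ge>N. norm (z (\<phi> m) - z (\<phi> n)) < e"
    proof (intro exI[of _ N] allI impI)
      fix m n assume mn: "N \<le> m" "N \<le> n"
      have "norm (z (\<phi> m) - z (\<phi> n)) \<le> sqrt M * norm (embed_W \<Omega> (test_W (\<phi> m)) - embed_W \<Omega> (test_W (\<phi> n)))"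
        using z_le[OF test_functions_diff[OF \<phi> \<phi>], of m n] by (simp add: z_diff W_diff \<phi>)
      also have "\<dots> \<le> (sqrt M + 1) * norm (embed_W \<Omega> (test_W (\<phi> m)) - embed_W \<Omega> (test_W (\<phi> n)))"
        by (rule mult_right_mono) auto
      also have "\<dots> < (sqrt M + 1) * (e / (sqrt M + 1))"
        using N[OF mn] M(2) by (intro mult_strict_left_mono) (auto intro: add_nonneg_pos)
      also have "\<dots> = e"
        using M(2) by (simp add: add_nonneg_eq_0_iff)
      finally show "norm (z (\<phi> m) - z (\<phi> n)) < e" .
    qed
  qed
  then obtain l where l: "(\<lambda>n. z (\<phi> n)) \<longlonglongrightarrow> l"
    using Cauchy_convergent convergent_def by blast
  have l1: "(\<lambda>n. lsq_of \<Omega> (sqrt_mult a (\<phi> n))) \<longlonglongrightarrow> fst l" and l2: "(\<lambda>n. lsq_of \<Omega> (\<phi> n)) \<longlonglongrightarrow> snd l"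
    using tendsto_fst[OF l] tendsto_snd[OF l] by (simp_all add: z_def)
  obtain s where s: "s \<in> L2 \<Omega>" "fst l = lsq_of \<Omega> s"
    using L2_limit_lsq_of[OF \<Omega>_sets L2(2)[OF \<phi>] l1] by blast
  obtain w where w: "w \<in> L2 \<Omega>" "snd l = lsq_of \<Omega> w"
    using L2_limit_lsq_of[OF \<Omega>_sets L2(1)[OF \<phi>] l2] by blast
  note w_lim = l2[unfolded w(2)]
  have uL2: "W_grad u \<in> L2 \<Omega>" "W_sqrt_q u \<in> L2 \<Omega>" using W_space_L2[OF u] by auto
  have grad_lim: "(\<lambda>n. lsq_of \<Omega> (grad (\<phi> n))) \<longlonglongrightarrow> lsq_of \<Omega> (W_grad u)"
    and q_lim: "(\<lambda>n. lsq_of \<Omega> (sqrt_mult q (\<phi> n))) \<longlonglongrightarrow> lsq_of \<Omega> (W_sqrt_q u)"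
    using tendsto_fst[OF lim] tendsto_snd[OF lim] by (simp_all add: embed_W_def test_W_def)
  note a_closed = sqrt_mult_closed[OF \<Omega>_sets L1_loc_measurable[OF open_\<Omega> a_L1] L2(1)[OF \<phi>] w(1) w_lim
      L2(2)[OF \<phi>] s(1) l1[unfolded s(2)]]
  \<comment> \<open>The second component of \<open>u\<close> is a separate L2 limit until closedness
    of multiplication by the root of \<open>q\<close> identifies it with the one computed from
    \<open>w\<close>.\<close>
  note q_closed = sqrt_mult_closed[OF \<Omega>_sets L1_loc_measurable[OF open_\<Omega> q_L1] L2(1)[OF \<phi>] w(1) w_lim
      sqrt_mult_test_L2[OF open_\<Omega> q_L1 \<phi>] uL2(2) q_lim]
  have H01: "H01_grad \<Omega> w (W_grad u)"
  proof (rule H01_gradI[OF \<Omega>_sets \<phi> w(1) _ uL2(1)])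
    show "(\<lambda>n. L2_norm \<Omega> (\<phi> n - w)) \<longlonglongrightarrow> 0"
      using tendsto_norm_zero[OF LIM_zero[OF w_lim]] L2(1)[OF \<phi>] w(1)
      by (simp add: lsq_of_diff[symmetric] norm_lsq_of L2_diff fun_diff_def)
    show "(\<lambda>n. L2_norm \<Omega> (grad (\<phi> n) - W_grad u)) \<longlonglongrightarrow> 0"
      using tendsto_norm_zero[OF LIM_zero[OF grad_lim]] grad_L2[OF \<phi> \<Omega>_sets] uL2(1)
      by (simp add: lsq_of_diff[symmetric] norm_lsq_of L2_diff fun_diff_def)
  qed
  have "norm l \<le> sqrt M * norm (embed_W \<Omega> u)"
    by (rule LIMSEQ_le[OF tendsto_norm[OF l] tendsto_mult_left[OF tendsto_norm[OF lim]]]) (use z_le \<phi> in auto)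
  moreover have "norm (fst l) \<le> norm l" "norm (snd l) \<le> norm l"
    using norm_fst_le[of "fst l" "snd l"] norm_snd_le[of "snd l" "fst l"] by auto
  ultimately have "norm (lsq_of \<Omega> (sqrt_mult a w)) \<le> sqrt M * norm (embed_W \<Omega> u)"
    "norm (lsq_of \<Omega> w) \<le> sqrt M * norm (embed_W \<Omega> u)"
    using a_closed(2) s(2) w(2) by auto
  moreover have "w \<in> form_domain \<Omega> a q"
    using H01 a_closed(1) q_closed(1) w(1) by (auto simp: form_domain_def Dom_sqrt_def)
  moreover have "embed_W \<Omega> u = (lsq_of \<Omega> (W_grad u), lsq_of \<Omega> (sqrt_mult q w))"
    by (simp add: embed_W_def q_closed(2))
  ultimately show ?thesis using that H01 by blast
qed

end

section \<open>Calculus for the energy functional\<close>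

lemma has_real_derivative_inner:
  assumes "(f has_vector_derivative f') (at t within A)" "(g has_vector_derivative g') (at t within A)"
  shows "((\<lambda>s. f s \<bullet> g s) has_real_derivative (f t \<bullet> g' + f' \<bullet> g t)) (at t within A)"
proof -
  have "((\<lambda>s. f s \<bullet> g s) has_derivative (\<lambda>h. f t \<bullet> (h *\<^sub>R g') + (h *\<^sub>R f') \<bullet> g t)) (at t within A)"
    using assms unfolding has_vector_derivative_def by (rule has_derivative_inner)
  then show ?thesis
    unfolding has_field_derivative_def by (rule has_derivative_eq_rhs) (auto simp: algebra_simps)
qed

lemma H01_grad_scaleR:
  fixes u :: "real^'d \<Rightarrow> complex"
  assumes \<Omega>: "\<Omega> \<in> sets lebesgue" and H: "H01_grad \<Omega> u G"
  shows "H01_grad \<Omega> (\<lambda>x. c *\<^sub>R u x) (\<lambda>x. c *\<^sub>R G x)"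
proof -
  have L2: "u \<in> L2 \<Omega>" "G \<in> L2 \<Omega>" using H by (auto simp: H01_grad_def)
  obtain \<phi> where \<phi>: "\<And>n. \<phi> n \<in> test_functions \<Omega>" "(\<lambda>n. L2_norm \<Omega> (\<phi> n - u)) \<longlonglongrightarrow> 0"
      "(\<lambda>n. L2_norm \<Omega> (grad (\<phi> n) - G)) \<longlonglongrightarrow> 0"
    using H unfolding H01_grad_def by blast
  have scale: "L2_norm \<Omega> ((\<lambda>x. c *\<^sub>R v x) - (\<lambda>x. c *\<^sub>R w x)) = \<bar>c\<bar> * L2_norm \<Omega> (v - w)"
    for v w :: "real^'d \<Rightarrow> 'e::euclidean_space"
  proof -
    have "(norm (c *\<^sub>R v x - c *\<^sub>R w x))\<^sup>2 = c\<^sup>2 * (norm (v x - w x))\<^sup>2" for x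
      by (simp add: power_mult_distrib flip: scaleR_diff_right)
    then show ?thesis by (simp add: L2_norm_def real_sqrt_mult)
  qed
  show ?thesis
  proof (rule H01_gradI[OF \<Omega>])
    show "(\<lambda>x. c *\<^sub>R \<phi> n x) \<in> test_functions \<Omega>" for n
      by (rule test_functions_bounded_linear[OF bounded_linear_scaleR_complex \<phi>(1)])
    show "(\<lambda>n. L2_norm \<Omega> ((\<lambda>x. c *\<^sub>R \<phi> n x) - (\<lambda>x. c *\<^sub>R u x))) \<longlonglongrightarrow> 0"
      unfolding scale by (rule tendsto_mult_right_zero[OF \<phi>(2)])
    show "(\<lambda>n. L2_norm \<Omega> (grad (\<lambda>x. c *\<^sub>R \<phi> n x) - (\<lambda>x. c *\<^sub>R G x))) \<longlonglongrightarrow> 0"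
      unfolding grad_scaleR[OF \<phi>(1)] scale by (rule tendsto_mult_right_zero[OF \<phi>(3)])
  qed (use L2 in \<open>simp_all add: L2_scaleR\<close>)
qed

text \<open>Here \<alpha> stands for |a^(1/2) v|, Y for |u|_W, Z for |v| and \<beta> for the mixed
  term <a^(1/2) v, a^(1/2) u>. By Young's inequality -\<beta> is at most M \<alpha>^2/2 + Y^2/2, and
  Z^2 is at most \<alpha>^2/\<open>a\<^sub>0\<close>, so the smallness of \<delta> lets half of the
  dissipation absorb both. The other half leaves - \<open>a\<^sub>0\<close> Z^2/2, and half of -
  \<delta> Y^2 remains.\<close>

lemma lyapunov_estimate:
  fixes \<alpha> \<beta> Y Z a\<^sub>0 \<delta> M :: real
  assumes "0 < a\<^sub>0" "0 < \<delta>" "0 \<le> M" "\<delta> * (1 / a\<^sub>0 + M / 2) \<le> 1 / 2"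
    and Z: "a\<^sub>0 * Z\<^sup>2 \<le> \<alpha>\<^sup>2" and \<beta>: "\<bar>\<beta>\<bar> \<le> \<bar>\<alpha>\<bar> * (sqrt M * \<bar>Y\<bar>)"
  shows "- \<alpha>\<^sup>2 + \<delta> * (Z\<^sup>2 - Y\<^sup>2 - \<beta>) \<le> - (min a\<^sub>0 \<delta> / 2) * (Y\<^sup>2 + Z\<^sup>2)"
proof -
  have "\<bar>\<alpha>\<bar> * (sqrt M * \<bar>Y\<bar>) = (sqrt M * \<bar>\<alpha>\<bar>) * \<bar>Y\<bar>" by simp
  also have "\<dots> \<le> ((sqrt M * \<bar>\<alpha>\<bar>)\<^sup>2 + \<bar>Y\<bar>\<^sup>2) / 2"
    using sum_squares_bound[of "sqrt M * \<bar>\<alpha>\<bar>" "\<bar>Y\<bar>"] by simp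
  also have "\<dots> = M / 2 * \<alpha>\<^sup>2 + Y\<^sup>2 / 2" using \<open>0 \<le> M\<close> by (simp add: power_mult_distrib)
  finally have "- \<beta> \<le> M / 2 * \<alpha>\<^sup>2 + Y\<^sup>2 / 2" using \<beta> by linarith
  moreover have "Z\<^sup>2 \<le> 1 / a\<^sub>0 * \<alpha>\<^sup>2" using Z \<open>0 < a\<^sub>0\<close> by (simp add: field_simps)
  ultimately have "Z\<^sup>2 - Y\<^sup>2 - \<beta> \<le> (1 / a\<^sub>0 + M / 2) * \<alpha>\<^sup>2 - Y\<^sup>2 / 2"
    by (simp add: distrib_right)
  then have "\<delta> * (Z\<^sup>2 - Y\<^sup>2 - \<beta>) \<le> \<delta> * ((1 / a\<^sub>0 + M / 2) * \<alpha>\<^sup>2 - Y\<^sup>2 / 2)"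
    using \<open>0 < \<delta>\<close> by (intro mult_left_mono) auto
  also have "\<dots> = (\<delta> * (1 / a\<^sub>0 + M / 2)) * \<alpha>\<^sup>2 - \<delta> / 2 * Y\<^sup>2"
    by (simp add: right_diff_distrib mult.assoc)
  also have "\<dots> \<le> 1 / 2 * \<alpha>\<^sup>2 - \<delta> / 2 * Y\<^sup>2"
    using mult_right_mono[OF assms(4), of "\<alpha>\<^sup>2"] by simp
  finally have "- \<alpha>\<^sup>2 + \<delta> * (Z\<^sup>2 - Y\<^sup>2 - \<beta>) \<le> - (a\<^sub>0 / 2 * Z\<^sup>2) - \<delta> / 2 * Y\<^sup>2"
    using Z by simp
  moreover have "min a\<^sub>0 \<delta> / 2 * Z\<^sup>2 \<le> a\<^sub>0 / 2 * Z\<^sup>2" "min a\<^sub>0 \<delta> / 2 * Y\<^sup>2 \<le> \<delta> / 2 * Y\<^sup>2"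
    by (intro mult_right_mono; simp)+
  ultimately show ?thesis by (simp add: distrib_left)
qed

text \<open>The integrating factor exp (c t) makes the product nonincreasing. The derivative at 0 is
  one-sided, so monotonicity is drawn from interior derivatives and continuity on the closed
  interval.\<close>

lemma exponential_decay_of_derivative:
  fixes L :: "real \<Rightarrow> real"
  assumes L: "\<And>t. 0 \<le> t \<Longrightarrow> (L has_real_derivative L' t) (at t within {0..})"
    and le: "\<And>t. 0 \<le> t \<Longrightarrow> L' t \<le> - c * L t" and t: "0 \<le> t"
  shows "L t \<le> exp (- c * t) * L 0"
proof (cases "t = 0")
  case False
  then have t: "0 < t" using t by simp
  define \<Phi> where "\<Phi> s = exp (c * s) * L s" for s
  have deriv: "(\<Phi> has_real_derivative (exp (c * s) * (c * L s + L' s))) (at s within {0..})" if "0 \<le> s" for s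
    unfolding \<Phi>_def using L[OF that] by (auto intro!: derivative_eq_intros simp: algebra_simps)
  have "\<Phi> t \<le> \<Phi> 0"
  proof (rule DERIV_nonpos_imp_decreasing_open[where f = \<Phi> and a = 0 and b = t])
    show "0 \<le> t" using t by simp
    show "\<exists>y. (\<Phi> has_real_derivative y) (at s) \<and> y \<le> 0" if "0 < s" "s < t" for s
    proof -
      have "at s within {0..} = at s"
        using that by (intro at_within_interior) simp
      then have "(\<Phi> has_real_derivative (exp (c * s) * (c * L s + L' s))) (at s)"
        using deriv[of s] that by simp
      moreover have "exp (c * s) * (c * L s + L' s) \<le> 0"
        using le[of s] that by (intro mult_nonneg_nonpos) auto
      ultimately show ?thesis by blast
    qed
    have "continuous_on {0..} \<Phi>"
      by (rule DERIV_continuous_on[of _ _ "\<lambda>s. exp (c * s) * (c * L s + L' s)"]) (use deriv in auto)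
    then show "continuous_on {0..t} \<Phi>" by (rule continuous_on_subset) auto
  qed
  then have "exp (- c * t) * (exp (c * t) * L t) \<le> exp (- c * t) * L 0"
    by (intro mult_left_mono) (auto simp: \<Phi>_def)
  then show ?thesis by (simp add: exp_minus field_simps)
qed simp

section \<open>Gradients of classes and the Lyapunov argument\<close>

context damped_wave
begin

text \<open>\<open>H01_grad\<close> lifted to classes. It is a relation because the W-component of a
  state stores the gradient of the displacement but not the displacement itself, which is recovered
  from it through this relation.\<close>

definition has_grad :: "(real^'d, complex) lsq \<Rightarrow> (real^'d, complex^'d) lsq \<Rightarrow> bool" where
  "has_grad z Y \<longleftrightarrow> (\<exists>w G. H01_grad \<Omega> w G \<and> z = lsq_of \<Omega> w \<and> Y = lsq_of \<Omega> G)"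

lemma has_grad_diff:
  assumes "has_grad z Y" "has_grad z' Y'"
  shows "has_grad (z - z') (Y - Y')"
proof -
  obtain w G w' G' where H: "H01_grad \<Omega> w G" "H01_grad \<Omega> w' G'"
    and eq: "z = lsq_of \<Omega> w" "Y = lsq_of \<Omega> G" "z' = lsq_of \<Omega> w'" "Y' = lsq_of \<Omega> G'"
    using assms by (auto simp: has_grad_def)
  have "w \<in> L2 \<Omega>" "G \<in> L2 \<Omega>" "w' \<in> L2 \<Omega>" "G' \<in> L2 \<Omega>" using H by (auto simp: H01_grad_def)
  then have "z - z' = lsq_of \<Omega> (w - w')" "Y - Y' = lsq_of \<Omega> (G - G')"
    by (simp_all add: eq fun_diff_def lsq_of_diff)
  then show ?thesis unfolding has_grad_def using H01_grad_diff[OF \<Omega>_sets H] by blast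
qed

lemma has_grad_scaleR:
  assumes "has_grad z Y"
  shows "has_grad (c *\<^sub>R z) (c *\<^sub>R Y)"
proof -
  obtain w G where H: "H01_grad \<Omega> w G" and eq: "z = lsq_of \<Omega> w" "Y = lsq_of \<Omega> G"
    using assms by (auto simp: has_grad_def)
  have "w \<in> L2 \<Omega>" "G \<in> L2 \<Omega>" using H by (auto simp: H01_grad_def)
  then have "c *\<^sub>R z = lsq_of \<Omega> (\<lambda>x. c *\<^sub>R w x)" "c *\<^sub>R Y = lsq_of \<Omega> (\<lambda>x. c *\<^sub>R G x)"
    by (simp_all add: eq lsq_of_scaleR)
  then show ?thesis unfolding has_grad_def using H01_grad_scaleR[OF \<Omega>_sets H] by blast
qed

lemma has_grad_zero:
  assumes "has_grad z 0"
  shows "z = 0"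
proof -
  obtain w G where H: "H01_grad \<Omega> w G" and eq: "z = lsq_of \<Omega> w" "0 = lsq_of \<Omega> G"
    using assms by (auto simp: has_grad_def)
  have L2: "w \<in> L2 \<Omega>" "G \<in> L2 \<Omega>" using H by (auto simp: H01_grad_def)
  have "lsq_of \<Omega> G = lsq_of \<Omega> (\<lambda>x. 0)" using eq(2) by simp
  then have "AE x in lebesgue_on \<Omega>. G x = 0" by (rule iffD1[OF lsq_of_eq_iff[OF \<Omega>_sets L2(2) L2_zero]])
  then have "AE x in lebesgue_on \<Omega>. w x = 0" by (rule H01_grad_zero_imp_zero[OF \<Omega>_sets H])
  then have "lsq_of \<Omega> w = lsq_of \<Omega> (\<lambda>x. 0)" by (rule iffD2[OF lsq_of_eq_iff[OF \<Omega>_sets L2(1) L2_zero]])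
  then show ?thesis by (simp add: eq)
qed

text \<open>Uniqueness forces \<open>z\<close> to be the class of the function that
  \<open>damping_bound_imp_W_function\<close> attaches to \<open>y\<close>, and that function
  carries the bound.\<close>

lemma has_grad_bound:
  assumes M: "damping_bound \<Omega> a q M" "0 \<le> M" and y: "y \<in> W_lsq"
    and z: "has_grad z (fst y)"
  shows "norm z \<le> sqrt M * norm y"
proof -
  obtain u where u: "u \<in> W_space \<Omega> q" "y = embed_W \<Omega> u" using y by blast
  obtain w where w: "H01_grad \<Omega> w (W_grad u)" "norm (lsq_of \<Omega> w) \<le> sqrt M * norm (embed_W \<Omega> u)"
    using damping_bound_imp_W_function[OF M u(1)] by metis
  have "has_grad (lsq_of \<Omega> w) (fst y)" unfolding has_grad_def u(2) embed_W_def using w(1) by auto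
  from has_grad_diff[OF z this] have "z = lsq_of \<Omega> w" using has_grad_zero[of "z - lsq_of \<Omega> w"] by simp
  then show ?thesis using w(2) u(2) by simp
qed

text \<open>The first-order remainder of \<open>z\<close> has the gradient component of the
  remainder of \<open>y\<close> as its gradient, so \<open>has_grad_bound\<close> dominates one by
  sqrt M times the other. Differentiability is thereby transferred from W to L2, which gives the
  time derivative of the displacement.\<close>

lemma has_grad_has_vector_derivative:
  assumes M: "damping_bound \<Omega> a q M" "0 \<le> M"
    and y: "\<And>s. s \<in> A \<Longrightarrow> y s \<in> W_lsq" "y' \<in> W_lsq"
    and z: "\<And>s. s \<in> A \<Longrightarrow> has_grad (z s) (fst (y s))" "has_grad z' (fst y')"
    and deriv: "(y has_vector_derivative y') (at t within A)" and t: "t \<in> A"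
  shows "(z has_vector_derivative z') (at t within A)"
  unfolding has_vector_derivative_def has_derivative_within_alt2
proof (intro conjI allI impI)
  show "bounded_linear (\<lambda>h. h *\<^sub>R z')" by (rule bounded_linear_scaleR_left)
  fix e :: real assume e: "0 < e"
  define k where "k = sqrt M + 1"
  have k: "0 < k" "sqrt M \<le> k" using M(2) by (simp_all add: k_def add_nonneg_pos)
  have "\<forall>e>0. \<forall>\<^sub>F s in at t within A. norm (y s - y t - (s - t) *\<^sub>R y') \<le> e * norm (s - t)"
    using deriv unfolding has_vector_derivative_def has_derivative_within_alt2 by blast
  then have "\<forall>\<^sub>F s in at t within A. norm (y s - y t - (s - t) *\<^sub>R y') \<le> (e / k) * norm (s - t)"
    using divide_pos_pos[OF e k(1)] by blast
  moreover have "\<forall>\<^sub>F s in at t within A. s \<in> A"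
    by (simp add: eventually_at_filter)
  ultimately show "\<forall>\<^sub>F s in at t within A. norm (z s - z t - (s - t) *\<^sub>R z') \<le> e * norm (s - t)"
  proof eventually_elim
    case (elim s)
    let ?Y = "y s - y t - (s - t) *\<^sub>R y'"
    have "?Y \<in> W_lsq"
      using y elim(2) t by (intro subspace_diff[OF subspace_W] subspace_scale[OF subspace_W])
    moreover have "has_grad (z s - z t - (s - t) *\<^sub>R z') (fst ?Y)"
      using has_grad_diff[OF has_grad_diff[OF z(1)[OF elim(2)] z(1)[OF t]] has_grad_scaleR[OF z(2), of "s - t"]]
      by simp
    ultimately have "norm (z s - z t - (s - t) *\<^sub>R z') \<le> sqrt M * norm ?Y"
      by (rule has_grad_bound[OF M])
    also have "\<dots> \<le> k * norm ?Y" using k by (intro mult_right_mono) auto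
    also have "\<dots> \<le> k * ((e / k) * norm (s - t))" using elim(1) k by (intro mult_left_mono) auto
    finally show ?case using k by simp
  qed
qed

text \<open>The left side of the inequality is the derivative, at the start of the orbit of
  \<open>x\<close>, of half the energy plus \<delta> times the real inner product of displacement
  and velocity. Testing the equation with the velocity gives the dissipation - |a^(1/2) v|^2;
  testing it with the displacement gives - |f|_W^2 minus the mixed term \<beta>.\<close>

lemma gen_dissipation:
  assumes M: "damping_bound \<Omega> a q M" "0 \<le> M" and a\<^sub>0: "0 < a\<^sub>0" "AE x in lebesgue_on \<Omega>. a\<^sub>0 \<le> a x"
    and \<delta>: "0 < \<delta>" "\<delta> * (1 / a\<^sub>0 + M / 2) \<le> 1 / 2" and g: "gen x y"
  obtains z where "has_grad z (fst (fst x))" "has_grad (snd x) (fst (fst y))"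
    "x \<bullet> y + \<delta> * (z \<bullet> snd y + snd x \<bullet> snd x) \<le> - (min a\<^sub>0 \<delta> / 2) * (norm x)\<^sup>2"
proof -
  have "x \<in> V" "y \<in> V" using g by (auto simp: gen_def)
  then obtain f v w h where x: "(f, v) \<in> \<H>" "x = embed \<Omega> (f, v)"
    and y: "(w, h) \<in> \<H>" "y = embed \<Omega> (w, h)"
    by (auto simp: V_def)
  have op: "damped_wave_op \<Omega> a q (f, v) (w, h)"
    using g gen_embed_iff[OF x(1) y(1)] x(2) y(2) by simp
  have f: "f \<in> W_space \<Omega> q" and v: "v \<in> form_domain \<Omega> a q" using op by (auto simp: damped_wave_op_def)
  obtain Dv where Dv: "H01_grad \<Omega> v Dv" "embed_W \<Omega> w = (lsq_of \<Omega> Dv, lsq_of \<Omega> (sqrt_mult q v))"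
    using damped_wave_op_image[OF op] .
  obtain u where u: "u \<in> form_domain \<Omega> a q" "H01_grad \<Omega> u (W_grad f)"
    "embed_W \<Omega> f = (lsq_of \<Omega> (W_grad f), lsq_of \<Omega> (sqrt_mult q u))"
    "norm (lsq_of \<Omega> (sqrt_mult a u)) \<le> sqrt M * norm (embed_W \<Omega> f)"
    using damping_bound_imp_W_function[OF M f] by metis
  define \<alpha> where "\<alpha> = lsq_of \<Omega> (sqrt_mult a v)"
  define \<beta> where "\<beta> = \<alpha> \<bullet> lsq_of \<Omega> (sqrt_mult a u)"
  have "lsq_of \<Omega> h \<bullet> lsq_of \<Omega> v = - (embed_W \<Omega> f \<bullet> embed_W \<Omega> w) - (norm \<alpha>)\<^sup>2"
    using damped_wave_op_weak[OF op v Dv(1)] by (simp add: Dv(2) \<alpha>_def power2_norm_eq_inner)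
  then have xy: "x \<bullet> y = - (norm \<alpha>)\<^sup>2"
    by (simp add: x(2) y(2) embed_def inner_commute[of "lsq_of \<Omega> v"])
  \<comment> \<open>The displacement is an admissible test function because the damping bound places
    \<open>u\<close> in the form domain; its gradient and q-part are those of
    \<open>f\<close>.\<close>
  have "lsq_of \<Omega> h \<bullet> lsq_of \<Omega> u = - (embed_W \<Omega> f \<bullet> embed_W \<Omega> f) - \<beta>"
    using damped_wave_op_weak[OF op u(1,2)] by (simp only: u(3)[symmetric] \<beta>_def \<alpha>_def)
  then have zy: "lsq_of \<Omega> u \<bullet> snd y = - (norm (embed_W \<Omega> f))\<^sup>2 - \<beta>"
    by (simp add: y(2) embed_def inner_commute[of "lsq_of \<Omega> u"] power2_norm_eq_inner)
  \<comment> \<open>The lower bound on the damping enters here: it bounds the kinetic term by the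
    dissipation.\<close>
  have "a\<^sub>0 * (norm (lsq_of \<Omega> v))\<^sup>2 = (\<integral>x. a\<^sub>0 * (norm (v x))\<^sup>2 \<partial>lebesgue_on \<Omega>)"
    using form_domain_L2(1)[OF v] by (simp add: norm_lsq_of L2_norm_power2)
  also have "\<dots> \<le> (\<integral>x. (norm (sqrt_mult a v x))\<^sup>2 \<partial>lebesgue_on \<Omega>)"
  proof (rule integral_mono_AE)
    show "integrable (lebesgue_on \<Omega>) (\<lambda>x. a\<^sub>0 * (norm (v x))\<^sup>2)"
      "integrable (lebesgue_on \<Omega>) (\<lambda>x. (norm (sqrt_mult a v x))\<^sup>2)"
      using form_domain_L2[OF v] by (simp_all add: L2_iff)
    show "AE x in lebesgue_on \<Omega>. a\<^sub>0 * (norm (v x))\<^sup>2 \<le> (norm (sqrt_mult a v x))\<^sup>2"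
      using a\<^sub>0(2)
    proof eventually_elim
      case (elim x)
      then show ?case using a\<^sub>0(1) by (simp add: sqrt_mult_def power_mult_distrib mult_right_mono)
    qed
  qed
  also have "\<dots> = (norm \<alpha>)\<^sup>2"
    using form_domain_L2(3)[OF v] by (simp add: \<alpha>_def norm_lsq_of L2_norm_power2)
  finally have Z: "a\<^sub>0 * (norm (lsq_of \<Omega> v))\<^sup>2 \<le> (norm \<alpha>)\<^sup>2" .
  have "\<bar>\<beta>\<bar> \<le> norm \<alpha> * norm (lsq_of \<Omega> (sqrt_mult a u))"
    unfolding \<beta>_def by (rule Cauchy_Schwarz_ineq2)
  also have "\<dots> \<le> norm \<alpha> * (sqrt M * norm (embed_W \<Omega> f))"
    by (rule mult_left_mono[OF u(4)]) simp
  finally have \<beta>: "\<bar>\<beta>\<bar> \<le> \<bar>norm \<alpha>\<bar> * (sqrt M * \<bar>norm (embed_W \<Omega> f)\<bar>)" by simp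
  have "(norm x)\<^sup>2 = (norm (embed_W \<Omega> f))\<^sup>2 + (norm (lsq_of \<Omega> v))\<^sup>2"
    by (simp add: x(2) embed_def norm_Pair)
  moreover have "snd x \<bullet> snd x = (norm (lsq_of \<Omega> v))\<^sup>2"
    by (simp add: x(2) embed_def power2_norm_eq_inner)
  ultimately have "x \<bullet> y + \<delta> * (lsq_of \<Omega> u \<bullet> snd y + snd x \<bullet> snd x) \<le> - (min a\<^sub>0 \<delta> / 2) * (norm x)\<^sup>2"
    using lyapunov_estimate[OF a\<^sub>0(1) \<delta>(1) M(2) \<delta>(2) Z \<beta>] by (simp add: xy zy algebra_simps)
  moreover have "has_grad (lsq_of \<Omega> u) (fst (fst x))"
    unfolding has_grad_def using u(2) by (auto simp: x(2) embed_def embed_W_def)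
  moreover have "has_grad (snd x) (fst (fst y))"
    unfolding has_grad_def using Dv by (auto simp: x(2) y(2) embed_def)
  ultimately show ?thesis using that by blast
qed

text \<open>The condition on \<delta> sqrt M keeps the mixed term below a quarter of the squared
  norm, so the functional \<open>L\<close> lies between 1/4 and 3/4 of it, and the ratio of these
  constants is the factor 3. The bound - c |U|^2 for the derivative implies - c L because L \<le>
  |U|^2.\<close>

lemma norm_S_generator_decay:
  assumes M: "damping_bound \<Omega> a q M" "0 \<le> M" and a\<^sub>0: "0 < a\<^sub>0" "AE x in lebesgue_on \<Omega>. a\<^sub>0 \<le> a x"
    and \<delta>: "0 < \<delta>" "\<delta> * (1 / a\<^sub>0 + M / 2) \<le> 1 / 2" "\<delta> * sqrt M \<le> 1 / 2"
    and g: "gen x y" and t: "0 \<le> t"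
  shows "(norm (S t x))\<^sup>2 \<le> 3 * exp (- (min a\<^sub>0 \<delta> / 2) * t) * (norm x)\<^sup>2"
proof -
  define c where "c = min a\<^sub>0 \<delta> / 2"
  have c: "0 < c" using a\<^sub>0(1) \<delta>(1) by (simp add: c_def)
  have xV: "x \<in> V" and yV: "y \<in> V" using g by (auto simp: gen_def)
  have fstW: "fst z \<in> W_lsq" if "z \<in> V" for z
    using that by (auto simp: V_eq)
  have "\<exists>z. has_grad z (fst (fst (S s x))) \<and> has_grad (snd (S s x)) (fst (fst (S s y))) \<and>
      S s x \<bullet> S s y + \<delta> * (z \<bullet> snd (S s y) + snd (S s x) \<bullet> snd (S s x)) \<le> - c * (norm (S s x))\<^sup>2"
    if s: "0 \<le> s" for s
    using gen_dissipation[OF M a\<^sub>0 \<delta>(1,2) gen_S[OF g s]] unfolding c_def by metis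
  then obtain z where z: "\<And>s. 0 \<le> s \<Longrightarrow> has_grad (z s) (fst (fst (S s x)))"
      "\<And>s. 0 \<le> s \<Longrightarrow> has_grad (snd (S s x)) (fst (fst (S s y)))"
      "\<And>s. 0 \<le> s \<Longrightarrow> S s x \<bullet> S s y + \<delta> * (z s \<bullet> snd (S s y) + snd (S s x) \<bullet> snd (S s x)) \<le> - c * (norm (S s x))\<^sup>2"
    by metis
  define L where "L s = (S s x \<bullet> S s x) / 2 + \<delta> * (z s \<bullet> snd (S s x))" for s
  define L' where "L' s = S s x \<bullet> S s y + \<delta> * (z s \<bullet> snd (S s y) + snd (S s x) \<bullet> snd (S s x))" for s
  have L_deriv: "(L has_real_derivative L' s) (at s within {0..})" if s: "0 \<le> s" for s
  proof -
    have dS: "((\<lambda>s. S s x) has_vector_derivative S s y) (at s within {0..})"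
      by (rule gen_has_vector_derivative[OF g s])
    have d_fst: "((\<lambda>s. fst (S s x)) has_vector_derivative fst (S s y)) (at s within {0..})"
      by (rule bounded_linear.has_vector_derivative[OF bounded_linear_fst dS])
    have d_snd: "((\<lambda>s. snd (S s x)) has_vector_derivative snd (S s y)) (at s within {0..})"
      by (rule bounded_linear.has_vector_derivative[OF bounded_linear_snd dS])
    \<comment> \<open>\<open>z\<close> was chosen separately at each time, with no regularity; its
      derivative comes from that of the W-component of the orbit.\<close>
    have dz: "(z has_vector_derivative snd (S s x)) (at s within {0..})"
      by (rule has_grad_has_vector_derivative[OF M _ _ _ _ d_fst])
        (use s z fstW in_V xV yV in auto)
    show ?thesis
      unfolding L_def[abs_def] L'_def
      by (rule DERIV_cong[OF DERIV_add[OF DERIV_cdivide[OF has_real_derivative_inner[OF dS dS], of 2]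
              DERIV_cmult[OF has_real_derivative_inner[OF dz d_snd], of \<delta>]]])
        (simp add: inner_commute)
  qed
  have cross: "\<delta> * \<bar>z s \<bullet> snd (S s x)\<bar> \<le> (norm (S s x))\<^sup>2 / 4" if s: "0 \<le> s" for s
  proof -
    let ?Y = "norm (fst (S s x))" and ?Z = "norm (snd (S s x))"
    have "norm (z s) \<le> sqrt M * ?Y"
      by (rule has_grad_bound[OF M fstW z(1)[OF s]]) (use s in_V xV in auto)
    then have "\<bar>z s \<bullet> snd (S s x)\<bar> \<le> sqrt M * ?Y * ?Z"
      using order_trans[OF Cauchy_Schwarz_ineq2 mult_right_mono] by (metis norm_ge_zero)
    then have "\<delta> * \<bar>z s \<bullet> snd (S s x)\<bar> \<le> \<delta> * (sqrt M * ?Y * ?Z)"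
      using \<delta>(1) by (intro mult_left_mono) auto
    also have "\<dots> = (\<delta> * sqrt M) * (?Y * ?Z)" by simp
    also have "\<dots> \<le> 1 / 2 * (?Y * ?Z)" by (rule mult_right_mono[OF \<delta>(3)]) simp
    also have "\<dots> \<le> (?Y\<^sup>2 + ?Z\<^sup>2) / 4" using sum_squares_bound[of ?Y ?Z] by (simp add: mult_ac)
    also have "?Y\<^sup>2 + ?Z\<^sup>2 = (norm (S s x))\<^sup>2"
      by (simp add: norm_prod_def)
    finally show ?thesis .
  qed
  have L_bounds: "(norm (S s x))\<^sup>2 / 4 \<le> L s" "L s \<le> 3 / 4 * (norm (S s x))\<^sup>2" if s: "0 \<le> s" for s
  proof -
    have "\<bar>\<delta> * (z s \<bullet> snd (S s x))\<bar> \<le> (norm (S s x))\<^sup>2 / 4"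
      using cross[OF s] \<delta>(1) by (simp add: abs_mult)
    then show "(norm (S s x))\<^sup>2 / 4 \<le> L s" "L s \<le> 3 / 4 * (norm (S s x))\<^sup>2"
      unfolding L_def power2_norm_eq_inner[symmetric] by linarith+
  qed
  have L'_le: "L' s \<le> - c * L s" if s: "0 \<le> s" for s
  proof -
    have "L' s \<le> - c * (norm (S s x))\<^sup>2" using z(3)[OF s] by (simp add: L'_def)
    moreover have "L s \<le> (norm (S s x))\<^sup>2"
      using L_bounds(2)[OF s] zero_le_power2[of "norm (S s x)"] by linarith
    then have "c * L s \<le> c * (norm (S s x))\<^sup>2"
      using c by (intro mult_left_mono) auto
    ultimately show ?thesis by simp
  qed
  have "L t \<le> exp (- c * t) * L 0"
    by (rule exponential_decay_of_derivative[OF L_deriv L'_le t])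
  also have "\<dots> \<le> exp (- c * t) * (3 / 4 * (norm x)\<^sup>2)"
    using L_bounds(2)[of 0] S_zero[OF xV] by (intro mult_left_mono) auto
  finally show ?thesis using L_bounds(1)[OF t] by (simp add: c_def)
qed

lemma damping_bound_imp_decay:
  assumes M: "damping_bound \<Omega> a q M" "0 < M" and a\<^sub>0: "0 < a\<^sub>0" "AE x in lebesgue_on \<Omega>. a\<^sub>0 \<le> a x"
  shows "\<exists>\<nu>>0. \<exists>C>0. decay_estimate \<Omega> q T \<nu> C"
proof -
  define p where "p = 1 / a\<^sub>0 + M / 2"
  \<comment> \<open>The smaller of two thresholds: the first lets the dissipation absorb the kinetic
    and mixed terms, the second makes the functional equivalent to the energy.\<close>
  define \<delta> where "\<delta> = min (1 / (2 * p)) (1 / (2 * sqrt M))"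
  have p: "0 < p" using M(2) a\<^sub>0(1) by (simp add: p_def add_pos_pos)
  have \<delta>: "0 < \<delta>" using p M(2) by (simp add: \<delta>_def)
  have "\<delta> * p \<le> 1 / (2 * p) * p"
    using p by (intro mult_right_mono) (auto simp: \<delta>_def)
  then have \<delta>1: "\<delta> * (1 / a\<^sub>0 + M / 2) \<le> 1 / 2" using p by (simp add: p_def[symmetric])
  have "\<delta> * sqrt M \<le> 1 / (2 * sqrt M) * sqrt M"
    using M(2) by (intro mult_right_mono) (auto simp: \<delta>_def)
  then have \<delta>2: "\<delta> * sqrt M \<le> 1 / 2" using M(2) by simp
  \<comment> \<open>The squared norm decays at the rate \<open>min a\<^sub>0 \<delta> / 2\<close>,
    the norm itself at half of it.\<close>
  define \<nu> where "\<nu> = min a\<^sub>0 \<delta> / 4"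
  have \<nu>: "0 < \<nu>" using a\<^sub>0(1) \<delta> by (simp add: \<nu>_def)
  have dom: "norm (S t x) \<le> 2 * exp (- \<nu> * t) * norm x" if "gen x y" "0 \<le> t" for t x y
  proof (rule power2_le_imp_le)
    have "(norm (S t x))\<^sup>2 \<le> 3 * exp (- (min a\<^sub>0 \<delta> / 2) * t) * (norm x)\<^sup>2"
      by (rule norm_S_generator_decay[OF M(1) less_imp_le[OF M(2)] a\<^sub>0 \<delta> \<delta>1 \<delta>2 that])
    \<comment> \<open>Raising 3 to 4 makes the right side a perfect square.\<close>
    also have "\<dots> \<le> 4 * exp (- (min a\<^sub>0 \<delta> / 2) * t) * (norm x)\<^sup>2"
      by (intro mult_right_mono) auto
    also have "exp (- (min a\<^sub>0 \<delta> / 2) * t) = (exp (- \<nu> * t))\<^sup>2"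
      by (simp add: exp_double[symmetric] \<nu>_def)
    finally show "(norm (S t x))\<^sup>2 \<le> (2 * exp (- \<nu> * t) * norm x)\<^sup>2"
      by (simp add: power_mult_distrib)
  qed simp
  have "norm (S t x) \<le> 2 * exp (- \<nu> * t) * norm x" if t: "0 \<le> t" and x: "x \<in> V" for t x
  proof (rule field_le_epsilon)
    fix e :: real assume e: "0 < e"
    \<comment> \<open>Replacing \<open>x\<close> by a nearby element of the domain costs
      \<open>k\<close> times the distance in the decayed term and once the distance by contraction,
      hence the tolerance e / (1 + k).\<close>
    define k where "k = 2 * exp (- \<nu> * t)"
    have k: "0 < k" by (simp add: k_def)
    then obtain x' y where x': "gen x' y" "norm (x' - x) < e / (1 + k)"
      using gen_dense[OF x, of "e / (1 + k)"] e by auto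
    have x'V: "x' \<in> V" using x'(1) by (simp add: gen_def)
    have "norm (S t x) \<le> norm (S t x') + norm (S t x - S t x')"
      using norm_triangle_ineq[of "S t x'" "S t x - S t x'"] by simp
    also have "norm (S t x - S t x') \<le> norm (x' - x)"
      using contraction[OF t V_diff[OF x x'V]] by (simp add: S_diff t x x'V norm_minus_commute)
    also have "norm (S t x') \<le> k * norm x'" unfolding k_def by (rule dom[OF x'(1) t])
    also have "norm x' \<le> norm x + norm (x' - x)"
      using norm_triangle_ineq[of x "x' - x"] by simp
    finally have "norm (S t x) \<le> k * (norm x + norm (x' - x)) + norm (x' - x)"
      using k by simp
    also have "\<dots> = k * norm x + (1 + k) * norm (x' - x)" by (simp add: algebra_simps)
    also have "\<dots> \<le> k * norm x + e"
      using x'(2) k by (simp add: field_simps less_imp_le)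
    finally show "norm (S t x) \<le> 2 * exp (- \<nu> * t) * norm x + e" by (simp add: k_def)
  qed
  then have "decay_estimate \<Omega> q T \<nu> (3 * 2)" by (rule norm_S_imp_decay_estimate)
  then show ?thesis using \<nu> by (intro exI[of _ \<nu>] conjI exI[of _ "3 * 2"]) auto
qed

end

theorem proposition1p1:
  fixes \<Omega> :: "(real^'d) set"
    and a q :: "real^'d \<Rightarrow> real"
    and T :: "real \<Rightarrow> 'd state \<Rightarrow> 'd state"
  assumes "open \<Omega>" and "\<Omega> \<noteq> {}"
    and "a \<in> L1_loc \<Omega>" and "AE x in lebesgue_on \<Omega>. 0 \<le> a x"
    and "q \<in> L1_loc \<Omega>" and "AE x in lebesgue_on \<Omega>. 0 \<le> q x"
    and "damped_wave_semigroup \<Omega> a q T"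
  shows "((\<exists>\<nu>>0. \<exists>C>0. decay_estimate \<Omega> q T \<nu> C) \<longrightarrow> (\<exists>M>0. damping_bound \<Omega> a q M)) \<and>
         ((\<exists>a\<^sub>0>0. AE x in lebesgue_on \<Omega>. a\<^sub>0 \<le> a x) \<longrightarrow>
            ((\<exists>\<nu>>0. \<exists>C>0. decay_estimate \<Omega> q T \<nu> C) \<longleftrightarrow> (\<exists>M>0. damping_bound \<Omega> a q M)))"
proof -
  interpret damped_wave \<Omega> a q T
    using assms by unfold_locales
  have 1: "\<exists>M>0. damping_bound \<Omega> a q M" if dec: "\<exists>\<nu>>0. \<exists>C>0. decay_estimate \<Omega> q T \<nu> C"
  proof -
    obtain \<nu> C where \<nu>: "0 < \<nu>" and C: "0 < C" and decay: "decay_estimate \<Omega> q T \<nu> C"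
      using dec by blast
    then have "0 < C / \<nu> + (C / \<nu>)\<^sup>2" by (simp add: add_pos_pos)
    then show ?thesis using decay_imp_damping_bound[OF decay \<nu> C] by blast
  qed
  moreover have "\<exists>\<nu>>0. \<exists>C>0. decay_estimate \<Omega> q T \<nu> C"
    if "\<exists>a\<^sub>0>0. AE x in lebesgue_on \<Omega>. a\<^sub>0 \<le> a x" "\<exists>M>0. damping_bound \<Omega> a q M"
    using that damping_bound_imp_decay by blast
  ultimately show ?thesis by blast
qed

end
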